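(* Let $0<\epsilon<1/4$ and let $I:M_\lambda\to\mathbb{R}^3$ be a paper Moebius band with $\lambda<\sqrt3+\epsilon$. Then there exist a homeomorphism $\phi:\partial M_{\sqrt3}\to\partial M_\lambda$ and an isometry $\psi:\mathbb{R}^3\to\mathbb{R}^3$ such that $$\sup_{p\in\partial M_{\sqrt3}}\|I_0(p)-\psi(I(\phi(p)))\|<6\sqrt{\epsilon},$$ where $I_0:M_{\sqrt3}\to\mathbb{R}^3$ is the triangular Moebius band map.
   Context: For $\lambda>0$, $M_\lambda$ is the flat Moebius band obtained from a $1\times\lambda$ rectangle by identifying its length-$1$ sides with a flip; equivalently, the quotient of the strip $\mathbb{R}\times[0,1]$ by the group generated by $(x,y)\mapsto(x+\lambda,1-y)$. Its boundary $\partial M_\lambda$ is a single circle. A paper Moebius band (short for smooth embedded paper Moebius band) of aspect ratio $\lambda$ is an infinitely differentiable isometric embedding $I:M_\lambda\to\mathbb{R}^3$ (isometric in the Riemannian sense); one writes $\Omega=I(M_\lambda)$. The triangular Moebius band map $I_0:M_{\sqrt3}\to\mathbb{R}^3$ is the following continuous, piecewise isometric (non-injective) map, well defined up to isometry. A fundamental domain of $M_{\sqrt3}$ is the trapezoid in $\mathbb{R}\times[0,1]$ with bottom vertices $(0,0),(4/\sqrt3,0)$ and top vertices $(1/\sqrt3,1),(\sqrt3,1)$. The points $P=(1/\sqrt3,1)$, $Q=(\sqrt3,1)$, $R=(2/\sqrt3,0)$ span an equilateral triangle of side $2/\sqrt3$, and the segments $PR$ and $QR$ divide the trapezoid into three equilateral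 triangles. $I_0$ is the inclusion of the plane into $\mathbb{R}^3$ composed with the map which is the identity on the triangle $PQR$, the reflection in the line $PR$ on the left triangle, and the reflection in the line $QR$ on the right triangle. (This respects the identification of the two slanted sides of the trapezoid, in which $(0,0)\sim(\sqrt3,1)$ and $(1/\sqrt3,1)\sim(4/\sqrt3,0)$.) Its image is a solid equilateral triangle of perimeter $2\sqrt3$. *)

theory Defs
  imports "HOL-Analysis.Analysis"
begin

section \<open>The flat Moebius band\<close>

definition strip :: "(real \<times> real) set" where
  "strip = UNIV \<times> {0..1}"

text \<open>The \<open>k\<close>-th power of the glide reflection \<open>(x, y) \<mapsto> (x + l, 1 - y)\<close>
  (see \<open>glide_generator\<close> below); the group generated by it is the set of all \<open>glide l k\<close>.\<close>

definition glide :: "real \<Rightarrow> int \<Rightarrow> real \<times> real \<Rightarrow> real \<times> real" where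
  "glide l k p = (fst p + of_int k * l, if even k then snd p else 1 - snd p)"

lemma glide_generator: "glide l 1 (x, y) = (x + l, 1 - y)"
  by (simp add: glide_def)

lemma glide_0: "glide l 0 p = p"
  by (simp add: glide_def)

lemma glide_add: "glide l (j + k) p = glide l j (glide l k p)"
  by (auto simp: glide_def algebra_simps)

lemma glide_in_strip: "p \<in> strip \<Longrightarrow> glide l k p \<in> strip"
  by (auto simp: glide_def strip_def)

text \<open>Points of the band are orbits, i.e. sets of points of the strip.\<close>

type_synonym band_point = "(real \<times> real) set"

definition moebius_class :: "real \<Rightarrow> real \<times> real \<Rightarrow> band_point" where
  "moebius_class l p = range (\<lambda>k. glide l k p)"

definition moebius :: "real \<Rightarrow> band_point set" where
  "moebius l = moebius_class l ` strip"

definition moebius_boundary :: "real \<Rightarrow> band_point set" where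
  "moebius_boundary l = moebius_class l ` (UNIV \<times> {0, 1})"

text \<open>The quotient topology; see \<open>quotient_map_moebius_class\<close>.\<close>

definition moebius_topology :: "real \<Rightarrow> band_point topology" where
  "moebius_topology l = topology (\<lambda>U. U \<subseteq> moebius l \<and>
     openin (top_of_set strip) {p \<in> strip. moebius_class l p \<in> U})"

lemma moebius_class_eq_iff:
  "moebius_class l p = moebius_class l q \<longleftrightarrow> (\<exists>k. q = glide l k p)"
proof
  assume "moebius_class l p = moebius_class l q"
  moreover have "q \<in> moebius_class l q"
    unfolding moebius_class_def by (rule range_eqI[of _ _ 0]) (simp add: glide_0)
  ultimately show "\<exists>k. q = glide l k p"
    by (auto simp: moebius_class_def)
next
  assume "\<exists>k. q = glide l k p"
  then obtain k where q: "q = glide l k p" ..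
  have "glide l j p \<in> moebius_class l q" for j
    unfolding moebius_class_def
    by (rule range_eqI[of _ _ "j - k"]) (simp add: q flip: glide_add)
  moreover have "glide l j q \<in> moebius_class l p" for j
    unfolding moebius_class_def
    by (rule range_eqI[of _ _ "j + k"]) (simp add: q glide_add)
  ultimately show "moebius_class l p = moebius_class l q"
    by (auto simp: moebius_class_def)
qed

lemma openin_moebius_topology:
  "openin (moebius_topology l) U \<longleftrightarrow>
     U \<subseteq> moebius l \<and> openin (top_of_set strip) {p \<in> strip. moebius_class l p \<in> U}"
proof -
  let ?O = "\<lambda>U. U \<subseteq> moebius l \<and> openin (top_of_set strip) {p \<in> strip. moebius_class l p \<in> U}"
  have "istopology ?O"
    unfolding istopology_def
  proof (intro conjI allI impI; (elim conjE)?)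
    fix S T
    assume "S \<subseteq> moebius l" "T \<subseteq> moebius l"
      "openin (top_of_set strip) {p \<in> strip. moebius_class l p \<in> S}"
      "openin (top_of_set strip) {p \<in> strip. moebius_class l p \<in> T}"
    moreover have "{p \<in> strip. moebius_class l p \<in> S \<inter> T} =
      {p \<in> strip. moebius_class l p \<in> S} \<inter> {p \<in> strip. moebius_class l p \<in> T}" by auto
    ultimately show "S \<inter> T \<subseteq> moebius l"
      "openin (top_of_set strip) {p \<in> strip. moebius_class l p \<in> S \<inter> T}" by auto
  next
    fix K
    assume K: "\<forall>U\<in>K. ?O U"
    then show "\<Union>K \<subseteq> moebius l" by auto
    have "{p \<in> strip. moebius_class l p \<in> \<Union>K} =
      (\<Union>U\<in>K. {p \<in> strip. moebius_class l p \<in> U})" by auto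
    with K show "openin (top_of_set strip) {p \<in> strip. moebius_class l p \<in> \<Union>K}"
      by (auto intro!: openin_Union)
  qed
  then show ?thesis by (simp add: moebius_topology_def)
qed

lemma topspace_moebius_topology: "topspace (moebius_topology l) = moebius l"
proof -
  have "{p \<in> strip. moebius_class l p \<in> moebius l} = strip"
    by (auto simp: moebius_def)
  then have "openin (moebius_topology l) (moebius l)"
    by (simp add: openin_moebius_topology)
  then show ?thesis
    by (metis openin_moebius_topology openin_subset openin_topspace subset_antisym)
qed

lemma quotient_map_moebius_class:
  "quotient_map (top_of_set strip) (moebius_topology l) (moebius_class l)"
  unfolding quotient_map_def topspace_moebius_topology
  by (auto simp: openin_moebius_topology moebius_def)


section \<open>Paper Moebius bands\<close>

primrec C_on :: "nat \<Rightarrow> 'a::real_normed_vector set \<Rightarrow> ('a \<Rightarrow> 'b::real_normed_vector) \<Rightarrow> bool" where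
  "C_on 0 U f \<longleftrightarrow> continuous_on U f"
| "C_on (Suc n) U f \<longleftrightarrow> f differentiable_on U \<and>
     (\<forall>v. C_on n U (\<lambda>x. frechet_derivative f (at x) v))"

text \<open>\<open>C_on\<close> is only meaningful for open sets. On an arbitrary set, such as the closed strip,
  infinite differentiability means the existence of local smooth extensions.\<close>

definition smooth :: "'a::real_normed_vector set \<Rightarrow> ('a \<Rightarrow> 'b::real_normed_vector) \<Rightarrow> bool" where
  "smooth S f \<longleftrightarrow> (\<forall>p\<in>S. \<exists>U g. open U \<and> p \<in> U \<and> (\<forall>n. C_on n U g) \<and> (\<forall>x\<in>U \<inter> S. g x = f x))"

definition riemannian_isometric :: "'a::real_inner set \<Rightarrow> ('a \<Rightarrow> 'b::real_inner) \<Rightarrow> bool" where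
  "riemannian_isometric S f \<longleftrightarrow> (\<forall>p\<in>S. \<exists>D. (f has_derivative D) (at p within S) \<and>
     (\<forall>u v. inner (D u) (D v) = inner u v))"

text \<open>The smooth structure and the flat metric of the band are those for which the projection
  from the strip is a local isometry, so both are tested on the lift to the strip.\<close>

definition paper_moebius_band :: "real \<Rightarrow> (band_point \<Rightarrow> real ^ 3) \<Rightarrow> bool" where
  "paper_moebius_band l I \<longleftrightarrow>
     smooth strip (I \<circ> moebius_class l) \<and>
     riemannian_isometric strip (I \<circ> moebius_class l) \<and>
     embedding_map (moebius_topology l) euclidean I"


section \<open>The triangular Moebius band\<close>

definition vertex_P :: "real \<times> real" where "vertex_P = (1 / sqrt 3, 1)"
definition vertex_Q :: "real \<times> real" where "vertex_Q = (sqrt 3, 1)"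
definition vertex_R :: "real \<times> real" where "vertex_R = (2 / sqrt 3, 0)"

definition trapezoid :: "(real \<times> real) set" where
  "trapezoid = convex hull {(0, 0), (4 / sqrt 3, 0), vertex_P, vertex_Q}"

text \<open>Reflection in the line through the distinct points \<open>a\<close> and \<open>b\<close>.\<close>

definition reflect_line :: "'a::real_inner \<Rightarrow> 'a \<Rightarrow> 'a \<Rightarrow> 'a" where
  "reflect_line a b p =
     2 *\<^sub>R (a + (inner (p - a) (b - a) / inner (b - a) (b - a)) *\<^sub>R (b - a)) - p"

text \<open>On the trapezoid, the last case is exactly that of points of the right triangle.\<close>

definition triangular_fold :: "real \<times> real \<Rightarrow> real \<times> real" where
  "triangular_fold p =
     (if p \<in> convex hull {vertex_P, vertex_Q, vertex_R} then p
      else if p \<in> convex hull {(0, 0), vertex_P, vertex_R} then reflect_line vertex_P vertex_R p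
      else reflect_line vertex_Q vertex_R p)"

definition plane_inclusion :: "real \<times> real \<Rightarrow> real ^ 3" where
  "plane_inclusion p = vector [fst p, snd p, 0]"

text \<open>An orbit meets the trapezoid in one point, or in two points of the slanted sides that have
  the same image; see \<open>moebius_class_meets_trapezoid\<close> and \<open>triangular_map_eq\<close>.\<close>

definition triangular_map :: "band_point \<Rightarrow> real ^ 3" where
  "triangular_map c = the_elem ((plane_inclusion \<circ> triangular_fold) ` (c \<inter> trapezoid))"

lemmas triangular_vertex_defs = vertex_P_def vertex_Q_def vertex_R_def

lemma sqrt3_simps:
  "sqrt 3 * (a / sqrt 3) = a" "sqrt 3 * sqrt 3 = 3" "sqrt 3 * (sqrt 3 * a) = 3 * a"
  by (simp_all flip: mult.assoc)

lemma convex_slab: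
  fixes a b c :: real
  shows "convex {p. a * fst p + b * snd p \<le> c}"
proof -
  have "{p. a * fst p + b * snd p \<le> c} = {p. inner (a, b) p \<le> c}"
    by (auto simp: inner_prod_def)
  then show ?thesis by (simp add: convex_halfspace_le)
qed

lemma middle_triangle_eq:
  "convex hull {vertex_P, vertex_Q, vertex_R} =
     {(x, y). y \<le> 1 \<and> 2 \<le> sqrt 3 * x + y \<and> sqrt 3 * x - y \<le> 2}" (is "_ = ?T")
proof
  have *: "?T = {p. 0 * fst p + 1 * snd p \<le> 1} \<inter> {p. - sqrt 3 * fst p + (-1) * snd p \<le> -2}
      \<inter> {p. sqrt 3 * fst p + (-1) * snd p \<le> 2}" by auto
  have "convex ?T" unfolding * by (intro convex_Int convex_slab)
  then show "convex hull {vertex_P, vertex_Q, vertex_R} \<subseteq> ?T"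
    by (intro hull_minimal) (auto simp: triangular_vertex_defs sqrt3_simps)
  show "?T \<subseteq> convex hull {vertex_P, vertex_Q, vertex_R}"
  proof
    fix p assume "p \<in> ?T"
    then obtain x y where p: "p = (x, y)" "y \<le> 1" "2 \<le> sqrt 3 * x + y" "sqrt 3 * x - y \<le> 2" by auto
    define u v w where "u = (2 + y - sqrt 3 * x) / 2" "v = (sqrt 3 * x + y - 2) / 2" "w = 1 - y"
    have "0 \<le> u" "0 \<le> v" "0 \<le> w" "u + v + w = 1" using p by (auto simp: u_v_w_def field_simps)
    moreover have "p = u *\<^sub>R vertex_P + v *\<^sub>R vertex_Q + w *\<^sub>R vertex_R"
      by (simp add: p triangular_vertex_defs u_v_w_def field_simps)
    ultimately show "p \<in> convex hull {vertex_P, vertex_Q, vertex_R}"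
      unfolding convex_hull_3 by blast
  qed
qed

lemma left_triangle_eq:
  "convex hull {(0, 0), vertex_P, vertex_R} =
     {(x, y). 0 \<le> y \<and> y \<le> sqrt 3 * x \<and> sqrt 3 * x + y \<le> 2}" (is "_ = ?T")
proof
  have *: "?T = {p. 0 * fst p + (-1) * snd p \<le> 0} \<inter> {p. - sqrt 3 * fst p + 1 * snd p \<le> 0}
      \<inter> {p. sqrt 3 * fst p + 1 * snd p \<le> 2}" by auto
  have "convex ?T" unfolding * by (intro convex_Int convex_slab)
  then show "convex hull {(0, 0), vertex_P, vertex_R} \<subseteq> ?T"
    by (intro hull_minimal) (auto simp: triangular_vertex_defs sqrt3_simps)
  show "?T \<subseteq> convex hull {(0, 0), vertex_P, vertex_R}"
  proof
    fix p assume "p \<in> ?T"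
    then obtain x y where p: "p = (x, y)" "0 \<le> y" "y \<le> sqrt 3 * x" "sqrt 3 * x + y \<le> 2" by auto
    define u v w where "u = (2 - y - sqrt 3 * x) / 2" "v = y" "w = (sqrt 3 * x - y) / 2"
    have "0 \<le> u" "0 \<le> v" "0 \<le> w" "u + v + w = 1" using p by (auto simp: u_v_w_def field_simps)
    moreover have "p = u *\<^sub>R (0, 0) + v *\<^sub>R vertex_P + w *\<^sub>R vertex_R"
      by (simp add: p triangular_vertex_defs u_v_w_def field_simps)
    ultimately show "p \<in> convex hull {(0, 0), vertex_P, vertex_R}"
      unfolding convex_hull_3 by blast
  qed
qed

lemma right_triangle_eq:
  "convex hull {(4 / sqrt 3, 0), vertex_Q, vertex_R} =
     {(x, y). 0 \<le> y \<and> 2 \<le> sqrt 3 * x - y \<and> sqrt 3 * x + y \<le> 4}" (is "_ = ?T")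
proof
  have *: "?T = {p. 0 * fst p + (-1) * snd p \<le> 0} \<inter> {p. - sqrt 3 * fst p + 1 * snd p \<le> -2}
      \<inter> {p. sqrt 3 * fst p + 1 * snd p \<le> 4}" by auto
  have "convex ?T" unfolding * by (intro convex_Int convex_slab)
  then show "convex hull {(4 / sqrt 3, 0), vertex_Q, vertex_R} \<subseteq> ?T"
    by (intro hull_minimal) (auto simp: triangular_vertex_defs sqrt3_simps)
  show "?T \<subseteq> convex hull {(4 / sqrt 3, 0), vertex_Q, vertex_R}"
  proof
    fix p assume "p \<in> ?T"
    then obtain x y where p: "p = (x, y)" "0 \<le> y" "2 \<le> sqrt 3 * x - y" "sqrt 3 * x + y \<le> 4" by auto
    define u v w where "u = (sqrt 3 * x - y - 2) / 2" "v = y" "w = (4 - y - sqrt 3 * x) / 2"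
    have "0 \<le> u" "0 \<le> v" "0 \<le> w" "u + v + w = 1" using p by (auto simp: u_v_w_def field_simps)
    moreover have "p = u *\<^sub>R (4 / sqrt 3, 0) + v *\<^sub>R vertex_Q + w *\<^sub>R vertex_R"
      by (simp add: p triangular_vertex_defs u_v_w_def field_simps)
    ultimately show "p \<in> convex hull {(4 / sqrt 3, 0), vertex_Q, vertex_R}"
      unfolding convex_hull_3 by blast
  qed
qed

lemma trapezoid_eq:
  "trapezoid = {(x, y). 0 \<le> y \<and> y \<le> 1 \<and> y \<le> sqrt 3 * x \<and> sqrt 3 * x + y \<le> 4}" (is "_ = ?T")
proof
  have *: "?T = {p. 0 * fst p + (-1) * snd p \<le> 0} \<inter> {p. 0 * fst p + 1 * snd p \<le> 1}
      \<inter> {p. - sqrt 3 * fst p + 1 * snd p \<le> 0} \<inter> {p. sqrt 3 * fst p + 1 * snd p \<le> 4}" by auto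
  have "convex ?T" unfolding * by (intro convex_Int convex_slab)
  then show "trapezoid \<subseteq> ?T" unfolding trapezoid_def
    by (intro hull_minimal) (auto simp: triangular_vertex_defs sqrt3_simps)
  have R: "vertex_R \<in> trapezoid"
  proof -
    have "vertex_R = (1/2) *\<^sub>R (0, 0) + (1/2) *\<^sub>R (4 / sqrt 3, 0)"
      by (simp add: vertex_R_def)
    moreover have "convex trapezoid" "(0, 0) \<in> trapezoid" "(4 / sqrt 3, 0) \<in> trapezoid"
      by (auto simp: trapezoid_def hull_inc)
    ultimately show ?thesis by (metis convexD field_sum_of_halves half_bounded_equal
          less_eq_real_def zero_le_divide_1_iff zero_le_numeral)
  qed
  have V: "vertex_P \<in> trapezoid" "vertex_Q \<in> trapezoid" "(0, 0) \<in> trapezoid"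
    "(4 / sqrt 3, 0) \<in> trapezoid" "convex trapezoid"
    by (auto simp: trapezoid_def hull_inc)
  have "convex hull {vertex_P, vertex_Q, vertex_R} \<subseteq> trapezoid"
    "convex hull {(0, 0), vertex_P, vertex_R} \<subseteq> trapezoid"
    "convex hull {(4 / sqrt 3, 0), vertex_Q, vertex_R} \<subseteq> trapezoid"
    by (rule hull_minimal; use R V in simp)+
  moreover have "?T \<subseteq> convex hull {vertex_P, vertex_Q, vertex_R} \<union>
      convex hull {(0, 0), vertex_P, vertex_R} \<union> convex hull {(4 / sqrt 3, 0), vertex_Q, vertex_R}"
    unfolding middle_triangle_eq left_triangle_eq right_triangle_eq by auto
  ultimately show "?T \<subseteq> trapezoid" by blast
qed

lemma trapezoid_eq_triangles:
  "trapezoid = convex hull {(0, 0), vertex_P, vertex_R} \<union>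
     convex hull {vertex_P, vertex_Q, vertex_R} \<union>
     convex hull {(4 / sqrt 3, 0), vertex_Q, vertex_R}"
  unfolding trapezoid_eq middle_triangle_eq left_triangle_eq right_triangle_eq by auto

lemma divide_sqrt3: "a / sqrt 3 = sqrt 3 * a / 3"
  by (simp add: field_simps)

lemma reflect_line_PR:
  "reflect_line vertex_P vertex_R (x, y) =
     ((2 * sqrt 3 - x - sqrt 3 * y) / 2, (2 - sqrt 3 * x + y) / 2)"
proof -
  have *: "vertex_P = (sqrt 3 / 3, 1)" "vertex_R = (2 * sqrt 3 / 3, 0)"
    by (simp_all add: triangular_vertex_defs divide_sqrt3)
  have **: "inner (vertex_R - vertex_P) (vertex_R - vertex_P) = 4 / 3"
    by (simp add: * inner_prod_def field_simps)
  show ?thesis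
    unfolding reflect_line_def ** by (simp add: * inner_prod_def sqrt3_simps field_simps)
qed

lemma reflect_line_QR:
  "reflect_line vertex_Q vertex_R (x, y) =
     ((2 * sqrt 3 - x + sqrt 3 * y) / 2, (sqrt 3 * x - 2 + y) / 2)"
proof -
  have *: "vertex_Q = (sqrt 3, 1)" "vertex_R = (2 * sqrt 3 / 3, 0)"
    by (simp_all add: triangular_vertex_defs divide_sqrt3)
  have **: "inner (vertex_R - vertex_Q) (vertex_R - vertex_Q) = 4 / 3"
    by (simp add: * inner_prod_def field_simps)
  show ?thesis
    unfolding reflect_line_def ** by (simp add: * inner_prod_def sqrt3_simps field_simps)
qed

lemma triangular_fold_left_side:
  assumes "0 \<le> y" "y \<le> 1"
  shows "triangular_fold (y / sqrt 3, y) = (sqrt 3 - 2 * y / sqrt 3, 1)"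
proof (cases "y = 1")
  case True
  then show ?thesis
    by (simp add: triangular_fold_def middle_triangle_eq sqrt3_simps) (simp add: divide_sqrt3)
next
  case False
  then have "triangular_fold (y / sqrt 3, y) = reflect_line vertex_P vertex_R (y / sqrt 3, y)"
    using assms by (simp add: triangular_fold_def middle_triangle_eq left_triangle_eq sqrt3_simps)
  then show ?thesis
    by (simp add: reflect_line_PR sqrt3_simps) (simp add: divide_sqrt3)
qed

lemma triangular_fold_right_side:
  assumes "0 \<le> y" "y \<le> 1"
  shows "triangular_fold (y / sqrt 3 + sqrt 3, 1 - y) = (sqrt 3 - 2 * y / sqrt 3, 1)"
proof (cases "y = 0")
  case True
  then show ?thesis
    by (simp add: triangular_fold_def middle_triangle_eq)
next
  case False
  then have "triangular_fold (y / sqrt 3 + sqrt 3, 1 - y) =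
    reflect_line vertex_Q vertex_R (y / sqrt 3 + sqrt 3, 1 - y)"
    using assms
    by (simp add: triangular_fold_def middle_triangle_eq left_triangle_eq distrib_left sqrt3_simps)
  then show ?thesis
    by (simp add: reflect_line_QR sqrt3_simps algebra_simps) (simp add: divide_sqrt3 field_simps)
qed

lemma glide_in_trapezoid:
  assumes "(x, y) \<in> trapezoid" "glide (sqrt 3) k (x, y) \<in> trapezoid"
  shows "k = 0 \<or> (k = 1 \<and> sqrt 3 * x = y) \<or> (k = - 1 \<and> sqrt 3 * x + y = 4)"
proof -
  define X where "X = sqrt 3 * x"
  define y' where "y' = (if even k then y else 1 - y)"
  have *: "sqrt 3 * (x + of_int k * sqrt 3) = X + 3 * of_int k"
    by (simp add: X_def algebra_simps sqrt3_simps)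
  have 1: "0 \<le> y" "y \<le> 1" "y \<le> X" "X + y \<le> 4"
    using assms(1) by (auto simp: trapezoid_eq X_def)
  have 2: "0 \<le> y'" "y' \<le> X + 3 * of_int k" "X + 3 * of_int k + y' \<le> 4"
    using assms(2) by (auto simp: trapezoid_eq glide_def * y'_def)
  have "3 * real_of_int k \<le> 4" "- 4 \<le> 3 * real_of_int k" using 1 2 by linarith+
  then have "k = 0 \<or> k = 1 \<or> k = - 1" by linarith
  then show ?thesis using 1 2 by (auto simp: y'_def X_def)
qed

lemma triangular_fold_glide:
  assumes "p \<in> trapezoid" "glide (sqrt 3) k p \<in> trapezoid"
  shows "triangular_fold (glide (sqrt 3) k p) = triangular_fold p"
proof -
  have side: "triangular_fold (glide (sqrt 3) 1 q) = triangular_fold q"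
    if "q \<in> trapezoid" "sqrt 3 * fst q = snd q" for q
  proof -
    obtain x y where xy: "q = (x, y)" by fastforce
    with that(2) have "y = sqrt 3 * x" by simp
    then have "x = y / sqrt 3" by simp
    with xy have q: "q = (y / sqrt 3, y)" by simp
    have "0 \<le> y" "y \<le> 1" using that(1) by (auto simp: xy trapezoid_eq)
    then show ?thesis
      by (simp add: q glide_def triangular_fold_left_side triangular_fold_right_side)
  qed
  obtain x y where p: "p = (x, y)" by fastforce
  consider "k = 0" | "k = 1" "sqrt 3 * x = y" | "k = - 1" "sqrt 3 * x + y = 4"
    using glide_in_trapezoid assms unfolding p by blast
  then show ?thesis
  proof cases
    case 1 then show ?thesis by (simp add: glide_0)
  next
    case 2 then show ?thesis using side[of p] assms p by simp
  next
    case 3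
    let ?q = "glide (sqrt 3) (- 1) p"
    have "sqrt 3 * fst ?q = snd ?q"
      using 3 by (simp add: p glide_def algebra_simps)
    moreover have "glide (sqrt 3) 1 ?q = p"
      by (simp add: glide_0 flip: glide_add)
    ultimately show ?thesis using side[of ?q] assms 3 by simp
  qed
qed

lemma triangular_map_eq:
  assumes "p \<in> trapezoid"
  shows "triangular_map (moebius_class (sqrt 3) p) = plane_inclusion (triangular_fold p)"
proof -
  have "p \<in> moebius_class (sqrt 3) p"
    unfolding moebius_class_def by (rule range_eqI[of _ _ 0]) (simp add: glide_0)
  then have "(plane_inclusion \<circ> triangular_fold) ` (moebius_class (sqrt 3) p \<inter> trapezoid) =
    {plane_inclusion (triangular_fold p)}"
    using assms by (auto simp: moebius_class_def triangular_fold_glide)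
  then show ?thesis by (simp add: triangular_map_def)
qed

lemma moebius_class_meets_trapezoid:
  assumes "c \<in> moebius (sqrt 3)"
  shows "\<exists>p\<in>trapezoid. c = moebius_class (sqrt 3) p"
proof -
  obtain x y where c: "c = moebius_class (sqrt 3) (x, y)" and y: "0 \<le> y" "y \<le> 1"
    using assms by (auto simp: moebius_def strip_def)
  define X where "X = sqrt 3 * x"
  define m where "m = \<lfloor>(X - y) / 6\<rfloor>"
  have "of_int m \<le> (X - y) / 6" "(X - y) / 6 < of_int m + 1"
    unfolding m_def by linarith+
  then have m: "y \<le> X - 6 * of_int m" "X - 6 * of_int m < 6 + y" by (simp_all add: field_simps)
  have *: "sqrt 3 * (x + of_int k * sqrt 3) = X + 3 * of_int k" for k
    by (simp add: X_def algebra_simps sqrt3_simps)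
  define k where "k = (if X - 6 * of_int m \<le> 4 - y then - 2 * m else - 2 * m - 1)"
  have "glide (sqrt 3) k (x, y) \<in> trapezoid"
    unfolding glide_def trapezoid_eq fst_conv snd_conv mem_Collect_eq case_prod_conv *
    using m y by (auto simp: k_def)
  moreover have "c = moebius_class (sqrt 3) (glide (sqrt 3) k (x, y))"
    unfolding c moebius_class_eq_iff by blast
  ultimately show ?thesis by blast
qed

end

theory Submission
  imports Defs
begin

text \<open>
  Let \<open>f\<close> be the lift of the band to the strip. Call a chord from \<open>(a, 0)\<close> to \<open>(b, 1)\<close> a bend if
  \<open>f\<close> maps it isometrically to a straight segment. With \<open>d = a - b\<close> the bend has length
  \<open>sqrt (1 + d\<^sup>2)\<close>, and its end points cut the boundary circle, of length \<open>2 l\<close>, into arcs of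
  lengths \<open>l - d\<close> and \<open>l + d\<close>.

  \<^bold>\<open>Why the triangle appears.\<close> Suppose that two bends have images on perpendicular lines of a common
  plane and that the images do not cross: a T-pattern. Then the point where the two lines meet is
  not interior to one of the segments, so this segment has an end point \<open>w\<close> at distance at least
  \<open>1\<close> from the line through the other segment \<open>PQ\<close>. One of the two boundary arcs from \<open>Q\<close> to \<open>P\<close>
  passes through \<open>w\<close>; for a suitable sign of \<open>d\<close> it is the one of length \<open>l + d\<close>. As \<open>f\<close> does not
  increase distances, \<open>sqrt (1 + d\<^sup>2) \<le> l - d\<close> and \<open>sqrt (5 + d\<^sup>2) \<le> l + d\<close>. After squaring these
  become \<open>2 l d \<le> l\<^sup>2 - 1\<close> and \<open>5 - l\<^sup>2 \<le> 2 l d\<close>, so \<open>3 \<le> l\<^sup>2\<close>, and all slack is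
  measured by \<open>\<mu> = l\<^sup>2 - 3\<close>. The triangle \<open>PQw\<close> is, up to an isometry, within \<open>sqrt \<mu>\<close> of the
  equilateral one (\<open>triangle_comparison\<close>), and each of the three boundary arcs is within
  \<open>sqrt (\<mu> / 2)\<close> of its chord (\<open>distance_from_segment_point\<close>). Since
  \<open>\<mu> < 4 \<epsilon>\<close>, the total error is at most \<open>2 sqrt \<mu> \<le> 4 sqrt \<epsilon>\<close>.

  \<^bold>\<open>Why there are enough bends.\<close> All second derivatives of \<open>f\<close> are normal to the surface, and by
  Gauss' equation the second fundamental form has rank at most one. Where it does not vanish, its
  kernel is tangent to a straight line along which it stays nonzero (\<open>ruling_persists\<close>), and by
  periodicity this line is not horizontal. So every curved point lies on a bend, and such bends
  do not cross. In the coordinates \<open>s = a + b\<close> and \<open>d = a - b\<close> this says that \<open>d\<close> is a 1-Lipschitz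
  function of \<open>s\<close>. A 1-Lipschitz extension that respects the glide yields one chord for each \<open>s\<close>, and a
  new chord, which crosses no old one, runs through flat points only and therefore is a bend as well
  (\<open>straight_chord_family\<close>).

  \<^bold>\<open>Why there is a T-pattern.\<close> Going once around the band reverses the direction of the bend. With the
  bends oriented continuously, the two conditions on a pair of bends, to be perpendicular and to be
  coplanar, are the vanishing of the two components of a planar vector field on the plane of pairs.
  The symmetries of this field rule out that it has no zero (\<open>perpendicular_coplanar_pair\<close>).
\<close>

section \<open>Iterated directional derivatives\<close>

definition dirderiv :: "'a::real_normed_vector \<Rightarrow> ('a \<Rightarrow> 'b::real_normed_vector) \<Rightarrow> 'a \<Rightarrow> 'b" where
  "dirderiv v f x = frechet_derivative f (at x) v"

definition smooth_on :: "'a::real_normed_vector set \<Rightarrow> ('a \<Rightarrow> 'b::real_normed_vector) \<Rightarrow> bool" where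
  "smooth_on W f \<longleftrightarrow> (\<forall>n. C_on n W f)"

lemma smooth_on_dirderiv: "smooth_on W f \<Longrightarrow> smooth_on W (dirderiv v f)"
  unfolding smooth_on_def dirderiv_def by (metis C_on.simps(2))

lemma smooth_on_has_derivative:
  assumes "open W" "smooth_on W f" "x \<in> W"
  shows "(f has_derivative (\<lambda>v. dirderiv v f x)) (at x)"
proof -
  have "f differentiable_on W"
    using assms(2) unfolding smooth_on_def by (metis C_on.simps(2))
  then have "f differentiable (at x)"
    using assms by (simp add: differentiable_on_eq_differentiable_at)
  then show ?thesis
    unfolding dirderiv_def by (simp add: frechet_derivative_works)
qed

lemma smooth_on_continuous_on: "smooth_on W f \<Longrightarrow> continuous_on W f"
  unfolding smooth_on_def by (metis C_on.simps(1))

lemma dirderiv_eq_derivative: "(f has_derivative D) (at x) \<Longrightarrow> dirderiv v f x = D v"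
  unfolding dirderiv_def by (metis frechet_derivative_at)

lemma dirderiv_cong:
  assumes "open W" "x \<in> W" "\<And>y. y \<in> W \<Longrightarrow> f y = g y"
  shows "dirderiv v f x = dirderiv v g x"
proof -
  have "(f has_derivative D) (at x) \<longleftrightarrow> (g has_derivative D) (at x)" for D
    using has_derivative_transform_within_open[OF _ assms(1,2), of f D UNIV g]
      has_derivative_transform_within_open[OF _ assms(1,2), of g D UNIV f] assms(3) by auto
  then show ?thesis unfolding dirderiv_def frechet_derivative_def by simp
qed

lemma dirderiv_linear:
  assumes "open W" "smooth_on W f" "x \<in> W"
  shows "dirderiv (a *\<^sub>R v + b *\<^sub>R w) f x = a *\<^sub>R dirderiv v f x + b *\<^sub>R dirderiv w f x"
proof -
  have "linear (\<lambda>v. dirderiv v f x)"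
    using smooth_on_has_derivative[OF assms] by (rule has_derivative_linear)
  from linear_add[OF this] linear_scale[OF this] show ?thesis by simp
qed

lemma has_vector_derivative_along_line:
  assumes "open W" "smooth_on W f" "z + t *\<^sub>R v \<in> W"
  shows "((\<lambda>t. f (z + t *\<^sub>R v)) has_vector_derivative dirderiv v f (z + t *\<^sub>R v)) (at t within S)"
proof -
  have 1: "((\<lambda>t. z + t *\<^sub>R v) has_derivative (\<lambda>s. s *\<^sub>R v)) (at t within S)"
    by (auto intro!: derivative_eq_intros)
  have "((\<lambda>t. f (z + t *\<^sub>R v)) has_derivative (\<lambda>s. dirderiv (s *\<^sub>R v) f (z + t *\<^sub>R v))) (at t within S)"
    using has_derivative_compose[OF 1 smooth_on_has_derivative[OF assms]] by simp
  moreover have "dirderiv (s *\<^sub>R v) f (z + t *\<^sub>R v) = s *\<^sub>R dirderiv v f (z + t *\<^sub>R v)" for s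
    using dirderiv_linear[OF assms, of s v 0 0] by simp
  ultimately show ?thesis by (simp add: has_vector_derivative_def)
qed

text \<open>Derivatives at a point of an open set only depend on the germ, so a function that locally has
  smooth extensions is itself smooth there. The induction needs the stronger hypothesis that the
  local extensions have all derivatives, which then passes to the derivatives of \<open>f\<close>.\<close>

lemma C_on_if_locally_smooth:
  assumes "open W"
    and "\<And>p. p \<in> W \<Longrightarrow> \<exists>U g. open U \<and> p \<in> U \<and> smooth_on U g \<and> (\<forall>x\<in>U \<inter> W. g x = f x)"
  shows "C_on n W f"
  using assms(2)
proof (induction n arbitrary: f)
  case 0
  have "isCont f p" if p: "p \<in> W" for p
  proof -
    obtain U g where U: "open U" "p \<in> U" "smooth_on U g" "\<forall>x\<in>U \<inter> W. g x = f x"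
      using 0 p by blast
    have "isCont g p"
      using U smooth_on_continuous_on continuous_on_eq_continuous_at by blast
    moreover have "eventually (\<lambda>x. g x = f x) (nhds p)"
      using U p assms(1) by (auto simp: eventually_nhds intro!: exI[of _ "U \<inter> W"])
    ultimately show ?thesis using isCont_cong by blast
  qed
  then show ?case by (simp add: continuous_at_imp_continuous_on)
next
  case (Suc n)
  have D: "\<exists>U g. open U \<and> p \<in> U \<and> smooth_on U g \<and> (\<forall>x\<in>U \<inter> W. g x = f x) \<and> f differentiable (at p)
      \<and> (\<forall>x\<in>U \<inter> W. \<forall>v. dirderiv v g x = dirderiv v f x)" if p: "p \<in> W" for p
  proof -
    obtain U g where U: "open U" "p \<in> U" "smooth_on U g" "\<forall>x\<in>U \<inter> W. g x = f x"
      using Suc.prems p by blast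
    have "(g has_derivative (\<lambda>v. dirderiv v g p)) (at p)"
      using smooth_on_has_derivative U by blast
    then have "(f has_derivative (\<lambda>v. dirderiv v g p)) (at p)"
      by (rule has_derivative_transform_within_open[of _ _ _ _ "U \<inter> W"]) (use U p assms(1) in auto)
    moreover have "dirderiv v g x = dirderiv v f x" if "x \<in> U \<inter> W" for x v
      by (rule dirderiv_cong[of "U \<inter> W"]) (use U assms(1) that in auto)
    ultimately show ?thesis using U unfolding differentiable_def by blast
  qed
  have "C_on n W (dirderiv v f)" for v
  proof (rule Suc.IH)
    fix p assume "p \<in> W"
    from D[OF this] obtain U g where "open U" "p \<in> U" "smooth_on U g"
      "\<forall>x\<in>U \<inter> W. \<forall>v. dirderiv v g x = dirderiv v f x" by blast
    then show "\<exists>U g. open U \<and> p \<in> U \<and> smooth_on U g \<and> (\<forall>x\<in>U \<inter> W. g x = dirderiv v f x)"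
      using smooth_on_dirderiv by (intro exI[of _ U] exI[of _ "dirderiv v g"]) auto
  qed
  moreover have "f differentiable_on W"
    using D assms(1) by (auto simp: differentiable_on_eq_differentiable_at)
  ultimately show ?case by (simp add: dirderiv_def[abs_def])
qed

lemma smooth_on_interior:
  assumes "smooth S f"
  shows "smooth_on (interior S) f"
  unfolding smooth_on_def
proof
  fix n show "C_on n (interior S) f"
  proof (rule C_on_if_locally_smooth)
    fix p assume "p \<in> interior S"
    then have "p \<in> S" using interior_subset by blast
    then show "\<exists>U g. open U \<and> p \<in> U \<and> smooth_on U g \<and> (\<forall>x\<in>U \<inter> interior S. g x = f x)"
      using assms interior_subset[of S] unfolding smooth_def smooth_on_def
      by (meson Int_iff subsetD)
  qed simp
qed

text \<open>The mean value theorem, applied first in the direction \<open>v\<close> and then in the direction \<open>w\<close>. The inner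
  product with \<open>e\<close> reduces the vector-valued case to the scalar one.\<close>

lemma mixed_difference:
  fixes f :: "'a::real_normed_vector \<Rightarrow> 'b::real_inner"
  assumes W: "open W" "smooth_on W f" and h: "0 < h"
    and sub: "\<And>s t. 0 \<le> s \<Longrightarrow> s \<le> h \<Longrightarrow> 0 \<le> t \<Longrightarrow> t \<le> h \<Longrightarrow> x + s *\<^sub>R v + t *\<^sub>R w \<in> W"
  shows "\<exists>s t. 0 \<le> s \<and> s \<le> h \<and> 0 \<le> t \<and> t \<le> h \<and>
    (f (x + h *\<^sub>R v + h *\<^sub>R w) - f (x + h *\<^sub>R v) - f (x + h *\<^sub>R w) + f x) \<bullet> e =
      h * h * (dirderiv w (dirderiv v f) (x + s *\<^sub>R v + t *\<^sub>R w) \<bullet> e)"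
proof -
  define \<phi> where "\<phi> s = (f (x + s *\<^sub>R v + h *\<^sub>R w) - f (x + s *\<^sub>R v)) \<bullet> e" for s
  have d: "(\<phi> has_real_derivative (dirderiv v f (x + s *\<^sub>R v + h *\<^sub>R w) - dirderiv v f (x + s *\<^sub>R v)) \<bullet> e) (at s)"
    if "0 \<le> s" "s \<le> h" for s
  proof -
    have 1: "((\<lambda>s. f (x + s *\<^sub>R v + h *\<^sub>R w)) has_vector_derivative dirderiv v f (x + s *\<^sub>R v + h *\<^sub>R w)) (at s)"
      using has_vector_derivative_along_line[OF W, of "x + h *\<^sub>R w" s v UNIV] sub[OF that, of h] h
      by (simp add: algebra_simps)
    have 2: "((\<lambda>s. f (x + s *\<^sub>R v)) has_vector_derivative dirderiv v f (x + s *\<^sub>R v)) (at s)"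
      using has_vector_derivative_along_line[OF W, of x s v UNIV] sub[OF that, of 0] h by simp
    have "((\<lambda>s. (f (x + s *\<^sub>R v + h *\<^sub>R w) - f (x + s *\<^sub>R v)) \<bullet> e) has_vector_derivative
        (dirderiv v f (x + s *\<^sub>R v + h *\<^sub>R w) - dirderiv v f (x + s *\<^sub>R v)) \<bullet> e) (at s)"
      by (intro bounded_linear.has_vector_derivative[OF bounded_linear_inner_left]
          has_vector_derivative_diff 1 2)
    then show ?thesis
      by (simp add: has_real_derivative_iff_has_vector_derivative \<phi>_def[abs_def])
  qed
  obtain s where s: "0 < s" "s < h" "\<phi> h - \<phi> 0 =
      (h - 0) * ((dirderiv v f (x + s *\<^sub>R v + h *\<^sub>R w) - dirderiv v f (x + s *\<^sub>R v)) \<bullet> e)"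
    using MVT2[of 0 h \<phi> "\<lambda>s. (dirderiv v f (x + s *\<^sub>R v + h *\<^sub>R w) - dirderiv v f (x + s *\<^sub>R v)) \<bullet> e"] h d by blast
  define \<theta> where "\<theta> t = dirderiv v f (x + s *\<^sub>R v + t *\<^sub>R w) \<bullet> e" for t
  have d2: "(\<theta> has_real_derivative dirderiv w (dirderiv v f) (x + s *\<^sub>R v + t *\<^sub>R w) \<bullet> e) (at t)"
    if "0 \<le> t" "t \<le> h" for t
  proof -
    have "((\<lambda>t. dirderiv v f (x + s *\<^sub>R v + t *\<^sub>R w) \<bullet> e) has_vector_derivative
       dirderiv w (dirderiv v f) (x + s *\<^sub>R v + t *\<^sub>R w) \<bullet> e) (at t)"
      by (intro bounded_linear.has_vector_derivative[OF bounded_linear_inner_left]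
          has_vector_derivative_along_line[OF W(1) smooth_on_dirderiv[OF W(2)]] sub) (use s that in auto)
    then show ?thesis
      by (simp add: has_real_derivative_iff_has_vector_derivative \<theta>_def[abs_def])
  qed
  obtain t where t: "0 < t" "t < h"
    "\<theta> h - \<theta> 0 = (h - 0) * (dirderiv w (dirderiv v f) (x + s *\<^sub>R v + t *\<^sub>R w) \<bullet> e)"
    using MVT2[of 0 h \<theta> "\<lambda>t. dirderiv w (dirderiv v f) (x + s *\<^sub>R v + t *\<^sub>R w) \<bullet> e"] h d2 by blast
  have "(f (x + h *\<^sub>R v + h *\<^sub>R w) - f (x + h *\<^sub>R v) - f (x + h *\<^sub>R w) + f x) \<bullet> e = \<phi> h - \<phi> 0"
    by (simp add: \<phi>_def algebra_simps)
  also have "\<dots> = h * (\<theta> h - \<theta> 0)"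
    using s by (simp add: \<theta>_def algebra_simps)
  finally show ?thesis using t s by (intro exI[of _ s] exI[of _ t]) auto
qed

text \<open>Schwarz' theorem: the second difference quotient is symmetric in \<open>v\<close> and \<open>w\<close>, and by
  \<open>mixed_difference\<close> it is a value of either mixed derivative at a point close to \<open>x\<close>.\<close>

lemma dirderiv_commute:
  fixes f :: "'a::real_normed_vector \<Rightarrow> 'b::real_inner"
  assumes W: "open W" "smooth_on W f" and x: "x \<in> W"
  shows "dirderiv v (dirderiv w f) x = dirderiv w (dirderiv v f) x"
proof -
  have "dirderiv v (dirderiv w f) x \<bullet> e = dirderiv w (dirderiv v f) x \<bullet> e" for e
  proof (rule ccontr)
    let ?F = "\<lambda>y. dirderiv v (dirderiv w f) y \<bullet> e" and ?G = "\<lambda>y. dirderiv w (dirderiv v f) y \<bullet> e"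
    assume ne: "?F x \<noteq> ?G x"
    define \<epsilon> where "\<epsilon> = \<bar>?F x - ?G x\<bar> / 2"
    have \<epsilon>: "0 < \<epsilon>" using ne by (simp add: \<epsilon>_def)
    have "isCont ?F x" "isCont ?G x"
      using smooth_on_continuous_on[OF smooth_on_dirderiv[OF smooth_on_dirderiv[OF W(2)]]] W x
      by (auto intro!: continuous_intros simp: continuous_on_eq_continuous_at)
    then obtain d1 d2 where d: "0 < d1" "\<And>y. dist y x < d1 \<Longrightarrow> dist (?F y) (?F x) < \<epsilon>"
      "0 < d2" "\<And>y. dist y x < d2 \<Longrightarrow> dist (?G y) (?G x) < \<epsilon>"
      using \<epsilon> unfolding continuous_at_eps_delta by metis
    obtain d3 where d3: "0 < d3" "ball x d3 \<subseteq> W" using W x open_contains_ball by blast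
    define d where "d = min d1 (min d2 d3)"
    define h where "h = d / (2 * (norm v + norm w + 1))"
    have d0: "0 < d" using d d3 by (simp add: d_def)
    have h: "0 < h" unfolding h_def using d0
      by (intro divide_pos_pos mult_pos_pos add_nonneg_pos) auto
    have near: "dist (x + s *\<^sub>R v + t *\<^sub>R w) x < d" "dist (x + t *\<^sub>R w + s *\<^sub>R v) x < d"
      if "0 \<le> s" "s \<le> h" "0 \<le> t" "t \<le> h" for s t
    proof -
      have "norm (s *\<^sub>R v + t *\<^sub>R w) \<le> s * norm v + t * norm w"
        using norm_triangle_ineq[of "s *\<^sub>R v" "t *\<^sub>R w"] that by simp
      also have "\<dots> \<le> h * norm v + h * norm w"
        using that by (intro add_mono mult_right_mono) auto
      also have "\<dots> < h * (2 * (norm v + norm w + 1))"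
        using h by (simp add: algebra_simps add_nonneg_pos add_strict_increasing2)
      also have "\<dots> = d" unfolding h_def using add_nonneg_pos[of "norm v + norm w" 1] by simp
      finally show "dist (x + s *\<^sub>R v + t *\<^sub>R w) x < d" "dist (x + t *\<^sub>R w + s *\<^sub>R v) x < d"
        by (simp_all add: dist_norm algebra_simps)
    qed
    have sub: "x + s *\<^sub>R v + t *\<^sub>R w \<in> W" "x + t *\<^sub>R w + s *\<^sub>R v \<in> W"
      if "0 \<le> s" "s \<le> h" "0 \<le> t" "t \<le> h" for s t
      using near[OF that] d3 by (auto simp: d_def dist_commute subset_iff)
    obtain s t where 1: "0 \<le> s" "s \<le> h" "0 \<le> t" "t \<le> h"
      "(f (x + h *\<^sub>R v + h *\<^sub>R w) - f (x + h *\<^sub>R v) - f (x + h *\<^sub>R w) + f x) \<bullet> e =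
      h * h * ?G (x + s *\<^sub>R v + t *\<^sub>R w)"
      using mixed_difference[OF W h sub(1), of e] by blast
    obtain s' t' where 2: "0 \<le> s'" "s' \<le> h" "0 \<le> t'" "t' \<le> h"
      "(f (x + h *\<^sub>R w + h *\<^sub>R v) - f (x + h *\<^sub>R w) - f (x + h *\<^sub>R v) + f x) \<bullet> e =
      h * h * ?F (x + s' *\<^sub>R w + t' *\<^sub>R v)"
      using mixed_difference[OF W h sub(2), of e] by blast
    have "?G (x + s *\<^sub>R v + t *\<^sub>R w) = ?F (x + s' *\<^sub>R w + t' *\<^sub>R v)"
      using 1(5) 2(5) h by (simp add: algebra_simps)
    moreover have "dist (?G (x + s *\<^sub>R v + t *\<^sub>R w)) (?G x) < \<epsilon>"
      by (rule d) (use near(1)[OF 1(1-4)] in \<open>simp add: d_def\<close>)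
    moreover have "dist (?F (x + s' *\<^sub>R w + t' *\<^sub>R v)) (?F x) < \<epsilon>"
      by (rule d) (use near(2)[OF 2(3,4,1,2)] in \<open>simp add: d_def\<close>)
    ultimately show False unfolding \<epsilon>_def dist_real_def by argo
  qed
  then show ?thesis by (metis vector_eq_rdot)
qed


section \<open>Degenerate second derivatives along a line\<close>

text \<open>If \<open>K\<close> bounds the coefficient, then \<open>B\<^sup>2 exp (- 2 K t)\<close> is nonincreasing and starts at \<open>0\<close>.\<close>

lemma linear_ode_zero:
  fixes B \<kappa> :: "real \<Rightarrow> real"
  assumes "0 \<le> \<tau>"
    and B': "\<And>t. 0 \<le> t \<Longrightarrow> t \<le> \<tau> \<Longrightarrow> (B has_real_derivative \<kappa> t * B t) (at t)"
    and \<kappa>: "continuous_on {0..\<tau>} \<kappa>" and "B 0 = 0"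
  shows "B \<tau> = 0"
proof -
  have "bounded (\<kappa> ` {0..\<tau>})"
    using \<kappa> compact_continuous_image compact_imp_bounded by blast
  then obtain K where "\<forall>x\<in>\<kappa> ` {0..\<tau>}. \<bar>x\<bar> \<le> K" by (auto simp: bounded_iff)
  then have K: "\<kappa> t \<le> K" if "0 \<le> t" "t \<le> \<tau>" for t
    using that abs_le_D1 by (metis atLeastAtMost_iff image_eqI)
  define E where "E t = (B t)\<^sup>2 * exp (- 2 * K * t)" for t
  have "\<exists>y. (E has_real_derivative y) (at t) \<and> y \<le> 0" if t: "0 \<le> t" "t \<le> \<tau>" for t
  proof -
    have "(E has_real_derivative 2 * (B t)\<^sup>2 * exp (- 2 * K * t) * (\<kappa> t - K)) (at t)"
      unfolding E_def[abs_def]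
      by (rule derivative_eq_intros B'[OF t] refl | simp add: power2_eq_square algebra_simps)+
    moreover have "2 * (B t)\<^sup>2 * exp (- 2 * K * t) * (\<kappa> t - K) \<le> 0"
      using K[OF t] by (intro mult_nonneg_nonpos) auto
    ultimately show ?thesis by blast
  qed
  then have "E \<tau> \<le> E 0" using DERIV_nonpos_imp_nonincreasing[OF assms(1)] by blast
  then have "(B \<tau>)\<^sup>2 * exp (- 2 * K * \<tau>) \<le> 0" using assms(4) by (simp add: E_def)
  then show ?thesis by (simp add: mult_le_0_iff)
qed

text \<open>The analytic core of the theorem on rulings. Along a line with direction \<open>w\<close>, the functions
  \<open>A\<close>, \<open>B\<close>, \<open>C\<close> will be the derivatives \<open>vv\<close>, \<open>vw\<close>, \<open>ww\<close> of a component of the surface;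
  \<open>a\<close>, \<open>b\<close>, \<open>c\<close> are the \<open>v\<close>-derivatives of these, and \<open>p\<close>, \<open>q\<close>, \<open>r\<close> the second ones. The
  hypotheses are \<open>A C = B\<^sup>2\<close> together with its first two derivatives in the
  direction \<open>v\<close>; as mixed derivatives commute, \<open>b\<close>, \<open>c\<close>, \<open>r\<close> are at the same time the derivatives of
  \<open>A\<close>, \<open>B\<close>, \<open>b\<close> along the line.

  As long as \<open>A\<close> does not vanish, \<open>B\<close> solves a homogeneous linear equation, so \<open>B = 0\<close>. Then
  \<open>A A'' = 2 A'\<^sup>2\<close>, that is, \<open>1 / A\<close> is an affine function. It stays bounded, so \<open>A\<close> has no
  first zero.\<close>

lemma rank_one_persists:
  fixes A B C a b c p q r :: "real \<Rightarrow> real"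
  assumes T: "0 \<le> T"
    and A': "\<And>t. 0 \<le> t \<Longrightarrow> t \<le> T \<Longrightarrow> (A has_real_derivative b t) (at t)"
    and B': "\<And>t. 0 \<le> t \<Longrightarrow> t \<le> T \<Longrightarrow> (B has_real_derivative c t) (at t)"
    and b': "\<And>t. 0 \<le> t \<Longrightarrow> t \<le> T \<Longrightarrow> (b has_real_derivative r t) (at t)"
    and a: "continuous_on {0..T} a"
    and d0: "\<And>t. 0 \<le> t \<Longrightarrow> t \<le> T \<Longrightarrow> A t * C t = (B t)\<^sup>2"
    and d1: "\<And>t. 0 \<le> t \<Longrightarrow> t \<le> T \<Longrightarrow> a t * C t + A t * c t = 2 * B t * b t"
    and d2: "\<And>t. 0 \<le> t \<Longrightarrow> t \<le> T \<Longrightarrow>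
      p t * C t + 2 * a t * c t + A t * r t = 2 * (b t)\<^sup>2 + 2 * B t * q t"
    and A0: "A 0 \<noteq> 0" and B0: "B 0 = 0"
  shows "A T \<noteq> 0 \<and> B T = 0"
proof -
  have cont: "continuous_on {0..T} A" "continuous_on {0..T} B" "continuous_on {0..T} b"
    using DERIV_isCont[OF A'] DERIV_isCont[OF B'] DERIV_isCont[OF b']
    by (auto intro!: continuous_at_imp_continuous_on)
  \<comment> \<open>The linear equation for \<open>B\<close>, obtained by eliminating \<open>C\<close> from \<open>d0\<close> and \<open>d1\<close>.\<close>
  have B: "B \<tau> = 0" if \<tau>: "0 \<le> \<tau>" "\<tau> \<le> T" and ne: "\<And>t. 0 \<le> t \<Longrightarrow> t \<le> \<tau> \<Longrightarrow> A t \<noteq> 0" for \<tau>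
  proof (rule linear_ode_zero[where B = B and \<tau> = \<tau> and \<kappa> = "\<lambda>t. (2 * b t - a t * B t / A t) / A t"])
    have sub: "{0..\<tau>} \<subseteq> {0..T}" using \<tau> by auto
    show "continuous_on {0..\<tau>} (\<lambda>t. (2 * b t - a t * B t / A t) / A t)"
      using cont a ne by (auto intro!: continuous_intros intro: continuous_on_subset[OF _ sub])
    fix t assume t: "0 \<le> t" "t \<le> \<tau>"
    have "C t = (B t)\<^sup>2 / A t" using d0[of t] ne[OF t] t \<tau> by (simp add: field_simps)
    then have "c t * A t = 2 * B t * b t - a t * ((B t)\<^sup>2 / A t)"
      using d1[of t] t \<tau> by (simp add: mult.commute)
    then have "c t = (2 * B t * b t - a t * ((B t)\<^sup>2 / A t)) / A t"
      using ne[OF t] by (metis nonzero_mult_div_cancel_right)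
    also have "\<dots> = (2 * b t - a t * B t / A t) / A t * B t"
      using ne[OF t] by (simp add: field_simps power2_eq_square)
    finally show "(B has_real_derivative (2 * b t - a t * B t / A t) / A t * B t) (at t)"
      using B'[of t] t \<tau> by simp
  qed (use \<tau> B0 in auto)
  have "A t \<noteq> 0" if "0 \<le> t" "t \<le> T" for t
  proof
    assume "A t = 0"
    define Z where "Z = {0..T} \<inter> A -` {0}"
    have "closed Z" unfolding Z_def
      by (intro continuous_closed_preimage cont) auto
    then have "compact Z"
      unfolding Z_def using compact_Int_closed[of "{0..T}" Z] by (simp add: Z_def Int_assoc[symmetric])
    moreover have "Z \<noteq> {}" using that \<open>A t = 0\<close> by (auto simp: Z_def)
    ultimately obtain z where z: "z \<in> Z" "\<And>s. s \<in> Z \<Longrightarrow> z \<le> s"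
      using compact_attains_inf[of Z] by auto
    then have zT: "0 \<le> z" "z \<le> T" "A z = 0" by (auto simp: Z_def)
    then have z0: "0 < z" using A0 by (cases "z = 0") auto
    have ne: "A s \<noteq> 0" if "0 \<le> s" "s < z" for s
      using z(2)[of s] that zT by (auto simp: Z_def)
    have r: "A s * r s = 2 * (b s)\<^sup>2" if s: "0 \<le> s" "s < z" for s
    proof -
      have "B s = 0" by (rule B) (use s zT ne in auto)
      moreover from this have "C s = 0" using d0[of s] ne[OF s] s zT by simp
      moreover from calculation have "c s = 0" using d1[of s] ne[OF s] s zT by simp
      ultimately show ?thesis using d2[of s] s zT by simp
    qed
    \<comment> \<open>The derivative of \<open>1 / A\<close> is the constant \<open>- \<beta>\<close>.\<close>
    have "\<exists>\<beta>. \<forall>s\<in>{0..<z}. b s / (A s)\<^sup>2 = \<beta>"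
    proof (rule has_field_derivative_zero_constant)
      fix s assume "s \<in> {0..<z}"
      then have s: "0 \<le> s" "s < z" "s \<le> T" using zT by auto
      have "((\<lambda>s. b s / (A s)\<^sup>2) has_real_derivative
        (r s * (A s)\<^sup>2 - b s * (2 * A s * b s)) / ((A s)\<^sup>2 * (A s)\<^sup>2)) (at s)"
        by (rule derivative_eq_intros A' b' refl | use s ne in \<open>simp add: power2_eq_square\<close>)+
      moreover have "r s * (A s)\<^sup>2 - b s * (2 * A s * b s) = 0"
        using r[OF s(1,2)] by algebra
      ultimately show "((\<lambda>s. b s / (A s)\<^sup>2) has_real_derivative 0) (at s within {0..<z})"
        by (simp add: has_field_derivative_at_within)
    qed simp
    then obtain \<beta> where \<beta>: "\<And>s. 0 \<le> s \<Longrightarrow> s < z \<Longrightarrow> b s / (A s)\<^sup>2 = \<beta>" by auto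
    have "\<exists>\<alpha>. \<forall>s\<in>{0..<z}. 1 / A s + \<beta> * s = \<alpha>"
    proof (rule has_field_derivative_zero_constant)
      fix s assume "s \<in> {0..<z}"
      then have s: "0 \<le> s" "s < z" "s \<le> T" using zT by auto
      have "((\<lambda>s. 1 / A s + \<beta> * s) has_real_derivative - (b s / (A s)\<^sup>2) + \<beta>) (at s)"
        by (rule derivative_eq_intros A' refl | use s ne in \<open>simp add: power2_eq_square\<close>)+
      then show "((\<lambda>s. 1 / A s + \<beta> * s) has_real_derivative 0) (at s within {0..<z})"
        using \<beta>[OF s(1,2)] by (simp add: has_field_derivative_at_within)
    qed simp
    then obtain \<alpha> where \<alpha>: "\<And>s. 0 \<le> s \<Longrightarrow> s < z \<Longrightarrow> 1 / A s + \<beta> * s = \<alpha>" by auto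
    have "A z * (\<alpha> - \<beta> * z) = 1"
    proof (rule continuous_constant_on_closure[where S = "{0..<z}" and f = "\<lambda>s. A s * (\<alpha> - \<beta> * s)"])
      show "continuous_on (closure {0..<z}) (\<lambda>s. A s * (\<alpha> - \<beta> * s))"
        using z0 zT by (auto intro!: continuous_intros intro: continuous_on_subset[OF cont(1)])
      show "A s * (\<alpha> - \<beta> * s) = 1" if "s \<in> {0..<z}" for s
        using \<alpha>[of s] ne[of s] that by (auto simp: field_simps)
      show "z \<in> closure {0..<z}" using z0 by simp
    qed
    then show False using zT by simp
  qed
  then show ?thesis using B[of T] T by auto
qed


section \<open>Flat surfaces in space are ruled\<close>

text \<open>The normal space of a plane in three dimensions is a line, spanned by the cross product.\<close>

lemma normal_line:
  fixes a b z :: "real ^ 3"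
  assumes "a \<bullet> a = 1" "b \<bullet> b = 1" "a \<bullet> b = 0" "z \<bullet> a = 0" "z \<bullet> b = 0"
  shows "z = (z \<bullet> cross3 a b) *\<^sub>R cross3 a b" "norm (cross3 a b) = 1"
proof -
  let ?n = "cross3 a b"
  have "norm a = 1" "norm b = 1" using assms by (simp_all add: norm_eq_sqrt_inner)
  then have "(norm ?n)\<^sup>2 = 1" using norm_cross_dot[of a b] assms(3) by simp
  then show n: "norm ?n = 1" by (metis norm_ge_zero power2_eq_1_iff not_one_le_zero abs_norm_cancel
        abs_1 abs_minus_cancel)
  have "cross3 z ?n = 0" by (simp add: Lagrange assms)
  then have "(z \<bullet> ?n)\<^sup>2 = z \<bullet> z"
    using norm_cross_dot[of z ?n] n by (simp add: power2_norm_eq_inner)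
  moreover have "(z - k *\<^sub>R ?n) \<bullet> (z - k *\<^sub>R ?n) = z \<bullet> z - 2 * k * (z \<bullet> ?n) + k * k * (?n \<bullet> ?n)" for k
    by (simp add: inner_diff_left inner_diff_right inner_commute algebra_simps)
  ultimately have "(z - (z \<bullet> ?n) *\<^sub>R ?n) \<bullet> (z - (z \<bullet> ?n) *\<^sub>R ?n) = 0"
    using n by (simp only: norm_eq_1) (simp add: power2_eq_square)
  then show "z = (z \<bullet> ?n) *\<^sub>R ?n" by simp
qed

lemma has_real_derivative_component_along_line:
  fixes F :: "'a::real_normed_vector \<Rightarrow> real ^ 'n"
  assumes "open W" "smooth_on W F" "z + t *\<^sub>R v \<in> W"
  shows "((\<lambda>t. F (z + t *\<^sub>R v) $ i) has_real_derivative dirderiv v F (z + t *\<^sub>R v) $ i) (at t)"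
  using bounded_linear.has_vector_derivative[OF bounded_linear_vec_nth
      has_vector_derivative_along_line[OF assms]]
  by (simp add: has_real_derivative_iff_has_vector_derivative)

lemma derivative_of_vanishing:
  fixes \<phi> :: "'a::real_normed_vector \<Rightarrow> real"
  assumes W: "open W" "x \<in> W" and \<phi>: "\<And>y. y \<in> W \<Longrightarrow> \<phi> y = 0"
    and d: "((\<lambda>t. \<phi> (x + t *\<^sub>R v)) has_real_derivative d) (at 0)"
  shows "d = 0"
proof -
  let ?U = "(\<lambda>t::real. x + t *\<^sub>R v) -` W"
  have "open ?U" using W(1) by (intro open_vimage) (auto intro!: continuous_intros)
  then have "((\<lambda>t. 0) has_real_derivative d) (at 0)"
    using has_field_derivative_transform_within_open[OF d, of ?U "\<lambda>t. 0"] W \<phi> by auto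
  then show ?thesis using DERIV_unique DERIV_const by blast
qed

locale isometric_surface =
  fixes W :: "(real \<times> real) set" and f :: "real \<times> real \<Rightarrow> real ^ 3"
  assumes open_W: "open W" and smooth_f: "smooth_on W f"
    and isometric: "\<And>x v w. x \<in> W \<Longrightarrow> dirderiv v f x \<bullet> dirderiv w f x = v \<bullet> w"
begin

lemma smooth_dirderiv: "smooth_on W (dirderiv v f)" "smooth_on W (dirderiv v (dirderiv w f))"
    "smooth_on W (dirderiv v (dirderiv w (dirderiv u f)))"
  by (intro smooth_on_dirderiv smooth_f)+

lemma dirderiv_inner_const:
  assumes F: "smooth_on W F" and G: "smooth_on W G" and c: "\<And>y. y \<in> W \<Longrightarrow> F y \<bullet> (G y :: real ^ 3) = c"
    and x: "x \<in> W"
  shows "dirderiv v F x \<bullet> G x + F x \<bullet> dirderiv v G x = 0"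
proof (rule derivative_of_vanishing[OF open_W x, where \<phi> = "\<lambda>y. F y \<bullet> G y - c" and v = v])
  have "((\<lambda>t. F (x + t *\<^sub>R v) \<bullet> G (x + t *\<^sub>R v)) has_derivative
    (\<lambda>h. F x \<bullet> (h *\<^sub>R dirderiv v G x) + (h *\<^sub>R dirderiv v F x) \<bullet> G x)) (at 0)"
    using has_derivative_inner[OF has_vector_derivative_along_line[OF open_W F, of x 0 v UNIV, unfolded has_vector_derivative_def]
        has_vector_derivative_along_line[OF open_W G, of x 0 v UNIV, unfolded has_vector_derivative_def]] x by simp
  then have "((\<lambda>t. F (x + t *\<^sub>R v) \<bullet> G (x + t *\<^sub>R v)) has_real_derivative
      dirderiv v F x \<bullet> G x + F x \<bullet> dirderiv v G x) (at 0)"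
    unfolding has_field_derivative_def by (rule has_derivative_eq_rhs) (auto simp: algebra_simps)
  then show "((\<lambda>t. F (x + t *\<^sub>R v) \<bullet> G (x + t *\<^sub>R v) - c) has_real_derivative
      dirderiv v F x \<bullet> G x + F x \<bullet> dirderiv v G x) (at 0)"
    by (auto intro!: derivative_eq_intros)
qed (use c in simp)

text \<open>Koszul's argument: the expression is symmetric in \<open>u\<close>, \<open>v\<close>, and skew in \<open>v\<close>, \<open>w\<close> because \<open>f\<close> is
  isometric. A trilinear form with these two symmetries vanishes.\<close>

lemma second_derivative_normal:
  assumes x: "x \<in> W"
  shows "dirderiv u (dirderiv v f) x \<bullet> dirderiv w f x = 0"
proof -
  have sym: "dirderiv u (dirderiv v f) x = dirderiv v (dirderiv u f) x" for u v
    by (rule dirderiv_commute[OF open_W smooth_f x])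
  have anti: "dirderiv u (dirderiv v f) x \<bullet> dirderiv w f x = - (dirderiv u (dirderiv w f) x \<bullet> dirderiv v f x)" for u v w
    using dirderiv_inner_const[OF smooth_dirderiv(1) smooth_dirderiv(1) isometric x, of u v w]
    by (simp add: inner_commute)
  have "dirderiv u (dirderiv v f) x \<bullet> dirderiv w f x = - (dirderiv w (dirderiv u f) x \<bullet> dirderiv v f x)"
    using anti[of u v w] sym[of u w] by simp
  also have "\<dots> = dirderiv v (dirderiv w f) x \<bullet> dirderiv u f x"
    using anti[of w u v] sym[of w v] by simp
  also have "\<dots> = - (dirderiv u (dirderiv v f) x \<bullet> dirderiv w f x)"
    using anti[of v w u] sym[of v u] by simp
  finally show ?thesis by simp
qed

text \<open>Gauss' equation for a flat metric. Differentiate two of the orthogonality relations of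
  \<open>second_derivative_normal\<close> so that the same third derivative appears in both, and subtract.\<close>

lemma gauss:
  assumes x: "x \<in> W"
  shows "dirderiv v (dirderiv v f) x \<bullet> dirderiv w (dirderiv w f) x = dirderiv v (dirderiv w f) x \<bullet> dirderiv v (dirderiv w f) x"
proof -
  have 1: "dirderiv w (dirderiv v (dirderiv v f)) x \<bullet> dirderiv w f x + dirderiv v (dirderiv v f) x \<bullet> dirderiv w (dirderiv w f) x = 0"
    by (rule dirderiv_inner_const[OF smooth_dirderiv(2,1) second_derivative_normal x])
  have 2: "dirderiv v (dirderiv v (dirderiv w f)) x \<bullet> dirderiv w f x + dirderiv v (dirderiv w f) x \<bullet> dirderiv v (dirderiv w f) x = 0"
    by (rule dirderiv_inner_const[OF smooth_dirderiv(2,1) second_derivative_normal x])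
  have "dirderiv w (dirderiv v (dirderiv v f)) x = dirderiv v (dirderiv w (dirderiv v f)) x"
    by (rule dirderiv_commute[OF open_W smooth_dirderiv(1) x])
  also have "\<dots> = dirderiv v (dirderiv v (dirderiv w f)) x"
    by (rule dirderiv_cong[OF open_W x]) (rule dirderiv_commute[OF open_W smooth_f])
  finally show ?thesis using 1 2 by simp
qed

lemma second_derivative_parallel:
  assumes x: "x \<in> W"
  obtains n where "n \<bullet> n = 1" "\<And>v w. dirderiv v (dirderiv w f) x = (dirderiv v (dirderiv w f) x \<bullet> n) *\<^sub>R n"
proof
  let ?n = "cross3 (dirderiv (1, 0) f x) (dirderiv (0, 1) f x)"
  have *: "dirderiv (1, 0) f x \<bullet> dirderiv (1, 0) f x = 1" "dirderiv (0, 1) f x \<bullet> dirderiv (0, 1) f x = 1"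
    "dirderiv (1, 0) f x \<bullet> dirderiv (0, 1) f x = 0"
    using isometric[OF x] by simp_all
  show "?n \<bullet> ?n = 1"
    using normal_line(2)[OF *, of 0] by (simp add: norm_eq_1)
  show "dirderiv v (dirderiv w f) x = (dirderiv v (dirderiv w f) x \<bullet> ?n) *\<^sub>R ?n" for v w
    by (rule normal_line(1)[OF *]) (rule second_derivative_normal[OF x])+
qed

text \<open>Every component of \<open>f\<close> solves the degenerate Monge-Ampere equation, because all second derivatives
  are multiples of one normal vector.\<close>

lemma gauss_component:
  assumes x: "x \<in> W"
  shows "dirderiv v (dirderiv v f) x $ i * dirderiv w (dirderiv w f) x $ i = (dirderiv v (dirderiv w f) x $ i)\<^sup>2"
proof -
  obtain n where n: "n \<bullet> n = 1" "\<And>v w. dirderiv v (dirderiv w f) x = (dirderiv v (dirderiv w f) x \<bullet> n) *\<^sub>R n"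
    using second_derivative_parallel[OF x] by blast
  define h where "h v w = dirderiv v (dirderiv w f) x \<bullet> n" for v w
  have h: "dirderiv v (dirderiv w f) x = h v w *\<^sub>R n" for v w using n(2) by (simp add: h_def)
  have "h v v * h w w = (h v w)\<^sup>2"
    using gauss[OF x, of v w] n(1) by (simp add: h power2_eq_square mult.commute)
  then have "h v v * h w w * (n $ i)\<^sup>2 = (h v w)\<^sup>2 * (n $ i)\<^sup>2" by simp
  then show ?thesis by (simp add: h power2_eq_square mult_ac)
qed

lemma second_derivative_bilinear:
  assumes x: "x \<in> W"
  shows "dirderiv (a, b) (dirderiv (c, d) f) x = (a * c) *\<^sub>R dirderiv (1, 0) (dirderiv (1, 0) f) x +
    (a * d + b * c) *\<^sub>R dirderiv (1, 0) (dirderiv (0, 1) f) x + (b * d) *\<^sub>R dirderiv (0, 1) (dirderiv (0, 1) f) x"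
proof -
  have lin: "dirderiv (a, b) F x = a *\<^sub>R dirderiv (1, 0) F x + b *\<^sub>R dirderiv (0, 1) F x"
    if "smooth_on W F" for a b and F :: "real \<times> real \<Rightarrow> real ^ 3"
    using dirderiv_linear[OF open_W that x, of a "(1, 0)" b "(0, 1)"] by simp
  have sw: "dirderiv v (dirderiv w f) x = dirderiv w (dirderiv v f) x" for v w
    by (rule dirderiv_commute[OF open_W smooth_f x])
  have "dirderiv (a, b) (dirderiv (c, d) f) x = a *\<^sub>R dirderiv (1, 0) (dirderiv (c, d) f) x + b *\<^sub>R dirderiv (0, 1) (dirderiv (c, d) f) x"
    by (rule lin[OF smooth_dirderiv(1)])
  also have "\<dots> = a *\<^sub>R dirderiv (c, d) (dirderiv (1, 0) f) x + b *\<^sub>R dirderiv (c, d) (dirderiv (0, 1) f) x"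
    by (simp only: sw[of "(1, 0)" "(c, d)"] sw[of "(0, 1)" "(c, d)"])
  also have "\<dots> = a *\<^sub>R (c *\<^sub>R dirderiv (1, 0) (dirderiv (1, 0) f) x + d *\<^sub>R dirderiv (1, 0) (dirderiv (0, 1) f) x)
    + b *\<^sub>R (c *\<^sub>R dirderiv (1, 0) (dirderiv (0, 1) f) x + d *\<^sub>R dirderiv (0, 1) (dirderiv (0, 1) f) x)"
    by (simp only: lin[OF smooth_dirderiv(1), of c d] sw[of "(0, 1)" "(1, 0)"])
  finally show ?thesis by (simp add: algebra_simps)
qed

text \<open>A kernel direction \<open>w\<close> of the second fundamental form at a curved point stays a kernel direction along
  the whole line, and the line stays in the curved region. It suffices to follow one component \<open>i\<close> of
  \<open>f\<close>: where its second derivative does not vanish, the normal has a nonzero component \<open>i\<close>, and the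
  other components follow.\<close>

lemma ruling_persists:
  assumes T: "0 \<le> T" and line: "\<And>t. 0 \<le> t \<Longrightarrow> t \<le> T \<Longrightarrow> z + t *\<^sub>R w \<in> W"
    and vv: "dirderiv v (dirderiv v f) z \<noteq> 0" and vw: "dirderiv v (dirderiv w f) z = 0"
  shows "dirderiv v (dirderiv v f) (z + T *\<^sub>R w) \<noteq> 0 \<and> dirderiv v (dirderiv w f) (z + T *\<^sub>R w) = 0
    \<and> dirderiv w (dirderiv w f) (z + T *\<^sub>R w) = 0"
proof -
  obtain i where i: "dirderiv v (dirderiv v f) z $ i \<noteq> 0" using vv by (auto simp: vec_eq_iff)
  define A where "A = dirderiv v (dirderiv v f)"
  define B where "B = dirderiv v (dirderiv w f)"
  define C where "C = dirderiv w (dirderiv w f)"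
  define a where "a = dirderiv v A"
  define b where "b = dirderiv v B"
  define c where "c = dirderiv w B"
  have sm: "smooth_on W A" "smooth_on W B" "smooth_on W C" "smooth_on W a" "smooth_on W b"
    "smooth_on W c"
    by (simp_all add: A_def B_def C_def a_def b_def c_def smooth_dirderiv)
  \<comment> \<open>As mixed derivatives commute, the derivatives along \<open>w\<close> are as \<open>rank_one_persists\<close> demands.\<close>
  have wA: "dirderiv w A x = b x" if "x \<in> W" for x
  proof -
    have "dirderiv w A x = dirderiv v (dirderiv w (dirderiv v f)) x"
      unfolding A_def by (rule dirderiv_commute[OF open_W smooth_dirderiv(1) that])
    also have "\<dots> = b x" unfolding b_def B_def
      by (rule dirderiv_cong[OF open_W that]) (rule dirderiv_commute[OF open_W smooth_f])
    finally show ?thesis .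
  qed
  have vC: "dirderiv v C x = c x" if "x \<in> W" for x
    unfolding C_def c_def B_def by (rule dirderiv_commute[OF open_W smooth_dirderiv(1) that])
  have vc: "dirderiv v c x = dirderiv w b x" if "x \<in> W" for x
    unfolding c_def b_def by (rule dirderiv_commute[OF open_W sm(2) that])
  have d0: "A x $ i * C x $ i = (B x $ i)\<^sup>2" if "x \<in> W" for x
    unfolding A_def B_def C_def by (rule gauss_component[OF that])
  have D: "((\<lambda>t. F (x + t *\<^sub>R v) $ i) has_real_derivative dirderiv v F x $ i) (at 0)"
    if "smooth_on W F" "x \<in> W" for F :: "real \<times> real \<Rightarrow> real ^ 3" and x
    using has_real_derivative_component_along_line[OF open_W that(1), of x 0 v i] that(2) by simp
  have d1: "a x $ i * C x $ i + A x $ i * c x $ i = 2 * B x $ i * b x $ i" if x: "x \<in> W" for x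
  proof -
    have "dirderiv v A x $ i * C x $ i + A x $ i * dirderiv v C x $ i - 2 * B x $ i * dirderiv v B x $ i = 0"
    proof (rule derivative_of_vanishing[OF open_W x,
          where \<phi> = "\<lambda>x. A x $ i * C x $ i - (B x $ i)\<^sup>2" and v = v])
      show "((\<lambda>t. A (x + t *\<^sub>R v) $ i * C (x + t *\<^sub>R v) $ i - (B (x + t *\<^sub>R v) $ i)\<^sup>2) has_real_derivative
          dirderiv v A x $ i * C x $ i + A x $ i * dirderiv v C x $ i - 2 * B x $ i * dirderiv v B x $ i) (at 0)"
        by (rule derivative_eq_intros D[OF sm(1) x] D[OF sm(2) x] D[OF sm(3) x] refl | simp)+
    qed (simp add: d0)
    then show ?thesis using vC[OF x] by (simp add: a_def b_def)
  qed
  have d2: "dirderiv v a x $ i * C x $ i + 2 * a x $ i * c x $ i + A x $ i * dirderiv w b x $ i =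
      2 * (b x $ i)\<^sup>2 + 2 * B x $ i * dirderiv v b x $ i" if x: "x \<in> W" for x
  proof -
    have "dirderiv v a x $ i * C x $ i + a x $ i * dirderiv v C x $ i + (dirderiv v A x $ i * c x $ i + A x $ i * dirderiv v c x $ i)
      - (2 * dirderiv v B x $ i * b x $ i + 2 * B x $ i * dirderiv v b x $ i) = 0"
    proof (rule derivative_of_vanishing[OF open_W x,
          where \<phi> = "\<lambda>x. a x $ i * C x $ i + A x $ i * c x $ i - 2 * B x $ i * b x $ i" and v = v])
      show "((\<lambda>t. a (x + t *\<^sub>R v) $ i * C (x + t *\<^sub>R v) $ i + A (x + t *\<^sub>R v) $ i * c (x + t *\<^sub>R v) $ i
            - 2 * B (x + t *\<^sub>R v) $ i * b (x + t *\<^sub>R v) $ i) has_real_derivative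
          dirderiv v a x $ i * C x $ i + a x $ i * dirderiv v C x $ i + (dirderiv v A x $ i * c x $ i + A x $ i * dirderiv v c x $ i)
      - (2 * dirderiv v B x $ i * b x $ i + 2 * B x $ i * dirderiv v b x $ i)) (at 0)"
        by (rule derivative_eq_intros D[OF sm(1) x] D[OF sm(2) x] D[OF sm(3) x] D[OF sm(4) x]
            D[OF sm(5) x] D[OF sm(6) x] refl | simp)+
    qed (simp add: d1)
    then show ?thesis using vC[OF x] vc[OF x]
      by (simp add: a_def[symmetric] b_def[symmetric] power2_eq_square)
  qed
  have along: "((\<lambda>t. F (z + t *\<^sub>R w) $ i) has_real_derivative dirderiv w F (z + t *\<^sub>R w) $ i) (at t)"
    if "smooth_on W F" "0 \<le> t" "t \<le> T" for F :: "real \<times> real \<Rightarrow> real ^ 3" and t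
    by (rule has_real_derivative_component_along_line[OF open_W that(1) line[OF that(2,3)]])
  have "A (z + T *\<^sub>R w) $ i \<noteq> 0 \<and> B (z + T *\<^sub>R w) $ i = 0"
  proof (rule rank_one_persists[where A = "\<lambda>t. A (z + t *\<^sub>R w) $ i" and B = "\<lambda>t. B (z + t *\<^sub>R w) $ i"
        and C = "\<lambda>t. C (z + t *\<^sub>R w) $ i" and a = "\<lambda>t. a (z + t *\<^sub>R w) $ i"
        and b = "\<lambda>t. b (z + t *\<^sub>R w) $ i" and c = "\<lambda>t. c (z + t *\<^sub>R w) $ i"
        and p = "\<lambda>t. dirderiv v a (z + t *\<^sub>R w) $ i" and q = "\<lambda>t. dirderiv v b (z + t *\<^sub>R w) $ i"
        and r = "\<lambda>t. dirderiv w b (z + t *\<^sub>R w) $ i", OF T])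
    show "continuous_on {0..T} (\<lambda>t. a (z + t *\<^sub>R w) $ i)"
      using along[OF sm(4)] by (auto intro!: continuous_at_imp_continuous_on DERIV_isCont)
    show "((\<lambda>t. A (z + t *\<^sub>R w) $ i) has_real_derivative b (z + t *\<^sub>R w) $ i) (at t)"
      if "0 \<le> t" "t \<le> T" for t using along[OF sm(1) that] wA[OF line[OF that]] by simp
    show "((\<lambda>t. B (z + t *\<^sub>R w) $ i) has_real_derivative c (z + t *\<^sub>R w) $ i) (at t)"
      if "0 \<le> t" "t \<le> T" for t using along[OF sm(2) that] by (simp add: c_def)
    show "((\<lambda>t. b (z + t *\<^sub>R w) $ i) has_real_derivative dirderiv w b (z + t *\<^sub>R w) $ i) (at t)"
      if "0 \<le> t" "t \<le> T" for t using along[OF sm(5) that] by simp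
    show "A (z + 0 *\<^sub>R w) $ i \<noteq> 0" using i by (simp add: A_def)
    show "B (z + 0 *\<^sub>R w) $ i = 0" using vw by (simp add: B_def)
  qed (simp_all add: line d0 d1 d2)
  moreover have x: "z + T *\<^sub>R w \<in> W" using line T by simp
  obtain n where n: "n \<bullet> n = 1" "\<And>v' w'. dirderiv v' (dirderiv w' f) (z + T *\<^sub>R w) = (dirderiv v' (dirderiv w' f) (z + T *\<^sub>R w) \<bullet> n) *\<^sub>R n"
    using second_derivative_parallel[OF x] by blast
  define y where "y = z + T *\<^sub>R w"
  have comp: "dirderiv v' (dirderiv w' f) y = k *\<^sub>R n \<Longrightarrow> dirderiv v' (dirderiv w' f) y $ i = k * n $ i" for v' w' k
    by simp
  ultimately have Az: "A y $ i \<noteq> 0" "B y $ i = 0" and yW: "y \<in> W" using x by (simp_all add: y_def)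
  have n: "dirderiv v' (dirderiv w' f) y = (dirderiv v' (dirderiv w' f) y \<bullet> n) *\<^sub>R n" for v' w'
    using n(2) by (simp add: y_def)
  have ni: "n $ i \<noteq> 0"
    using Az(1) comp[OF n, of v v] by (auto simp: A_def)
  have zero: "dirderiv v' (dirderiv w' f) y = 0" if "dirderiv v' (dirderiv w' f) y $ i = 0" for v' w'
    using comp[OF n, of v' w'] n[of v' w'] that ni by simp
  have "C y $ i = 0"
    using d0[OF yW] Az by simp
  then have "B y = 0" "C y = 0" using zero Az(2) by (auto simp: B_def C_def)
  moreover have "A y \<noteq> 0" using Az(1) by auto
  ultimately show ?thesis by (simp add: A_def B_def C_def y_def)
qed

end


section \<open>Rulings of the strip\<close>

lemma affine_if_second_derivative_zero:
  fixes \<phi> \<psi> :: "real \<Rightarrow> 'a::real_inner"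
  assumes "convex S" and \<phi>: "\<And>t. t \<in> S \<Longrightarrow> (\<phi> has_vector_derivative \<psi> t) (at t within S)"
    and \<psi>: "\<And>t. t \<in> S \<Longrightarrow> (\<psi> has_vector_derivative 0) (at t within S)"
  obtains c d where "\<And>t. t \<in> S \<Longrightarrow> \<psi> t = c" "\<And>t. t \<in> S \<Longrightarrow> \<phi> t = d + t *\<^sub>R c"
proof -
  obtain c where c: "\<And>t. t \<in> S \<Longrightarrow> \<psi> t = c"
    using has_derivative_zero_constant[OF assms(1), of \<psi>] \<psi> by (auto simp: has_vector_derivative_def)
  have "((\<lambda>t. \<phi> t - t *\<^sub>R c) has_derivative (\<lambda>h. 0)) (at t within S)" if "t \<in> S" for t
    using \<phi>[OF that] c[OF that] unfolding has_vector_derivative_def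
    by (auto intro!: derivative_eq_intros)
  then obtain d where d: "\<And>t. t \<in> S \<Longrightarrow> \<phi> t - t *\<^sub>R c = d"
    using has_derivative_zero_constant[OF assms(1), of "\<lambda>t. \<phi> t - t *\<^sub>R c"] by auto
  have "\<phi> t = d + t *\<^sub>R c" if "t \<in> S" for t
    using d[OF that] by (simp add: algebra_simps)
  then show ?thesis using c by (intro that) auto
qed

lemma in_interior_strip: "p \<in> interior strip \<longleftrightarrow> 0 < snd p \<and> snd p < 1"
  by (cases p) (auto simp: strip_def interior_Times)

text \<open>The point at height \<open>y\<close> of the chord from \<open>(a, 0)\<close> to \<open>(b, 1)\<close>.\<close>

definition chord :: "real \<Rightarrow> real \<Rightarrow> real \<Rightarrow> real \<times> real" where
  "chord a b y = (a + y * (b - a), y)"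

lemma chord_line: "chord a b y = chord a b t + (y - t) *\<^sub>R (b - a, 1)"
  by (simp add: chord_def algebra_simps)

lemma chord_in_interior_strip: "0 < y \<Longrightarrow> y < 1 \<Longrightarrow> chord a b y \<in> interior strip"
  by (simp add: in_interior_strip chord_def)

locale paper_strip =
  fixes l :: real and f :: "real \<times> real \<Rightarrow> real ^ 3"
  assumes l_pos: "0 < l" and smooth_strip: "smooth strip f"
    and isometric_strip: "riemannian_isometric strip f"
    and f_eq_iff: "\<And>p q. p \<in> strip \<Longrightarrow> q \<in> strip \<Longrightarrow> f p = f q \<longleftrightarrow> (\<exists>k. q = glide l k p)"
begin

lemma isometric_surface: "isometric_surface (interior strip) f"
proof
  show "smooth_on (interior strip) f" using smooth_strip by (rule smooth_on_interior)
  fix x v w assume x: "x \<in> interior strip"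
  then have "x \<in> strip" using interior_subset by blast
  from bspec[OF isometric_strip[unfolded riemannian_isometric_def] this]
  obtain D where D: "(f has_derivative D) (at x within strip)" "\<And>u v. D u \<bullet> D v = u \<bullet> v"
    by (elim exE conjE, intro that) (assumption, drule spec, erule spec)
  from D(1) have "(f has_derivative D) (at x)" using x by (simp only: at_within_interior)
  from dirderiv_eq_derivative[OF this] show "dirderiv v f x \<bullet> dirderiv w f x = v \<bullet> w" by (simp only: D(2))
qed (rule open_interior)

sublocale isometric_surface "interior strip" f by (rule isometric_surface)

lemma f_glide: "p \<in> strip \<Longrightarrow> f (glide l k p) = f p"
  by (subst eq_commute, subst f_eq_iff) (auto intro: glide_in_strip)

lemma lipschitz: "p \<in> strip \<Longrightarrow> q \<in> strip \<Longrightarrow> norm (f p - f q) \<le> norm (p - q)"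
proof -
  assume pq: "p \<in> strip" "q \<in> strip"
  have "\<forall>x\<in>strip. \<exists>D. (f has_derivative D) (at x within strip) \<and> (\<forall>u v. D u \<bullet> D v = u \<bullet> v)"
    using isometric_strip unfolding riemannian_isometric_def .
  then obtain D where D: "\<And>x. x \<in> strip \<Longrightarrow> (f has_derivative D x) (at x within strip)"
    "\<And>x u v. x \<in> strip \<Longrightarrow> D x u \<bullet> D x v = u \<bullet> v" by metis
  have "onorm (D x) \<le> 1" if "x \<in> strip" for x
  proof (rule onorm_le)
    show "norm (D x v) \<le> 1 * norm v" for v
      using D(2)[OF that, of v v] by (simp add: norm_eq_sqrt_inner)
  qed
  moreover have "convex strip" unfolding strip_def by (intro convex_Times) auto
  ultimately have "norm (f p - f q) \<le> 1 * norm (p - q)"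
    by (intro differentiable_bound[OF _ D(1)] pq)
  then show ?thesis by simp
qed

lemma continuous_on_strip: "continuous_on strip f"
proof -
  have "dist (f p) (f q) \<le> 1 * dist p q" if "p \<in> strip" "q \<in> strip" for p q
    using lipschitz[OF that] by (simp add: dist_norm)
  then have "1-lipschitz_on strip f" by (intro lipschitz_onI) auto
  then show ?thesis by (rule lipschitz_on_continuous_on)
qed

lemma second_derivative_uminus:
  assumes "x \<in> interior strip"
  shows "dirderiv v (dirderiv (- w) f) x = - dirderiv v (dirderiv w f) x" "dirderiv (- w) (dirderiv (- w) f) x = dirderiv w (dirderiv w f) x"
proof -
  obtain v1 v2 where v: "v = (v1, v2)" by (cases v)
  obtain w1 w2 where w: "w = (w1, w2)" by (cases w)
  show "dirderiv v (dirderiv (- w) f) x = - dirderiv v (dirderiv w f) x"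
    using second_derivative_bilinear[OF assms, of v1 v2 w1 w2]
      second_derivative_bilinear[OF assms, of v1 v2 "- w1" "- w2"]
    by (simp only: v w uminus_Pair) (simp add: algebra_simps)
  show "dirderiv (- w) (dirderiv (- w) f) x = dirderiv w (dirderiv w f) x"
    using second_derivative_bilinear[OF assms, of w1 w2 w1 w2]
      second_derivative_bilinear[OF assms, of "- w1" "- w2" "- w1" "- w2"]
    by (simp only: v w uminus_Pair) simp
qed

lemma ruling_line:
  assumes z: "z \<in> interior strip" and vv: "dirderiv v (dirderiv v f) z \<noteq> 0" and vw: "dirderiv v (dirderiv w f) z = 0"
    and T: "z + T *\<^sub>R w \<in> interior strip"
  shows "dirderiv v (dirderiv v f) (z + T *\<^sub>R w) \<noteq> 0 \<and> dirderiv w (dirderiv w f) (z + T *\<^sub>R w) = 0"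
proof -
  have line: "z + t *\<^sub>R w \<in> interior strip" if "0 \<le> t / T" "t / T \<le> 1" "T \<noteq> 0" for t
  proof -
    have "convex (interior strip)" unfolding strip_def by (intro convex_interior convex_Times) auto
    then have "(1 - t / T) *\<^sub>R z + (t / T) *\<^sub>R (z + T *\<^sub>R w) \<in> interior strip"
      using that z T by (intro convexD) auto
    then show ?thesis using that(3) by (simp add: algebra_simps)
  qed
  show ?thesis
  proof (cases "0 \<le> T")
    case True
    have "z + t *\<^sub>R w \<in> interior strip" if "0 \<le> t" "t \<le> T" for t
      using line[of t] that z by (cases "T = 0") auto
    then show ?thesis using ruling_persists[OF True _ vv vw] by blast
  next
    case False
    have 1: "z + t *\<^sub>R - w \<in> interior strip" if "0 \<le> t" "t \<le> - T" for t
      using line[of "- t"] that False by (simp add: field_simps)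
    have "dirderiv v (dirderiv (- w) f) z = 0" using second_derivative_uminus(1)[OF z] vw by simp
    then show ?thesis
      using ruling_persists[OF _ 1 vv, of "- T"] False second_derivative_uminus(2)[OF T] by auto
  qed
qed

text \<open>On such a line \<open>f\<close> would be affine with unit speed, but it has the period \<open>2 l\<close>.\<close>

lemma no_horizontal_ruling:
  assumes y: "0 < y" "y < 1"
  shows "\<exists>t. dirderiv (1, 0) (dirderiv (1, 0) f) (x + t, y) \<noteq> 0"
proof (rule ccontr)
  assume "\<not> ?thesis"
  then have z: "dirderiv (1, 0) (dirderiv (1, 0) f) (x + t, y) = 0" for t by auto
  have W: "(x, y) + t *\<^sub>R (1, 0) \<in> interior strip" for t using y by (simp add: in_interior_strip)
  obtain c d where c: "\<And>t. t \<in> UNIV \<Longrightarrow> dirderiv (1, 0) f ((x, y) + t *\<^sub>R (1, 0)) = c"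
    "\<And>t. t \<in> UNIV \<Longrightarrow> f ((x, y) + t *\<^sub>R (1, 0)) = d + t *\<^sub>R c"
  proof (rule affine_if_second_derivative_zero[of UNIV])
    show "((\<lambda>t. f ((x, y) + t *\<^sub>R (1, 0))) has_vector_derivative dirderiv (1, 0) f ((x, y) + t *\<^sub>R (1, 0))) (at t)" for t
      by (rule has_vector_derivative_along_line[OF open_W smooth_f W])
    show "((\<lambda>t. dirderiv (1, 0) f ((x, y) + t *\<^sub>R (1, 0))) has_vector_derivative 0) (at t)" for t
      using has_vector_derivative_along_line[OF open_W smooth_dirderiv(1)[of "(1, 0)"] W[of t], of UNIV] z
      by simp
  qed auto
  have "c \<bullet> c = 1" using c(1)[of 0] isometric[OF W[of 0], of "(1, 0)" "(1, 0)"] by simp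
  moreover have "f (x + 2 * l, y) = f (x, y)"
    using f_glide[of "(x, y)" 2] y by (simp add: glide_def strip_def)
  then have "(2 * l) *\<^sub>R c = 0" using c(2)[of 0] c(2)[of "2 * l"] by simp
  then have "c = 0" using l_pos by simp
  ultimately show False by simp
qed

definition flat_at :: "real \<times> real \<Rightarrow> bool" where
  "flat_at x \<longleftrightarrow> (\<forall>v w. dirderiv v (dirderiv w f) x = 0)"

text \<open>The open chord consists of curved points, and its direction is the kernel of the second fundamental
  form.\<close>

definition rulings :: "(real \<times> real) set" where
  "rulings = {(a, b). \<forall>y. 0 < y \<and> y < 1 \<longrightarrow>
     \<not> flat_at (chord a b y) \<and> dirderiv (b - a, 1) (dirderiv (b - a, 1) f) (chord a b y) = 0}"

text \<open>The coefficients \<open>\<alpha>\<close>, \<open>\<beta>\<close>, \<open>\<gamma>\<close> of the second fundamental form turn questions about its kernel into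
  scalar algebra.\<close>

lemma fundamental_form:
  assumes x: "x \<in> interior strip"
  obtains n \<alpha> \<beta> \<gamma> where "n \<bullet> n = 1" "\<alpha> * \<gamma> = \<beta>\<^sup>2"
    "\<And>a b c d. dirderiv (a, b) (dirderiv (c, d) f) x = (a * c * \<alpha> + (a * d + b * c) * \<beta> + b * d * \<gamma>) *\<^sub>R n"
proof -
  obtain n where n: "n \<bullet> n = 1" "\<And>v w. dirderiv v (dirderiv w f) x = (dirderiv v (dirderiv w f) x \<bullet> n) *\<^sub>R n"
    using second_derivative_parallel[OF x] by blast
  define \<alpha> \<beta> \<gamma> where "\<alpha> = dirderiv (1, 0) (dirderiv (1, 0) f) x \<bullet> n" "\<beta> = dirderiv (1, 0) (dirderiv (0, 1) f) x \<bullet> n"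
    "\<gamma> = dirderiv (0, 1) (dirderiv (0, 1) f) x \<bullet> n"
  have h: "dirderiv (1, 0) (dirderiv (1, 0) f) x = \<alpha> *\<^sub>R n" "dirderiv (1, 0) (dirderiv (0, 1) f) x = \<beta> *\<^sub>R n"
    "dirderiv (0, 1) (dirderiv (0, 1) f) x = \<gamma> *\<^sub>R n"
    unfolding \<alpha>_\<beta>_\<gamma>_def by (rule n(2))+
  show ?thesis
  proof
    show "\<alpha> * \<gamma> = \<beta>\<^sup>2"
      using gauss[OF x, of "(1, 0)" "(0, 1)"] n(1) by (simp add: h power2_eq_square mult.commute)
    show "dirderiv (a, b) (dirderiv (c, d) f) x = (a * c * \<alpha> + (a * d + b * c) * \<beta> + b * d * \<gamma>) *\<^sub>R n"
      for a b c d
      using second_derivative_bilinear[OF x, of a b c d] by (simp add: h algebra_simps)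
  qed (rule n)
qed

lemma flat_at_iff:
  assumes "x \<in> interior strip"
  shows "flat_at x \<longleftrightarrow> dirderiv (1, 0) (dirderiv (1, 0) f) x = 0 \<and> dirderiv (0, 1) (dirderiv (0, 1) f) x = 0"
proof -
  obtain n \<alpha> \<beta> \<gamma> where n: "n \<bullet> n = 1" "\<alpha> * \<gamma> = \<beta>\<^sup>2"
    "\<And>a b c d. dirderiv (a, b) (dirderiv (c, d) f) x = (a * c * \<alpha> + (a * d + b * c) * \<beta> + b * d * \<gamma>) *\<^sub>R n"
    using fundamental_form[OF assms] by metis
  have "n \<noteq> 0" using n(1) by auto
  moreover have "flat_at x" if "\<alpha> = 0" "\<gamma> = 0"
    using n(2) that unfolding flat_at_def by (simp add: n(3) split_paired_all)
  ultimately show ?thesis unfolding flat_at_def using n(3)[of 1 0 1 0] n(3)[of 0 1 0 1] by auto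
qed

text \<open>If \<open>\<alpha> = 0\<close>, the kernel direction would be horizontal. Hence the kernel is spanned by
  \<open>(- \<beta> / \<alpha>, 1)\<close>, and the line in this direction reaches both sides of the strip.\<close>

lemma ruling_through_curved_point:
  assumes z: "z \<in> interior strip" and curved: "\<not> flat_at z"
  obtains a b where "(a, b) \<in> rulings" "z = chord a b (snd z)"
proof -
  obtain n \<alpha> \<beta> \<gamma> where n: "n \<bullet> n = 1" "\<alpha> * \<gamma> = \<beta>\<^sup>2"
    "\<And>a b c d. dirderiv (a, b) (dirderiv (c, d) f) z = (a * c * \<alpha> + (a * d + b * c) * \<beta> + b * d * \<gamma>) *\<^sub>R n"
    using fundamental_form[OF z] by metis
  have n0: "n \<noteq> 0" using n(1) by auto
  have \<alpha>: "\<alpha> \<noteq> 0"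
  proof
    assume "\<alpha> = 0"
    then have "\<beta> = 0" using n(2) by simp
    have "dirderiv (0, 1) (dirderiv (0, 1) f) z \<noteq> 0" "dirderiv (0, 1) (dirderiv (1, 0) f) z = 0"
      using curved \<open>\<alpha> = 0\<close> \<open>\<beta> = 0\<close> n0 unfolding flat_at_iff[OF z] by (simp_all add: n(3))
    from ruling_line[OF z this] have "dirderiv (1, 0) (dirderiv (1, 0) f) (fst z + t, snd z) = 0" for t
      using z by (cases z) (simp add: in_interior_strip)
    then show False using no_horizontal_ruling z unfolding in_interior_strip by blast
  qed
  define k where "k = - \<beta> / \<alpha>"
  define a where "a = fst z - snd z * k"
  define b where "b = a + k"
  have zc: "z = chord a b (snd z)" by (simp add: chord_def a_def b_def prod_eq_iff)
  have 1: "dirderiv (1, 0) (dirderiv (1, 0) f) z \<noteq> 0" "dirderiv (1, 0) (dirderiv (k, 1) f) z = 0"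
    using \<alpha> n0 by (simp_all add: n(3) k_def)
  have "(a, b) \<in> rulings"
    unfolding rulings_def mem_Collect_eq case_prod_conv
  proof (intro allI impI)
    fix y :: real assume y: "0 < y \<and> y < 1"
    have "chord a b y = z + (y - snd z) *\<^sub>R (k, 1)"
      using chord_line[of a b y "snd z"] zc by (simp add: b_def)
    then show "\<not> flat_at (chord a b y) \<and> dirderiv (b - a, 1) (dirderiv (b - a, 1) f) (chord a b y) = 0"
      using ruling_line[OF z 1, of "y - snd z"] chord_in_interior_strip[of y a b] y
      by (auto simp: flat_at_iff b_def)
  qed
  with zc show ?thesis using that by blast
qed

text \<open>A form of rank one has only one kernel direction.\<close>

lemma ruling_slope_unique:
  assumes "(a, b) \<in> rulings" "(a', b') \<in> rulings" "0 < y" "y < 1" "chord a b y = chord a' b' y"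
  shows "a = a' \<and> b = b'"
proof -
  let ?x = "chord a b y"
  have x: "?x \<in> interior strip" using chord_in_interior_strip assms by blast
  obtain n \<alpha> \<beta> \<gamma> where n: "n \<bullet> n = 1" "\<alpha> * \<gamma> = \<beta>\<^sup>2"
    "\<And>a b c d. dirderiv (a, b) (dirderiv (c, d) f) ?x = (a * c * \<alpha> + (a * d + b * c) * \<beta> + b * d * \<gamma>) *\<^sub>R n"
    using fundamental_form[OF x] by metis
  have n0: "n \<noteq> 0" using n(1) by auto
  have 1: "\<not> flat_at ?x" "dirderiv (b - a, 1) (dirderiv (b - a, 1) f) ?x = 0"
     "dirderiv (b' - a', 1) (dirderiv (b' - a', 1) f) ?x = 0"
    using assms(1-4) assms(5)[symmetric] unfolding rulings_def by auto
  have slope: "\<alpha> * k = - \<beta>" if "dirderiv (k, 1) (dirderiv (k, 1) f) ?x = 0" for k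
  proof -
    have "k * k * \<alpha> + (k + k) * \<beta> + \<gamma> = 0" using that n0 by (simp add: n(3))
    then have "(\<alpha> * k + \<beta>)\<^sup>2 = 0" using n(2) by algebra
    then show ?thesis by simp
  qed
  have "\<alpha> \<noteq> 0"
  proof
    assume "\<alpha> = 0"
    then have "\<beta> = 0" using n(2) by simp
    then have "\<gamma> = 0" using 1(2) \<open>\<alpha> = 0\<close> n0 by (simp add: n(3))
    then show False using 1(1) \<open>\<alpha> = 0\<close> by (simp add: flat_at_iff[OF x] n(3))
  qed
  then have "b - a = b' - a'" using slope[OF 1(2)] slope[OF 1(3)] by (metis mult_cancel_left)
  then show ?thesis using assms(5) by (auto simp: chord_def)
qed

text \<open>If the end points of two chords are in opposite orders on the two sides of the strip, the chords meet
  inside. So \<open>a\<close> and \<open>b\<close> increase together from ruling to ruling, which in terms of sum and difference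
  is a Lipschitz condition.\<close>

lemma rulings_do_not_cross:
  assumes "(a, b) \<in> rulings" "(a', b') \<in> rulings"
  shows "\<bar>(a - b) - (a' - b')\<bar> \<le> \<bar>(a + b) - (a' + b')\<bar>"
proof -
  have no: False if "(a, b) \<in> rulings" "(a', b') \<in> rulings" "a < a'" "b' < b" for a b a' b'
  proof -
    define y where "y = (a' - a) / ((a' - a) + (b - b'))"
    have y: "0 < y" "y < 1" using that by (auto simp: y_def field_simps)
    have "y * ((a' - a) + (b - b')) = a' - a" using that by (simp add: y_def)
    then have "chord a b y = chord a' b' y" by (simp add: chord_def algebra_simps)
    then show False using ruling_slope_unique[OF that(1,2) y] that by auto
  qed
  have "\<not> (a < a' \<and> b' < b)" "\<not> (a' < a \<and> b < b')"
    using no[OF assms] no[OF assms(2,1)] by blast+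
  then show ?thesis by (auto simp: not_less abs_if)
qed

lemma dirderiv_glide:
  assumes F: "smooth_on (interior strip) F" and c: "c = l \<or> c = - l"
    and G: "\<And>x. x \<in> interior strip \<Longrightarrow> (G x :: real ^ 3) = F (fst x + c, 1 - snd x)"
    and x: "x \<in> interior strip"
  shows "dirderiv v G x = dirderiv (fst v, - snd v) F (fst x + c, 1 - snd x)"
proof -
  let ?g = "\<lambda>x. (fst x + c, 1 - snd x :: real)"
  have gx: "?g x \<in> interior strip" using x by (auto simp: in_interior_strip)
  have "(?g has_derivative (\<lambda>v. (fst v, - snd v))) (at x)"
    by (auto intro!: derivative_eq_intros)
  from has_derivative_compose[OF this smooth_on_has_derivative[OF open_W F gx]]
  have "((\<lambda>x. F (?g x)) has_derivative (\<lambda>v. dirderiv (fst v, - snd v) F (?g x))) (at x)" by simp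
  then have "(G has_derivative (\<lambda>v. dirderiv (fst v, - snd v) F (?g x))) (at x)"
    by (rule has_derivative_transform_within_open[OF _ open_W x]) (simp add: G)
  then show ?thesis by (rule dirderiv_eq_derivative)
qed

text \<open>The deck transformation turns the chord from \<open>(a, 0)\<close> to \<open>(b, 1)\<close> upside down.\<close>

lemma rulings_glide:
  assumes "(a, b) \<in> rulings" and c: "c = l \<or> c = - l"
  shows "(b + c, a + c) \<in> rulings"
proof -
  have f: "f x = f (fst x + c, 1 - snd x)" if "x \<in> interior strip" for x
  proof -
    have "(fst x + c, 1 - snd x) = glide l (if c = l then 1 else - 1) x"
      using c by (auto simp: glide_def)
    moreover have "x \<in> strip" using that interior_subset by blast
    ultimately show ?thesis using f_glide by metis
  qed
  have 2: "dirderiv v (dirderiv w f) x = dirderiv (fst v, - snd v) (dirderiv (fst w, - snd w) f) (fst x + c, 1 - snd x)"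
    if "x \<in> interior strip" for v w x
    by (rule dirderiv_glide[OF smooth_dirderiv(1) c dirderiv_glide[OF smooth_f c f] that])
  show ?thesis
    unfolding rulings_def mem_Collect_eq case_prod_conv
  proof (intro allI impI)
    fix y :: real assume y: "0 < y \<and> y < 1"
    let ?x = "chord (b + c) (a + c) y" and ?x' = "chord a b (1 - y)"
    have x: "?x \<in> interior strip" and x': "?x' \<in> interior strip"
      using y by (auto intro: chord_in_interior_strip)
    have e: "(fst ?x' + c, 1 - snd ?x') = ?x" by (simp add: chord_def algebra_simps)
    have r: "\<not> flat_at ?x'" "dirderiv (b - a, 1) (dirderiv (b - a, 1) f) ?x' = 0"
      using assms(1) y unfolding rulings_def by auto
    have "\<not> flat_at ?x"
      using r(1) 2[OF x'] unfolding e flat_at_def by auto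
    moreover have "dirderiv (b - a, - 1) (dirderiv (b - a, - 1) f) ?x = 0"
      using r(2) 2[OF x', of "(b - a, 1)" "(b - a, 1)"] unfolding e by simp
    then have "dirderiv (a - b, 1) (dirderiv (a - b, 1) f) ?x = 0"
      using second_derivative_uminus(2)[OF x, of "(b - a, - 1)"] by (simp add: uminus_prod_def)
    ultimately show "\<not> flat_at ?x \<and>
        dirderiv (a + c - (b + c), 1) (dirderiv (a + c - (b + c), 1) f) ?x = 0" by simp
  qed
qed

text \<open>The velocity is constant on the open chord; continuity up to the boundary covers the end points.\<close>

lemma straight_chord:
  assumes "\<And>y. 0 < y \<Longrightarrow> y < 1 \<Longrightarrow> dirderiv (b - a, 1) (dirderiv (b - a, 1) f) (chord a b y) = 0"
  shows "0 \<le> y \<Longrightarrow> y \<le> 1 \<Longrightarrow> f (chord a b y) = f (a, 0) + y *\<^sub>R (f (b, 1) - f (a, 0))"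
    "(norm (f (b, 1) - f (a, 0)))\<^sup>2 = 1 + (b - a)\<^sup>2"
proof -
  let ?w = "(b - a, 1 :: real)"
  have ch: "chord a b t = (a, 0) + t *\<^sub>R ?w" for t by (simp add: chord_def)
  have W: "(a, 0) + t *\<^sub>R ?w \<in> interior strip" if "t \<in> {0<..<1}" for t
    using that by (simp add: in_interior_strip)
  obtain c d where c: "\<And>t. t \<in> {0<..<1} \<Longrightarrow> dirderiv ?w f ((a, 0) + t *\<^sub>R ?w) = c"
    "\<And>t. t \<in> {0<..<1} \<Longrightarrow> f ((a, 0) + t *\<^sub>R ?w) = d + t *\<^sub>R c"
  proof (rule affine_if_second_derivative_zero[of "{0<..<1}"])
    fix t :: real assume t: "t \<in> {0<..<1}"
    show "((\<lambda>t. f ((a, 0) + t *\<^sub>R ?w)) has_vector_derivative dirderiv ?w f ((a, 0) + t *\<^sub>R ?w))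
        (at t within {0<..<1})"
      by (rule has_vector_derivative_along_line[OF open_W smooth_f W[OF t]])
    show "((\<lambda>t. dirderiv ?w f ((a, 0) + t *\<^sub>R ?w)) has_vector_derivative 0) (at t within {0<..<1})"
      using has_vector_derivative_along_line[OF open_W smooth_dirderiv(1) W[OF t], of ?w] assms[of t] t
      by (simp add: ch)
  qed auto
  have "c \<bullet> c = ?w \<bullet> ?w"
    using c(1)[of "1/2"] isometric[OF W[of "1/2"], of ?w ?w] by simp
  then have cc: "c \<bullet> c = 1 + (b - a)\<^sup>2" by (simp add: power2_eq_square)
  have lin: "f (chord a b t) - (d + t *\<^sub>R c) = 0" if "t \<in> {0..1}" for t
  proof (rule continuous_constant_on_closure[where S = "{0<..<1}"
        and f = "\<lambda>t. f (chord a b t) - (d + t *\<^sub>R c)"])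
    have "continuous_on {0..1} (\<lambda>t. f (chord a b t))"
      by (rule continuous_on_compose2[OF continuous_on_strip])
        (auto simp: chord_def strip_def intro!: continuous_intros)
    then show "continuous_on (closure {0<..<1}) (\<lambda>t. f (chord a b t) - (d + t *\<^sub>R c))"
      by (auto intro!: continuous_intros)
  qed (use c(2) that in \<open>auto simp: ch\<close>)
  have e: "f (a, 0) = d" "f (b, 1) - f (a, 0) = c"
    using lin[of 0] lin[of 1] by (simp_all add: chord_def)
  show "0 \<le> y \<Longrightarrow> y \<le> 1 \<Longrightarrow> f (chord a b y) = f (a, 0) + y *\<^sub>R (f (b, 1) - f (a, 0))"
    using lin[of y] e by simp
  show "(norm (f (b, 1) - f (a, 0)))\<^sup>2 = 1 + (b - a)\<^sup>2"
    using cc e(2) by (simp add: power2_norm_eq_inner)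
qed

end


section \<open>A pair of perpendicular coplanar lines\<close>

text \<open>Combine both conditions into one complex function \<open>H\<close> on the plane of pairs \<open>(s, s')\<close>, and suppose
  that it has no zero. Then it has a continuous logarithm \<open>L\<close>. The swap \<open>(s, s') \<mapsto> (s', s + \<tau>)\<close>
  changes the sign of \<open>H\<close>, so it changes \<open>L\<close> by a constant odd multiple of \<open>\<i> \<pi>\<close>. Applied twice, it is
  the translation by \<open>(\<tau>, \<tau>)\<close>, so \<open>Im L\<close> changes by a nonzero amount of at least \<open>2 \<pi>\<close> along the
  diagonal. But there \<open>Re H > 0\<close>, which keeps \<open>Im L\<close> within an interval of length \<open>\<pi>\<close>.\<close>

lemma perpendicular_coplanar_pair:
  fixes e m :: "real \<Rightarrow> real ^ 3"
  assumes cont: "continuous_on UNIV e" "continuous_on UNIV m"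
    and e: "\<And>s. e (s + \<tau>) = - e s" and m: "\<And>s. m (s + \<tau>) = m s" and ne: "\<And>s. e s \<noteq> 0"
  obtains s s' where "e s \<bullet> e s' = 0" "(m s - m s') \<bullet> cross3 (e s) (e s') = 0"
proof (rule ccontr)
  assume "\<not> thesis"
  then have no: "\<not> (e s \<bullet> e s' = 0 \<and> (m s - m s') \<bullet> cross3 (e s) (e s') = 0)" for s s'
    using that by blast
  define H where "H x = Complex (e (fst x) \<bullet> e (snd x))
      ((m (fst x) - m (snd x)) \<bullet> cross3 (e (fst x)) (e (snd x)))" for x :: "real \<times> real"
  have H0: "H x \<noteq> 0" for x
    using no by (auto simp: H_def complex_eq_iff)
  have c: "continuous_on UNIV (\<lambda>x. e (fst x))" "continuous_on UNIV (\<lambda>x. e (snd x))"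
    "continuous_on UNIV (\<lambda>x. m (fst x))" "continuous_on UNIV (\<lambda>x. m (snd x))" for x :: "real \<times> real"
    by (auto intro!: continuous_on_compose2[OF cont(1)] continuous_on_compose2[OF cont(2)]
        continuous_intros)
  have "continuous_on UNIV H"
    unfolding H_def[abs_def] Complex_eq
    by (intro continuous_intros continuous_on_cross c)
  then obtain L where L: "continuous_on UNIV L" "\<And>x. H x = exp (L x)"
    using continuous_logarithm_on_contractible[of UNIV H] H0 by (auto simp: contractible_UNIV)
  have H_swap: "H (s', s + \<tau>) = - H (s, s')" for s s'
    by (simp add: H_def complex_eq_iff e m inner_commute cross_skew[of "e s'"] inner_diff_left inner_diff_right)
  define K where "K x = L (snd x, fst x + \<tau>) - L x" for x
  have expK: "exp (K x) = - 1" for x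
    using H_swap[of "snd x" "fst x"] H0[of x] by (simp add: K_def exp_diff flip: L(2))
  have "K constant_on UNIV"
  proof (rule continuous_discrete_range_constant)
    show "continuous_on UNIV K"
      unfolding K_def[abs_def] by (intro continuous_intros continuous_on_compose2[OF L(1)]) auto
    fix x show "\<exists>d>0. \<forall>y. y \<in> UNIV \<and> K y \<noteq> K x \<longrightarrow> d \<le> norm (K y - K x)"
    proof (intro exI[of _ "2 * pi"] conjI allI impI)
      fix y assume y: "y \<in> UNIV \<and> K y \<noteq> K x"
      have "exp (K y) = exp (K x)" by (simp add: expK)
      then obtain n :: int where n: "K y = K x + (of_int (2 * n) * pi) * \<i>"
        unfolding exp_eq by blast
      with y have "n \<noteq> 0" by auto
      then have "1 \<le> \<bar>real_of_int n\<bar>" by linarith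
      then show "2 * pi \<le> norm (K y - K x)"
        by (simp add: n norm_mult)
    qed simp
  qed (rule connected_UNIV)
  then obtain k where k: "\<And>x. K x = k" unfolding constant_on_def by blast
  have L_shift: "L (s + \<tau>, s' + \<tau>) = L (s, s') + 2 * k" for s s'
    using k[of "(s', s + \<tau>)"] k[of "(s, s')"] by (simp add: K_def algebra_simps)
  have "exp k = - 1" using expK k by metis
  then have "exp k = exp (\<i> * pi)" by simp
  then obtain n :: int where n: "k = \<i> * pi + (of_int (2 * n) * pi) * \<i>"
    unfolding exp_eq by blast
  define \<theta> where "\<theta> s = Im (L (s, s))" for s
  have \<theta>_cont: "continuous_on UNIV \<theta>"
    unfolding \<theta>_def[abs_def] by (intro continuous_intros continuous_on_compose2[OF L(1)]) auto
  have cos_pos: "cos (\<theta> s) > 0" for s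
  proof -
    have "Re (H (s, s)) > 0" using ne by (simp add: H_def)
    then show ?thesis by (simp add: L(2) Re_exp \<theta>_def zero_less_mult_iff)
  qed
  have \<theta>_shift: "\<theta> (0 + \<tau>) = \<theta> 0 + 2 * pi * (2 * of_int n + 1)"
    using L_shift[of 0 0] by (simp add: \<theta>_def n algebra_simps)
  have "connected (range \<theta>)"
    by (rule connected_continuous_image[OF \<theta>_cont connected_UNIV])
  then have iv: "is_interval (range \<theta>)" by (simp add: is_interval_connected_1)
  have odd_ge_1: "1 \<le> \<bar>2 * of_int n + 1 :: real\<bar>"
  proof -
    have "1 \<le> \<bar>2 * n + 1\<bar>" by presburger
    then have "real_of_int 1 \<le> real_of_int \<bar>2 * n + 1\<bar>" by (simp only: of_int_le_iff)
    then show ?thesis by simp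
  qed
  \<comment> \<open>The argument on the diagonal passes a value at which its cosine has the opposite sign.\<close>
  have "\<theta> 0 + pi \<in> range \<theta> \<or> \<theta> 0 - pi \<in> range \<theta>"
  proof (cases "2 * of_int n + 1 > (0::real)")
    case True
    then have "1 \<le> (2 * of_int n + 1 :: real)" using odd_ge_1 by linarith
    then have "pi * 1 \<le> pi * (2 * of_int n + 1)" by (intro mult_left_mono) auto
    then have "\<theta> 0 + pi \<le> \<theta> (0 + \<tau>)" using \<theta>_shift pi_gt_zero by linarith
    then have "\<theta> 0 + pi \<in> range \<theta>"
      using mem_is_interval_1_I[OF iv, of "\<theta> 0" "\<theta> (0 + \<tau>)"] pi_gt_zero by auto
    then show ?thesis ..
  next
    case False
    then have "(2 * of_int n + 1 :: real) \<le> - 1" using odd_ge_1 by linarith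
    then have "pi * (2 * of_int n + 1) \<le> pi * (- 1)" by (intro mult_left_mono) auto
    then have "\<theta> (0 + \<tau>) \<le> \<theta> 0 - pi" using \<theta>_shift pi_gt_zero by linarith
    then have "\<theta> 0 - pi \<in> range \<theta>"
      using mem_is_interval_1_I[OF iv, of "\<theta> (0 + \<tau>)" "\<theta> 0"] pi_gt_zero by auto
    then show ?thesis ..
  qed
  then obtain s where "\<theta> s = \<theta> 0 + pi \<or> \<theta> s = \<theta> 0 - pi" by force
  then have "cos (\<theta> s) = - cos (\<theta> 0)" by auto
  then show False using cos_pos[of s] cos_pos[of 0] by linarith
qed


section \<open>Straight chords and the T-pattern\<close>

text \<open>McShane's extension, the largest 1-Lipschitz function that agrees with the given values.\<close>

lemma mcshane_extension:
  fixes Z :: "(real \<times> real) set"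
  defines "U \<equiv> \<lambda>s. Inf ((\<lambda>(s', d). d + \<bar>s - s'\<bar>) ` Z)"
  assumes ne: "Z \<noteq> {}"
    and lip: "\<And>s d s' d'. (s, d) \<in> Z \<Longrightarrow> (s', d') \<in> Z \<Longrightarrow> \<bar>d - d'\<bar> \<le> \<bar>s - s'\<bar>"
  shows "\<bar>U s - U s'\<bar> \<le> \<bar>s - s'\<bar>" "(s, d) \<in> Z \<Longrightarrow> U s = d"
proof -
  obtain s0 d0 where 0: "(s0, d0) \<in> Z" using ne by auto
  have bdd: "bdd_below ((\<lambda>(s', d). d + \<bar>s - s'\<bar>) ` Z)" for s
  proof (rule bdd_belowI)
    fix x assume "x \<in> (\<lambda>(s', d). d + \<bar>s - s'\<bar>) ` Z"
    then obtain s' d where "(s', d) \<in> Z" "x = d + \<bar>s - s'\<bar>" by auto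
    then show "d0 - \<bar>s - s0\<bar> \<le> x" using lip[OF 0, of s' d] by linarith
  qed
  have le: "U s \<le> U s' + \<bar>s - s'\<bar>" for s s'
  proof -
    have "U s - \<bar>s - s'\<bar> \<le> U s'"
      unfolding U_def
    proof (rule cInf_greatest)
      fix x assume "x \<in> (\<lambda>(s'', d). d + \<bar>s' - s''\<bar>) ` Z"
      then obtain s'' d where x: "(s'', d) \<in> Z" "x = d + \<bar>s' - s''\<bar>" by auto
      have "Inf ((\<lambda>(s', d). d + \<bar>s - s'\<bar>) ` Z) \<le> d + \<bar>s - s''\<bar>"
        by (rule cInf_lower[OF _ bdd]) (use x in force)
      then show "Inf ((\<lambda>(s', d). d + \<bar>s - s'\<bar>) ` Z) - \<bar>s - s'\<bar> \<le> x" using x(2) by linarith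
    qed (use ne in auto)
    then show ?thesis by simp
  qed
  show "\<bar>U s - U s'\<bar> \<le> \<bar>s - s'\<bar>" using le[of s s'] le[of s' s] by linarith
  show "U s = d" if "(s, d) \<in> Z"
    unfolding U_def
  proof (rule cInf_eq_minimum)
    show "d \<in> (\<lambda>(s', d). d + \<bar>s - s'\<bar>) ` Z" using that by force
    fix x assume "x \<in> (\<lambda>(s', d). d + \<bar>s - s'\<bar>) ` Z"
    then obtain s' d' where "(s', d') \<in> Z" "x = d' + \<bar>s - s'\<bar>" by auto
    then show "d \<le> x" using lip[OF that, of s' d'] by linarith
  qed
qed

text \<open>The McShane extension \<open>U Z\<close> need not be antiperiodic, but translation by \<open>\<tau>\<close> exchanges it with
  the extension of the negated data \<open>N\<close>. So half of the difference of the two is antiperiodic.\<close>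

lemma antiperiodic_lipschitz_extension:
  fixes Z :: "(real \<times> real) set"
  assumes lip: "\<And>s d s' d'. (s, d) \<in> Z \<Longrightarrow> (s', d') \<in> Z \<Longrightarrow> \<bar>d - d'\<bar> \<le> \<bar>s - s'\<bar>"
    and shift: "\<And>s d. (s, d) \<in> Z \<Longrightarrow> (s + \<tau>, - d) \<in> Z" "\<And>s d. (s, d) \<in> Z \<Longrightarrow> (s - \<tau>, - d) \<in> Z"
  obtains D where "\<And>s s'. \<bar>D s - D s'\<bar> \<le> \<bar>s - s'\<bar>" "\<And>s. D (s + \<tau>) = - D s"
    "\<And>s d. (s, d) \<in> Z \<Longrightarrow> D s = (d :: real)"
proof (cases "Z = {}")
  case True
  then show ?thesis by (intro that[of "\<lambda>s. 0"]) auto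
next
  case False
  define N where "N = (\<lambda>(s, d). (s, - d)) ` Z"
  define U where "U Y s = Inf ((\<lambda>(s', d). d + \<bar>s - s'\<bar>) ` Y)" for Y :: "(real \<times> real) set" and s
  have N_ne: "N \<noteq> {}" using False by (simp add: N_def)
  have N_lip: "\<bar>d - d'\<bar> \<le> \<bar>s - s'\<bar>" if "(s, d) \<in> N" "(s', d') \<in> N" for s d s' d'
    using that lip unfolding N_def by fastforce
  have shift_U: "U ((\<lambda>(s, d). (s + \<tau>, d)) ` Y) (s + \<tau>) = U Y s" for Y s
    by (simp add: U_def image_image case_prod_unfold)
  have NZ: "(\<lambda>(s, d). (s + \<tau>, d)) ` N = Z" "(\<lambda>(s, d). (s + \<tau>, d)) ` Z = N"
  proof -
    have "(s, d) \<in> (\<lambda>(s, d). (s + \<tau>, d)) ` N" if "(s, d) \<in> Z" for s d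
      using shift(2)[OF that] unfolding N_def image_image by force
    then show "(\<lambda>(s, d). (s + \<tau>, d)) ` N = Z"
      using shift(1) by (auto simp: N_def)
    have "(s, - d) \<in> (\<lambda>(s, d). (s + \<tau>, d)) ` Z" if "(s, d) \<in> Z" for s d
      using shift(2)[OF that] by force
    then show "(\<lambda>(s, d). (s + \<tau>, d)) ` Z = N"
      using shift(1) by (force simp: N_def)
  qed
  have UZ: "\<bar>U Z s - U Z s'\<bar> \<le> \<bar>s - s'\<bar>" "(s, d) \<in> Z \<Longrightarrow> U Z s = d" for s s' d
    using mcshane_extension(1)[OF False, of s s'] mcshane_extension(2)[OF False, of s d] lip
    unfolding U_def by blast+
  have UN: "\<bar>U N s - U N s'\<bar> \<le> \<bar>s - s'\<bar>" "(s, d) \<in> N \<Longrightarrow> U N s = d" for s s' d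
    using mcshane_extension(1)[OF N_ne, of s s'] mcshane_extension(2)[OF N_ne, of s d] N_lip
    unfolding U_def by blast+
  show ?thesis
  proof (rule that[of "\<lambda>s. (U Z s - U N s) / 2"])
    show "\<bar>(U Z s - U N s) / 2 - (U Z s' - U N s') / 2\<bar> \<le> \<bar>s - s'\<bar>" for s s'
    proof -
      have "\<bar>(U Z s - U Z s') - (U N s - U N s')\<bar> \<le> \<bar>U Z s - U Z s'\<bar> + \<bar>U N s - U N s'\<bar>"
        by (rule abs_triangle_ineq4)
      also have "\<dots> \<le> \<bar>s - s'\<bar> + \<bar>s - s'\<bar>" by (intro add_mono UZ UN)
      finally have "\<bar>(U Z s - U Z s') - (U N s - U N s')\<bar> \<le> 2 * \<bar>s - s'\<bar>" by simp
      then have "\<bar>((U Z s - U Z s') - (U N s - U N s')) / 2\<bar> \<le> \<bar>s - s'\<bar>" by simp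
      moreover have "((U Z s - U Z s') - (U N s - U N s')) / 2 =
          (U Z s - U N s) / 2 - (U Z s' - U N s') / 2" by (simp add: diff_divide_distrib)
      ultimately show ?thesis by (simp only:)
    qed
    show "(U Z (s + \<tau>) - U N (s + \<tau>)) / 2 = - ((U Z s - U N s) / 2)" for s
      using shift_U[of N s] shift_U[of Z s] by (simp only: NZ) (simp add: diff_divide_distrib)
    show "(U Z s - U N s) / 2 = d" if "(s, d) \<in> Z" for s d
    proof -
      have "(s, - d) \<in> N" using that by (force simp: N_def)
      then show ?thesis using UZ(2)[OF that] UN(2) by simp
    qed
  qed
qed

lemma antiperiodic_int:
  fixes h :: "real \<Rightarrow> 'a::real_vector"
  assumes h: "\<And>s. h (s + \<tau>) = - h s"
  shows "h (s + of_int k * \<tau>) = (if even k then h s else - h s)"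
proof (induction k rule: int_induct[where k = 0])
  case (step1 i)
  have "s + of_int (i + 1) * \<tau> = (s + of_int i * \<tau>) + \<tau>" by (simp add: algebra_simps)
  then have "h (s + of_int (i + 1) * \<tau>) = - h (s + of_int i * \<tau>)" by (simp only: h)
  then show ?case using step1 by auto
next
  case (step2 i)
  have "s + of_int i * \<tau> = (s + of_int (i - 1) * \<tau>) + \<tau>" by (simp add: algebra_simps)
  then have "h (s + of_int i * \<tau>) = - h (s + of_int (i - 1) * \<tau>)" by (simp only: h)
  then have "h (s + of_int (i - 1) * \<tau>) = - h (s + of_int i * \<tau>)" by simp
  then show ?case using step2 by auto
qed simp

text \<open>Chords in terms of the sum \<open>s\<close> and the difference \<open>d\<close> of \<open>a\<close> and \<open>b\<close>. All chords with the
  same \<open>s\<close> pass through the point \<open>(s / 2, 1 / 2)\<close> of the middle line.\<close>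

abbreviation sd_chord :: "real \<Rightarrow> real \<Rightarrow> real \<Rightarrow> real \<times> real" where
  "sd_chord s d \<equiv> chord ((s + d) / 2) ((s - d) / 2)"

lemma glide_sd_chord:
  "glide l k (sd_chord s d y) =
     sd_chord (s + of_int k * (2 * l)) (if even k then d else - d) (if even k then y else 1 - y)"
  by (auto simp: glide_def chord_def field_simps)

text \<open>By the Lipschitz condition both end points move weakly in the same direction, and at
  least one of them moves.\<close>

lemma chords_disjoint:
  assumes "\<bar>d - d'\<bar> \<le> \<bar>s - s'\<bar>" "s \<noteq> s'" "0 < y" "y < 1"
  shows "sd_chord s d y \<noteq> sd_chord s' d' y"
proof
  assume "sd_chord s d y = sd_chord s' d' y"
  then have *: "(1 - y) * (s - s' + (d - d')) + y * (s - s' - (d - d')) = 0"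
    by (simp add: chord_def field_simps)
  consider "s > s'" | "s < s'" using assms(2) by linarith
  then show False
  proof cases
    case 1
    then have "0 \<le> s - s' + (d - d')" "0 \<le> s - s' - (d - d')" using assms(1) by linarith+
    then have "0 \<le> (1 - y) * (s - s' + (d - d'))" "0 \<le> y * (s - s' - (d - d'))"
      using assms by (intro mult_nonneg_nonneg; simp)+
    then have "(1 - y) * (s - s' + (d - d')) = 0" "y * (s - s' - (d - d')) = 0" using * by linarith+
    then show False using 1 assms by simp
  next
    case 2
    then have "s - s' + (d - d') \<le> 0" "s - s' - (d - d') \<le> 0" using assms(1) by linarith+
    then have "(1 - y) * (s - s' + (d - d')) \<le> 0" "y * (s - s' - (d - d')) \<le> 0"
      using assms by (intro mult_nonneg_nonpos; simp)+
    then have "(1 - y) * (s - s' + (d - d')) = 0" "y * (s - s' - (d - d')) = 0" using * by linarith+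
    then show False using 2 assms by simp
  qed
qed

lemma coplanar_expansion:
  fixes e e' x :: "real ^ 3"
  assumes "e \<noteq> 0" "e' \<noteq> 0" "e \<bullet> e' = 0" "x \<bullet> cross3 e e' = 0"
  obtains \<alpha> \<beta> where "x = \<alpha> *\<^sub>R e + \<beta> *\<^sub>R e'"
proof
  define r where "r = x - ((x \<bullet> e) / (e \<bullet> e)) *\<^sub>R e - ((x \<bullet> e') / (e' \<bullet> e')) *\<^sub>R e'"
  let ?a = "(1 / norm e) *\<^sub>R e" and ?b = "(1 / norm e') *\<^sub>R e'"
  have "r \<bullet> e = 0" "r \<bullet> e' = 0"
    using assms by (simp_all add: r_def inner_diff_left inner_diff_right inner_commute)
  moreover have "r \<bullet> cross3 e e' = 0"
    using assms by (simp add: r_def inner_diff_left dot_cross_self)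
  then have "r \<bullet> cross3 ?a ?b = 0" by (simp add: cross_mult_left cross_mult_right)
  moreover have "?a \<bullet> ?a = 1" "?b \<bullet> ?b = 1"
    using assms by (simp_all add: dot_square_norm power2_eq_square)
  ultimately have "r = 0" using normal_line(1)[of ?a ?b r] assms by simp
  then show "x = ((x \<bullet> e) / (e \<bullet> e)) *\<^sub>R e + ((x \<bullet> e') / (e' \<bullet> e')) *\<^sub>R e'"
    by (simp add: r_def algebra_simps)
qed

context paper_strip
begin

text \<open>The chord given by the extension \<open>D\<close> is either a ruling or consists of flat points: a curved point on
  it lies on a ruling, which belongs to the same family and so is disjoint from the chord unless
  both are equal.\<close>

lemma straight_chord_family:
  obtains D where "\<And>s s'. \<bar>D s - D s'\<bar> \<le> \<bar>s - s'\<bar>" "\<And>s. D (s + 2 * l) = - D s"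
    "\<And>s y. 0 \<le> y \<Longrightarrow> y \<le> 1 \<Longrightarrow> f (sd_chord s (D s) y) =
       f ((s + D s) / 2, 0) + y *\<^sub>R (f ((s - D s) / 2, 1) - f ((s + D s) / 2, 0))"
    "\<And>s. (norm (f ((s - D s) / 2, 1) - f ((s + D s) / 2, 0)))\<^sup>2 = 1 + (D s)\<^sup>2"
proof -
  define Z where "Z = (\<lambda>(a, b). (a + b, a - b)) ` rulings"
  have Z: "(s + 2 * l, - d) \<in> Z \<and> (s - 2 * l, - d) \<in> Z" if sd: "(s, d) \<in> Z" for s d
  proof -
    obtain a b where ab: "(a, b) \<in> rulings" "s = a + b" "d = a - b" using sd by (auto simp: Z_def)
    have "(b + l, a + l) \<in> rulings" "(b + - l, a + - l) \<in> rulings"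
      using rulings_glide[OF ab(1)] by blast+
    then show ?thesis unfolding Z_def using ab(2,3) by (force simp: algebra_simps)
  qed
  have lip: "\<bar>d - d'\<bar> \<le> \<bar>s - s'\<bar>" if sd: "(s, d) \<in> Z" "(s', d') \<in> Z" for s d s' d'
  proof -
    obtain a b where ab: "(a, b) \<in> rulings" "s = a + b" "d = a - b" using sd by (auto simp: Z_def)
    obtain a' b' where ab': "(a', b') \<in> rulings" "s' = a' + b'" "d' = a' - b'"
      using sd by (auto simp: Z_def)
    show ?thesis using rulings_do_not_cross[OF ab(1) ab'(1)] ab ab' by simp
  qed
  obtain D where D: "\<And>s s'. \<bar>D s - D s'\<bar> \<le> \<bar>s - s'\<bar>" "\<And>s. D (s + 2 * l) = - D s"
    "\<And>s d. (s, d) \<in> Z \<Longrightarrow> D s = d"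
    using antiperiodic_lipschitz_extension[of Z "2 * l"] lip Z by metis
  have straight: "dirderiv ((s - D s) / 2 - (s + D s) / 2, 1) (dirderiv ((s - D s) / 2 - (s + D s) / 2, 1) f)
      (sd_chord s (D s) y) = 0" if y: "0 < y" "y < 1" for s y
  proof (cases "flat_at (sd_chord s (D s) y)")
    case True
    then show ?thesis by (simp add: flat_at_def)
  next
    case False
    let ?x = "sd_chord s (D s) y"
    obtain a b where ab: "(a, b) \<in> rulings" "?x = chord a b (snd ?x)"
      using ruling_through_curved_point[OF chord_in_interior_strip[OF y] False] by blast
    have "snd ?x = y" by (simp add: chord_def)
    then have x: "?x = chord a b y" using ab(2) by simp
    have "(a + b, a - b) \<in> Z" using ab(1) by (force simp: Z_def)
    then have Dab: "D (a + b) = a - b" by (rule D)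
    have "s = a + b"
      using chords_disjoint[OF D(1) _ y, of s "a + b"] x Dab by fastforce
    then have "(s + D s) / 2 = a" "(s - D s) / 2 = b" using Dab by simp_all
    then show ?thesis using ab(1) y by (simp add: rulings_def)
  qed
  show ?thesis
  proof (rule that[of D])
    show "f (sd_chord s (D s) y) =
       f ((s + D s) / 2, 0) + y *\<^sub>R (f ((s - D s) / 2, 1) - f ((s + D s) / 2, 0))"
      if "0 \<le> y" "y \<le> 1" for s y
      by (rule straight_chord(1)) (use straight that in auto)
    have "(norm (f ((s - D s) / 2, 1) - f ((s + D s) / 2, 0)))\<^sup>2 = 1 + ((s - D s) / 2 - (s + D s) / 2)\<^sup>2"
      for s by (rule straight_chord(2)) (use straight in auto)
    moreover have "((s - D s) / 2 - (s + D s) / 2)\<^sup>2 = (D s)\<^sup>2" for s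
      by (simp add: field_simps power2_eq_square)
    ultimately show "(norm (f ((s - D s) / 2, 1) - f ((s + D s) / 2, 0)))\<^sup>2 = 1 + (D s)\<^sup>2" for s
      by simp
  qed (use D in auto)
qed

text \<open>Take perpendicular coplanar bends from \<open>perpendicular_coplanar_pair\<close>, with edge vectors \<open>e s\<close> and
  midpoints \<open>m s\<close>, and write \<open>m s' - m s = \<alpha> e s + \<beta> e s'\<close>. If both coefficients were less
  than \<open>1 / 2\<close> in absolute value, the images would cross at interior points, and injectivity would force
  the two chords to be equivalent, hence parallel. So, up to exchanging the bends,
  \<open>1 / 2 \<le> \<bar>\<beta>\<bar>\<close>, and the end point of the second bend that is farther from the first line is at
  distance at least \<open>\<bar>e s'\<bar> \<ge> 1\<close>.\<close>

lemma T_pattern: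
  obtains a d c where "\<bar>d\<bar> \<le> l" "(norm (f (a + l - d, 0) - f (a, 0)))\<^sup>2 = 1 + d\<^sup>2"
    "\<And>r. 1 \<le> norm (f (c, 0) - (f (a, 0) + r *\<^sub>R (f (a + l - d, 0) - f (a, 0))))"
proof -
  note witness = that
  obtain D where D: "\<And>s s'. \<bar>D s - D s'\<bar> \<le> \<bar>s - s'\<bar>" "\<And>s. D (s + 2 * l) = - D s"
    and straight: "\<And>s y. 0 \<le> y \<Longrightarrow> y \<le> 1 \<Longrightarrow> f (sd_chord s (D s) y) =
       f ((s + D s) / 2, 0) + y *\<^sub>R (f ((s - D s) / 2, 1) - f ((s + D s) / 2, 0))"
    and len: "\<And>s. (norm (f ((s - D s) / 2, 1) - f ((s + D s) / 2, 0)))\<^sup>2 = 1 + (D s)\<^sup>2"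
    using straight_chord_family by blast
  define e where "e s = f ((s - D s) / 2, 1) - f ((s + D s) / 2, 0)" for s
  define m where "m s = f ((s + D s) / 2, 0) + (1 / 2) *\<^sub>R e s" for s
  have g1: "f (x, 1) = f (x + l, 0)" "f (x, 1) = f (x - l, 0)" for x
    using f_glide[of "(x, 1)" 1] f_glide[of "(x, 1)" "- 1"] by (simp_all add: glide_def strip_def)
  have g2: "f (x + l, 1) = f (x, 0)" for x using g1(2)[of "x + l"] by simp
  have half: "(s + 2 * l + - D s) / 2 = (s - D s) / 2 + l" "(s + 2 * l - - D s) / 2 = (s + D s) / 2 + l" for s
    by (simp_all add: field_simps)
  have e_shift: "e (s + 2 * l) = - e s" for s
    unfolding e_def D(2) half g2 g1(1)[symmetric] by simp
  have double: "e s = (1 / 2) *\<^sub>R e s + (1 / 2) *\<^sub>R e s" for s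
    by (simp flip: scaleR_add_left)
  have m_shift: "m (s + 2 * l) = m s" for s
  proof -
    have "m (s + 2 * l) = f ((s - D s) / 2, 1) - (1 / 2) *\<^sub>R e s"
      unfolding m_def e_shift D(2) half g1(1)[symmetric] by simp
    also have "\<dots> = f ((s + D s) / 2, 0) + e s - (1 / 2) *\<^sub>R e s" by (simp add: e_def)
    also have "\<dots> = m s" by (subst double) (simp add: m_def)
    finally show ?thesis .
  qed
  have e_ge: "1 \<le> e s \<bullet> e s" for s using len[of s] by (simp add: e_def power2_norm_eq_inner)
  have e0: "e s \<noteq> 0" for s using e_ge[of s] by auto
  have "1-lipschitz_on UNIV D" using D(1) by (intro lipschitz_onI) (auto simp: dist_real_def)
  then have contD: "continuous_on UNIV D" by (rule lipschitz_on_continuous_on)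
  have cont: "continuous_on UNIV (\<lambda>s. f ((s + D s) / 2, 0))" "continuous_on UNIV (\<lambda>s. f ((s - D s) / 2, 1))"
    by (rule continuous_on_compose2[OF continuous_on_strip];
        auto simp: strip_def intro!: continuous_intros contD)+
  have cont_e: "continuous_on UNIV e" unfolding e_def[abs_def] by (intro continuous_intros cont)
  have cont_m: "continuous_on UNIV m" unfolding m_def[abs_def] by (intro continuous_intros cont cont_e)
  obtain s s' where perp: "e s \<bullet> e s' = 0" and cop: "(m s - m s') \<bullet> cross3 (e s) (e s') = 0"
    by (rule perpendicular_coplanar_pair[of e m "2 * l"]) (use cont_e cont_m e_shift m_shift e0 in auto)
  have "(m s' - m s) \<bullet> cross3 (e s) (e s') = 0" using cop by (simp add: inner_diff_left)
  then obtain \<alpha> \<beta> where ab: "m s' - m s = \<alpha> *\<^sub>R e s + \<beta> *\<^sub>R e s'"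
    using coplanar_expansion[OF e0 e0 perp] by metis
  have on_chord: "f (sd_chord t (D t) (1 / 2 + r)) = m t + r *\<^sub>R e t" if "\<bar>r\<bar> < 1 / 2" for t r
    using straight[of "1 / 2 + r" t] that by (simp add: m_def e_def scaleR_add_left)
  have far: "1 / 2 \<le> \<bar>\<alpha>\<bar> \<or> 1 / 2 \<le> \<bar>\<beta>\<bar>"
  proof (rule ccontr)
    assume "\<not> ?thesis"
    then have small: "\<bar>\<alpha>\<bar> < 1 / 2" "\<bar>- \<beta>\<bar> < 1 / 2" by auto
    let ?p = "sd_chord s (D s) (1 / 2 + \<alpha>)" and ?q = "sd_chord s' (D s') (1 / 2 + - \<beta>)"
    have pq: "?p \<in> strip" "?q \<in> strip" using small by (auto simp: strip_def chord_def)
    have "m s + \<alpha> *\<^sub>R e s = m s' + (- \<beta>) *\<^sub>R e s'" using ab by (simp add: algebra_simps)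
    then have "f ?p = f ?q"
      using on_chord[OF small(1), of s] on_chord[OF small(2), of s'] by (simp only:)
    then obtain k where k: "?q = glide l k ?p" using f_eq_iff[OF pq] by blast
    \<comment> \<open>The glide maps the first chord to the chord of the family with parameter \<open>t\<close>.\<close>
    define t where "t = s + of_int k * (2 * l)"
    have Dt: "D t = (if even k then D s else - D s)"
      unfolding t_def by (rule antiperiodic_int) (rule D(2))
    have et: "e t = (if even k then e s else - e s)"
      unfolding t_def by (rule antiperiodic_int) (rule e_shift)
    define y where "y = 1 / 2 - \<beta>"
    have y: "0 < y" "y < 1" using small by (auto simp: y_def)
    have g: "glide l k ?p = sd_chord t (D t) (if even k then 1 / 2 + \<alpha> else 1 - (1 / 2 + \<alpha>))"
      unfolding glide_sd_chord Dt unfolding t_def ..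
    have "y = snd ?q" by (simp add: chord_def y_def)
    also have "\<dots> = (if even k then 1 / 2 + \<alpha> else 1 - (1 / 2 + \<alpha>))"
      unfolding k g by (simp add: chord_def)
    finally have "glide l k ?p = sd_chord t (D t) y" using g by simp
    then have "sd_chord s' (D s') y = sd_chord t (D t) y" using k by (simp add: y_def)
    then have "s' = t" using chords_disjoint[OF D(1) _ y, of s' t] by blast
    then have "e s' \<bullet> e s' = 0" using perp et by (auto split: if_splits)
    then show False using e0 by simp
  qed
  have conclude: thesis
    if perp: "e s \<bullet> e s' = 0" and ab: "m s' - m s = \<alpha> *\<^sub>R e s + \<beta> *\<^sub>R e s'" and \<beta>: "1 / 2 \<le> \<bar>\<beta>\<bar>"
    for s s' \<alpha> \<beta>
  proof -
    \<comment> \<open>The end point of the second bend on the side given by the sign of \<open>\<beta>\<close>.\<close>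
    define \<sigma> :: real where "\<sigma> = (if 0 \<le> \<beta> then 1 / 2 else - 1 / 2)"
    have \<sigma>: "1 \<le> (\<beta> + \<sigma>)\<^sup>2"
    proof -
      have "1 \<le> \<bar>\<beta> + \<sigma>\<bar>" using \<beta> by (auto simp: \<sigma>_def)
      then show ?thesis by (metis one_le_power power2_abs)
    qed
    have "\<exists>c. f (c, 0) = m s' + \<sigma> *\<^sub>R e s'"
    proof (cases "0 \<le> \<beta>")
      case True
      then have "m s' + \<sigma> *\<^sub>R e s' = f ((s' - D s') / 2, 1)"
        using double[of s'] by (simp add: \<sigma>_def m_def add.assoc) (simp add: e_def)
      then show ?thesis using g1(1) by metis
    next
      case False
      then have "m s' + \<sigma> *\<^sub>R e s' = f ((s' + D s') / 2, 0)"
        by (simp add: \<sigma>_def m_def e_def)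
      then show ?thesis by metis
    qed
    then obtain c where c: "f (c, 0) = m s' + \<sigma> *\<^sub>R e s'" by blast
    define a where "a = (s + D s) / 2"
    have al: "f (a + l - D s, 0) = f ((s - D s) / 2, 1)"
      using g1(1)[of "(s - D s) / 2"] by (simp add: a_def field_simps)
    then have es: "f (a + l - D s, 0) - f (a, 0) = e s" by (simp add: e_def a_def)
    have fa: "f (a, 0) = m s - (1 / 2) *\<^sub>R e s" by (simp add: m_def a_def)
    have "\<bar>D (s + 2 * l) - D s\<bar> \<le> 2 * l" using D(1)[of "s + 2 * l" s] l_pos by simp
    then have "\<bar>D s\<bar> \<le> l" using D(2)[of s] by linarith
    moreover have "(norm (f (a + l - D s, 0) - f (a, 0)))\<^sup>2 = 1 + (D s)\<^sup>2"
      using len[of s] by (simp add: es e_def)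
    moreover have "1 \<le> norm (f (c, 0) - (f (a, 0) + r *\<^sub>R (f (a + l - D s, 0) - f (a, 0))))" for r
    proof -
      let ?k = "\<alpha> + 1 / 2 - r"
      have n1: "f (c, 0) - (f (a, 0) + r *\<^sub>R e s) = ?k *\<^sub>R e s + (\<beta> + \<sigma>) *\<^sub>R e s'"
        using ab unfolding c fa by (simp add: algebra_simps)
      have n2: "(norm (?k *\<^sub>R e s + (\<beta> + \<sigma>) *\<^sub>R e s'))\<^sup>2 = ?k\<^sup>2 * (e s \<bullet> e s) + (\<beta> + \<sigma>)\<^sup>2 * (e s' \<bullet> e s')"
        using perp unfolding power2_norm_eq_inner
        by (simp add: inner_add_left inner_add_right inner_commute power2_eq_square)
      have "1 * 1 \<le> (\<beta> + \<sigma>)\<^sup>2 * (e s' \<bullet> e s')" using \<sigma> e_ge[of s'] by (intro mult_mono) auto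
      moreover have "0 \<le> ?k\<^sup>2 * (e s \<bullet> e s)" by simp
      ultimately have "0 + 1 * 1 \<le> (norm (f (c, 0) - (f (a, 0) + r *\<^sub>R e s)))\<^sup>2"
        unfolding n1 n2 by (intro add_mono)
      then have "1\<^sup>2 \<le> (norm (f (c, 0) - (f (a, 0) + r *\<^sub>R e s)))\<^sup>2" by simp
      then show ?thesis unfolding es by (rule power2_le_imp_le) simp
    qed
    ultimately show thesis by (rule witness[of "D s" a c])
  qed
  from far show thesis
  proof
    assume "1 / 2 \<le> \<bar>\<beta>\<bar>" then show thesis by (rule conclude[OF perp ab])
  next
    assume \<alpha>: "1 / 2 \<le> \<bar>\<alpha>\<bar>"
    show thesis
    proof (rule conclude[of s' s "- \<beta>" "- \<alpha>"])
      show "e s' \<bullet> e s = 0" using perp by (simp add: inner_commute)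
      have "m s - m s' = - (m s' - m s)" by simp
      then show "m s - m s' = (- \<beta>) *\<^sub>R e s' + (- \<alpha>) *\<^sub>R e s" unfolding ab by simp
    qed (use \<alpha> in simp)
  qed
qed

end


section \<open>Comparison with the equilateral triangle\<close>

text \<open>By Stewart's theorem the square of the left-hand distance is
  \<open>(1 - \<tau>) \<bar>X - P\<bar>\<^sup>2 + \<tau> \<bar>X - Q\<bar>\<^sup>2 - \<tau> (1 - \<tau>) \<bar>P - Q\<bar>\<^sup>2\<close>. Applied with \<open>X\<close> at
  the fraction \<open>\<tau>\<close> of an arc of length \<open>L\<close> from \<open>P\<close> to \<open>Q\<close>, this bounds the distance of
  corresponding points of the arc and its chord.\<close>

lemma distance_from_segment_point:
  fixes X P Q :: "'a::real_inner"
  assumes "norm (X - P) \<le> \<tau> * L" "norm (X - Q) \<le> (1 - \<tau>) * L" and \<tau>: "0 \<le> \<tau>" "\<tau> \<le> 1"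
    and PQ: "norm (P - Q) \<le> L"
  shows "(norm (X - ((1 - \<tau>) *\<^sub>R P + \<tau> *\<^sub>R Q)))\<^sup>2 \<le> (L\<^sup>2 - (norm (P - Q))\<^sup>2) / 4"
proof -
  define u v where "u = X - P" "v = X - Q"
  have 1: "X - ((1 - \<tau>) *\<^sub>R P + \<tau> *\<^sub>R Q) = (1 - \<tau>) *\<^sub>R u + \<tau> *\<^sub>R v" "P - Q = v - u"
    by (simp_all add: u_v_def algebra_simps)
  have id: "(norm ((1 - \<tau>) *\<^sub>R u + \<tau> *\<^sub>R v))\<^sup>2 =
      (1 - \<tau>) * (norm u)\<^sup>2 + \<tau> * (norm v)\<^sup>2 - \<tau> * (1 - \<tau>) * (norm (v - u))\<^sup>2"
    unfolding power2_norm_eq_inner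
    by (simp add: inner_add_left inner_add_right inner_diff_left inner_diff_right inner_commute[of v u])
      (simp add: algebra_simps)
  have uv: "(norm u)\<^sup>2 \<le> (\<tau> * L)\<^sup>2" "(norm v)\<^sup>2 \<le> ((1 - \<tau>) * L)\<^sup>2"
    using assms(1,2) by (simp_all add: u_v_def power_mono)
  have "(1 - \<tau>) * (norm u)\<^sup>2 + \<tau> * (norm v)\<^sup>2 \<le> (1 - \<tau>) * (\<tau> * L)\<^sup>2 + \<tau> * ((1 - \<tau>) * L)\<^sup>2"
    using \<tau> uv by (intro add_mono mult_left_mono) auto
  also have "\<dots> = \<tau> * (1 - \<tau>) * L\<^sup>2" by algebra
  finally have "(norm ((1 - \<tau>) *\<^sub>R u + \<tau> *\<^sub>R v))\<^sup>2 \<le> \<tau> * (1 - \<tau>) * (L\<^sup>2 - (norm (v - u))\<^sup>2)"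
    unfolding id by (simp add: right_diff_distrib)
  also have "\<dots> \<le> (1 / 4) * (L\<^sup>2 - (norm (v - u))\<^sup>2)"
  proof (rule mult_right_mono)
    have "0 \<le> (\<tau> - 1 / 2)\<^sup>2" by simp
    then show "\<tau> * (1 - \<tau>) \<le> 1 / 4" by (simp add: power2_eq_square algebra_simps)
    show "0 \<le> L\<^sup>2 - (norm (v - u))\<^sup>2"
      using PQ unfolding 1 by (simp add: power_mono)
  qed
  finally show ?thesis unfolding 1 by simp
qed

text \<open>The two error terms, from the arc to its chord and from the chord to the edge \<open>AB\<close> of the model
  triangle, are each at most \<open>sqrt \<mu>\<close>.\<close>

lemma arc_near_segment:
  fixes g :: "real \<Rightarrow> 'a::real_inner" and \<psi> :: "'a \<Rightarrow> 'b::real_inner"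
  assumes g: "\<And>x y. norm (g x - g y) \<le> \<bar>x - y\<bar>"
    and \<psi>: "\<And>x y. dist (\<psi> x) (\<psi> y) = dist x y"
      "\<And>x y \<tau>. \<psi> ((1 - \<tau>) *\<^sub>R x + \<tau> *\<^sub>R y) = (1 - \<tau>) *\<^sub>R \<psi> x + \<tau> *\<^sub>R \<psi> y"
    and xy: "x \<le> y" and \<tau>: "0 \<le> \<tau>" "\<tau> \<le> 1"
    and excess: "(y - x)\<^sup>2 - (norm (g x - g y))\<^sup>2 \<le> 2 * \<mu>"
    and A: "(norm (\<psi> (g x) - A))\<^sup>2 \<le> \<mu>" and B: "(norm (\<psi> (g y) - B))\<^sup>2 \<le> \<mu>"
  shows "norm (((1 - \<tau>) *\<^sub>R A + \<tau> *\<^sub>R B) - \<psi> (g (x + \<tau> * (y - x)))) \<le> 2 * sqrt \<mu>"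
proof -
  let ?X = "g (x + \<tau> * (y - x))" and ?S = "(1 - \<tau>) *\<^sub>R g x + \<tau> *\<^sub>R g y"
  have \<mu>: "0 \<le> \<mu>" using A by (meson order_trans zero_le_power2)
  have "\<bar>x + \<tau> * (y - x) - x\<bar> = \<tau> * (y - x)" using xy \<tau> by simp
  moreover have "x + \<tau> * (y - x) - y = - ((1 - \<tau>) * (y - x))" by (simp add: algebra_simps)
  then have "\<bar>x + \<tau> * (y - x) - y\<bar> = (1 - \<tau>) * (y - x)" using xy \<tau> by simp
  ultimately have 1: "norm (?X - g x) \<le> \<tau> * (y - x)" "norm (?X - g y) \<le> (1 - \<tau>) * (y - x)"
    using g[of "x + \<tau> * (y - x)" x] g[of "x + \<tau> * (y - x)" y] by (simp_all only:)
  have "norm (g x - g y) \<le> y - x" using g[of x y] xy by simp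
  from distance_from_segment_point[OF 1 \<tau> this]
  have "(norm (?X - ?S))\<^sup>2 \<le> \<mu>" using excess \<mu> by simp
  then have "norm (?X - ?S) \<le> sqrt \<mu>" by (rule real_le_rsqrt)
  then have 2: "norm (\<psi> ?S - \<psi> ?X) \<le> sqrt \<mu>"
    using \<psi>(1)[of ?S ?X] by (simp add: dist_norm norm_minus_commute)
  have 3: "norm (A - \<psi> (g x)) \<le> sqrt \<mu>" "norm (B - \<psi> (g y)) \<le> sqrt \<mu>"
    using A B real_le_rsqrt by (simp_all add: norm_minus_commute)
  have "norm ((1 - \<tau>) *\<^sub>R (A - \<psi> (g x)) + \<tau> *\<^sub>R (B - \<psi> (g y))) \<le> (1 - \<tau>) * sqrt \<mu> + \<tau> * sqrt \<mu>"
    using 3 \<tau> by (intro norm_triangle_mono) (simp_all add: mult_left_mono)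
  also have "\<dots> = sqrt \<mu>" by (simp add: algebra_simps)
  finally have 4: "norm (((1 - \<tau>) *\<^sub>R A + \<tau> *\<^sub>R B) - \<psi> ?S) \<le> sqrt \<mu>"
    unfolding \<psi>(2) by (simp add: algebra_simps)
  have "norm (((1 - \<tau>) *\<^sub>R A + \<tau> *\<^sub>R B) - \<psi> ?X) \<le> sqrt \<mu> + sqrt \<mu>"
    using norm_triangle_mono[OF 4 2] by simp
  then show ?thesis by simp
qed

lemma orthonormal_frame_parseval:
  fixes e n z :: "real ^ 3"
  assumes "e \<bullet> e = 1" "n \<bullet> n = 1" "e \<bullet> n = 0"
  shows "(norm z)\<^sup>2 = (z \<bullet> e)\<^sup>2 + (z \<bullet> n)\<^sup>2 + (z \<bullet> cross3 e n)\<^sup>2"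
proof -
  define r where "r = z - (z \<bullet> e) *\<^sub>R e - (z \<bullet> n) *\<^sub>R n"
  let ?k = "cross3 e n"
  have ne: "n \<bullet> e = 0" using assms(3) by (simp add: inner_commute)
  have r0: "r \<bullet> e = 0" "r \<bullet> n = 0"
    using assms ne by (simp_all add: r_def inner_diff_left)
  have rk: "r \<bullet> ?k = z \<bullet> ?k" by (simp add: r_def inner_diff_left dot_cross_self)
  have "r = (z \<bullet> ?k) *\<^sub>R ?k" using normal_line(1)[OF assms r0] rk by simp
  moreover have "norm ?k = 1" by (rule normal_line(2)[OF assms r0])
  ultimately have rr: "r \<bullet> r = (z \<bullet> ?k)\<^sup>2" by (simp add: power2_eq_square norm_eq_1)
  have "r \<bullet> r = z \<bullet> z - (z \<bullet> e)\<^sup>2 - (z \<bullet> n)\<^sup>2"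
    using assms ne unfolding r_def
    by (simp add: inner_diff_left inner_diff_right inner_commute[of e z] inner_commute[of n z]
        power2_eq_square)
  then show ?thesis using rr by (simp add: power2_norm_eq_inner)
qed

text \<open>The rigid motion that takes \<open>c\<close> to the midpoint \<open>(2 / sqrt 3, 1, 0)\<close> of the edge \<open>PQ\<close> of the model
  triangle, \<open>e\<close> to the direction from \<open>P\<close> to \<open>Q\<close>, and \<open>n\<close> to the direction from this midpoint to
  the vertex \<open>R\<close>.\<close>

definition frame_map :: "real ^ 3 \<Rightarrow> real ^ 3 \<Rightarrow> real ^ 3 \<Rightarrow> real ^ 3 \<Rightarrow> real ^ 3" where
  "frame_map c e n z = vector [2 / sqrt 3 + (z - c) \<bullet> e, 1 - (z - c) \<bullet> n, (z - c) \<bullet> cross3 e n]"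

lemma norm_real3: "(norm (z :: real ^ 3))\<^sup>2 = (z $ 1)\<^sup>2 + (z $ 2)\<^sup>2 + (z $ 3)\<^sup>2"
  unfolding power2_norm_eq_inner inner_vec_def sum_3 by (simp add: power2_eq_square)

lemma frame_map_isometry:
  assumes "e \<bullet> e = 1" "n \<bullet> n = 1" "e \<bullet> n = 0"
  shows "dist (frame_map c e n x) (frame_map c e n y) = dist x y"
proof -
  let ?d = "frame_map c e n x - frame_map c e n y"
  have "?d $ 1 = (x - y) \<bullet> e" "?d $ 2 = - ((x - y) \<bullet> n)" "?d $ 3 = (x - y) \<bullet> cross3 e n"
    by (simp_all add: frame_map_def inner_diff_left)
  then have "(norm ?d)\<^sup>2 = (norm (x - y))\<^sup>2"
    unfolding norm_real3[of ?d] orthonormal_frame_parseval[OF assms, of "x - y"]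
    by (simp only: power2_minus)
  then have "norm ?d = norm (x - y)" by (rule power2_eq_imp_eq) simp_all
  then show ?thesis by (simp only: dist_norm)
qed

lemma frame_map_affine:
  "frame_map c e n ((1 - \<tau>) *\<^sub>R x + \<tau> *\<^sub>R y) = (1 - \<tau>) *\<^sub>R frame_map c e n x + \<tau> *\<^sub>R frame_map c e n y"
  by (simp add: frame_map_def vec_eq_iff forall_3 inner_diff_left inner_add_left algebra_simps)

text \<open>Here \<open>r1\<close> and \<open>r2\<close> are the distances of the point \<open>(x, \<eta>)\<close> from the foci \<open>(- c, 0)\<close> and \<open>(c, 0)\<close>.
  The inequality is Minkowski's (reflect one focus in the line at height \<open>\<eta>\<close>); the identity is the
  equation of the ellipse, without division.\<close>

lemma sum_of_distances_to_foci:
  fixes x \<eta> c r1 r2 :: real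
  assumes r: "0 \<le> r1" "0 \<le> r2" "r1\<^sup>2 = (x + c)\<^sup>2 + \<eta>\<^sup>2" "r2\<^sup>2 = (x - c)\<^sup>2 + \<eta>\<^sup>2"
  shows "4 * (c\<^sup>2 + \<eta>\<^sup>2) \<le> (r1 + r2)\<^sup>2"
    "4 * x\<^sup>2 * ((r1 + r2)\<^sup>2 - 4 * c\<^sup>2) = (r1 + r2)\<^sup>2 * ((r1 + r2)\<^sup>2 - 4 * \<eta>\<^sup>2 - 4 * c\<^sup>2)"
proof -
  have "(c\<^sup>2 + \<eta>\<^sup>2 - x\<^sup>2)\<^sup>2 \<le> (c\<^sup>2 + \<eta>\<^sup>2 - x\<^sup>2)\<^sup>2 + (2 * x * \<eta>)\<^sup>2" by simp
  also have "\<dots> = r1\<^sup>2 * r2\<^sup>2" unfolding r by algebra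
  finally have "(c\<^sup>2 + \<eta>\<^sup>2 - x\<^sup>2)\<^sup>2 \<le> (r1 * r2)\<^sup>2" by (simp add: power_mult_distrib)
  then have "c\<^sup>2 + \<eta>\<^sup>2 - x\<^sup>2 \<le> r1 * r2" by (rule power2_le_imp_le) (use r in simp)
  moreover have "(r1 + r2)\<^sup>2 = 2 * x\<^sup>2 + 2 * c\<^sup>2 + 2 * \<eta>\<^sup>2 + 2 * (r1 * r2)"
    using r(3,4) by (simp add: power2_eq_square algebra_simps)
  ultimately show "4 * (c\<^sup>2 + \<eta>\<^sup>2) \<le> (r1 + r2)\<^sup>2" by simp
  define S T where "S = (r1 + r2)\<^sup>2" "T = (r1 - r2)\<^sup>2"
  have "(r1 + r2) * (r1 - r2) = 4 * x * c"
    using r(3,4) by (simp add: power2_eq_square algebra_simps)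
  then have "((r1 + r2) * (r1 - r2))\<^sup>2 = (4 * x * c)\<^sup>2" by simp
  then have 1: "S * T = 16 * x\<^sup>2 * c\<^sup>2" by (simp add: S_T_def power_mult_distrib)
  have 2: "T = 4 * x\<^sup>2 + 4 * c\<^sup>2 + 4 * \<eta>\<^sup>2 - S"
    using r(3,4) by (simp add: S_T_def power2_eq_square algebra_simps)
  have "4 * x\<^sup>2 * (S - 4 * c\<^sup>2) = S * (S - 4 * \<eta>\<^sup>2 - 4 * c\<^sup>2)"
    using 1 unfolding 2 by (simp add: algebra_simps)
  then show "4 * x\<^sup>2 * ((r1 + r2)\<^sup>2 - 4 * c\<^sup>2) = (r1 + r2)\<^sup>2 * ((r1 + r2)\<^sup>2 - 4 * \<eta>\<^sup>2 - 4 * c\<^sup>2)"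
    by (simp add: S_T_def)
qed

text \<open>The bounds on \<open>t\<close> confine \<open>t\<^sup>2\<close> to an interval around \<open>1 / 3\<close> of size proportional to \<open>\<mu>\<close>. The half
  sides \<open>b / 2\<close> and \<open>1 / sqrt 3\<close> have sum at least \<open>1\<close>, so their difference is bounded by the difference of
  their squares, \<open>(t\<^sup>2 - 1 / 3) / 4\<close>. As \<open>\<mu> \<le> 1\<close>, the resulting bound \<open>\<mu>\<^sup>2\<close> is at most \<open>\<mu>\<close>.\<close>

lemma base_estimate:
  fixes l t b :: real
  assumes l: "3 \<le> l\<^sup>2" "l\<^sup>2 \<le> 4" "0 < l" and t: "2 * l * t \<le> l\<^sup>2 - 1" "5 - l\<^sup>2 \<le> 2 * l * t"
    and b: "0 \<le> b" "b\<^sup>2 = 1 + t\<^sup>2"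
  shows "(b / 2 - 1 / sqrt 3)\<^sup>2 \<le> l\<^sup>2 - 3" "t\<^sup>2 \<le> 3"
proof -
  define \<mu> where "\<mu> = l\<^sup>2 - 3"
  have \<mu>: "0 \<le> \<mu>" "\<mu> \<le> 1" "l\<^sup>2 = 3 + \<mu>" using l by (auto simp: \<mu>_def)
  have up: "(2 * l * t)\<^sup>2 \<le> (2 + \<mu>)\<^sup>2" and lo: "(2 - \<mu>)\<^sup>2 \<le> (2 * l * t)\<^sup>2"
    using t \<mu> by (auto intro!: power_mono)
  have e: "(2 * l * t)\<^sup>2 = 4 * (3 + \<mu>) * t\<^sup>2" using \<mu>(3) by (simp add: power_mult_distrib)
  have m2: "\<mu> * \<mu> \<le> \<mu>" using \<mu> mult_left_le by blast
  have mt: "0 \<le> \<mu> * t\<^sup>2" using \<mu> by simp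
  have "12 * t\<^sup>2 \<le> 4 + 5 * \<mu>"
    using up e m2 mt by (simp add: power2_eq_square algebra_simps)
  then have t_up: "t\<^sup>2 - 1 / 3 \<le> \<mu> / 2" using \<mu> by simp
  then show "t\<^sup>2 \<le> 3" using \<mu> by simp
  have "\<mu> * t\<^sup>2 \<le> \<mu> * (5 / 6)" using t_up \<mu> by (intro mult_left_mono) auto
  moreover have "4 - 4 * \<mu> \<le> (2 - \<mu>)\<^sup>2" by (simp add: power2_eq_square algebra_simps)
  moreover have "4 * (3 + \<mu>) * t\<^sup>2 = 12 * t\<^sup>2 + 4 * (\<mu> * t\<^sup>2)" by (simp add: algebra_simps)
  ultimately have "4 - 4 * \<mu> \<le> 12 * t\<^sup>2 + 4 * (\<mu> * (5 / 6))" using lo e by linarith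
  then have t_lo: "- \<mu> \<le> t\<^sup>2 - 1 / 3" using \<mu> by simp
  define s where "s = 1 / sqrt 3"
  have s: "0 < s" "s\<^sup>2 = 1 / 3" by (simp_all add: s_def power_divide)
  have "1 / 2 \<le> s" by (rule power2_le_imp_le) (use s in \<open>simp_all add: power2_eq_square\<close>)
  moreover have "1 \<le> b" by (rule power2_le_imp_le) (use b in simp_all)
  ultimately have sum: "1 \<le> b / 2 + s" by simp
  have "(b / 2 - s) * (b / 2 + s) = b\<^sup>2 / 4 - s\<^sup>2"
    by (simp add: power2_eq_square algebra_simps)
  also have "\<dots> = (t\<^sup>2 - 1 / 3) / 4" unfolding b(2) s(2) by (simp add: field_simps)
  finally have eq: "(b / 2 - s) * (b / 2 + s) = (t\<^sup>2 - 1 / 3) / 4" .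
  have "\<bar>(b / 2 - s) * (b / 2 + s)\<bar> = \<bar>b / 2 - s\<bar> * (b / 2 + s)" using sum by (simp add: abs_mult)
  then have abs_eq: "\<bar>b / 2 - s\<bar> * (b / 2 + s) = \<bar>t\<^sup>2 - 1 / 3\<bar> / 4"
    unfolding eq by simp
  have "\<bar>b / 2 - s\<bar> * 1 \<le> \<bar>b / 2 - s\<bar> * (b / 2 + s)"
    using sum by (intro mult_left_mono) auto
  also have "\<dots> \<le> \<bar>t\<^sup>2 - 1 / 3\<bar>" unfolding abs_eq by simp
  also have "\<dots> \<le> \<mu>" using t_up t_lo \<mu> by linarith
  finally have "\<bar>b / 2 - s\<bar> \<le> \<mu>" by simp
  then have "(b / 2 - s)\<^sup>2 \<le> \<mu>\<^sup>2" by (metis abs_ge_zero power2_abs power_mono)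
  then show "(b / 2 - 1 / sqrt 3)\<^sup>2 \<le> l\<^sup>2 - 3" using m2 by (simp add: s_def \<mu>_def power2_eq_square)
qed

text \<open>Place the midpoint of \<open>PQ\<close> at the origin, so that \<open>w\<close> has coordinates \<open>(x, \<eta>)\<close> with \<open>1 \<le> \<eta>\<close>. The
  sum \<open>\<sigma>\<close> of the distances of \<open>w\<close> from \<open>P\<close> and \<open>Q\<close> is at least \<open>sqrt (5 + t\<^sup>2)\<close> and at most
  \<open>l + t\<close>; with the bound on the base this gives \<open>3 \<le> l\<^sup>2\<close>. The ellipse through \<open>w\<close> with foci \<open>P\<close>, \<open>Q\<close> is barely
  higher than \<open>1\<close>, so \<open>w\<close> must be close to its apex: \<open>x\<^sup>2 + \<eta>\<^sup>2 - 1 \<le> l\<^sup>2 - 3\<close>.\<close>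

lemma triangle_comparison:
  fixes P Q w :: "real ^ 3" and l t L2 L3 :: real
  assumes l: "0 < l" "l < 2" and base: "(norm (Q - P))\<^sup>2 = 1 + t\<^sup>2" "norm (Q - P) \<le> l - t"
    and height: "\<And>r. 1 \<le> norm (w - (P + r *\<^sub>R (Q - P)))"
    and sides: "norm (Q - w) \<le> L2" "norm (w - P) \<le> L3" "L2 + L3 = l + t"
  obtains \<psi> :: "real ^ 3 \<Rightarrow> real ^ 3" where "\<And>x y. dist (\<psi> x) (\<psi> y) = dist x y"
      "\<And>x y \<tau>. \<psi> ((1 - \<tau>) *\<^sub>R x + \<tau> *\<^sub>R y) = (1 - \<tau>) *\<^sub>R \<psi> x + \<tau> *\<^sub>R \<psi> y"
    and "(norm (\<psi> P - plane_inclusion vertex_P))\<^sup>2 \<le> l\<^sup>2 - 3"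
      "(norm (\<psi> Q - plane_inclusion vertex_Q))\<^sup>2 \<le> l\<^sup>2 - 3"
      "(norm (\<psi> w - plane_inclusion vertex_R))\<^sup>2 \<le> l\<^sup>2 - 3"
    and "(l - t)\<^sup>2 - (norm (P - Q))\<^sup>2 \<le> 2 * (l\<^sup>2 - 3)"
      "L2\<^sup>2 - (norm (Q - w))\<^sup>2 \<le> 2 * (l\<^sup>2 - 3)"
      "L3\<^sup>2 - (norm (w - P))\<^sup>2 \<le> 2 * (l\<^sup>2 - 3)"
proof -
  define b where "b = norm (Q - P)"
  have b2: "b\<^sup>2 = 1 + t\<^sup>2" using base by (simp add: b_def)
  then have b0: "0 < b" unfolding b_def by (metis add_pos_nonneg norm_ge_zero order_le_less
        power_zero_numeral zero_le_power2 zero_less_one less_irrefl)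
  define e where "e = (1 / b) *\<^sub>R (Q - P)"
  have ee: "e \<bullet> e = 1" using b0 by (simp add: e_def b_def dot_square_norm power2_eq_square)
  define c where "c = (1 / 2) *\<^sub>R (P + Q)"
  define x where "x = (w - c) \<bullet> e"
  define p where "p = w - c - x *\<^sub>R e"
  define \<eta> where "\<eta> = norm p"
  define n where "n = (1 / \<eta>) *\<^sub>R p"
  have QP: "Q - P = b *\<^sub>R e" using b0 by (simp add: e_def)
  have cP: "P = c - (b / 2) *\<^sub>R e" and cQ: "Q = c + (b / 2) *\<^sub>R e"
  proof -
    have "(b / 2) *\<^sub>R e = (1 / 2) *\<^sub>R (Q - P)" using b0 by (simp add: e_def)
    then show "P = c - (b / 2) *\<^sub>R e" "Q = c + (b / 2) *\<^sub>R e"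
      by (simp_all add: c_def scaleR_diff_right scaleR_add_right)
  qed
  have "w - (P + (1 / 2 + x / b) *\<^sub>R (Q - P)) = p"
  proof -
    have "(1 / 2 + x / b) *\<^sub>R (Q - P) = (b / 2 + x) *\<^sub>R e"
      unfolding QP using b0 by (simp add: distrib_right)
    then show ?thesis by (simp only: p_def) (subst cP, simp add: algebra_simps)
  qed
  then have \<eta>: "1 \<le> \<eta>" using height[of "1 / 2 + x / b"] by (simp add: \<eta>_def)
  have pe: "p \<bullet> e = 0" using ee by (simp add: p_def x_def inner_diff_left)
  have "p \<noteq> 0" using \<eta> by (auto simp: \<eta>_def)
  then have nn: "n \<bullet> n = 1" and en: "e \<bullet> n = 0"
    using pe by (simp_all add: n_def \<eta>_def dot_square_norm power2_eq_square inner_commute)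
  have w: "w = c + x *\<^sub>R e + \<eta> *\<^sub>R n"
    using \<eta> by (simp add: n_def p_def)
  define r1 r2 where "r1 = norm (w - P)" "r2 = norm (Q - w)"
  have nrm: "(norm (i *\<^sub>R e + j *\<^sub>R n))\<^sup>2 = i\<^sup>2 + j\<^sup>2" for i j
    using ee nn en unfolding power2_norm_eq_inner
    by (simp add: inner_add_left inner_add_right inner_commute power2_eq_square)
  have "w - P = (x + b / 2) *\<^sub>R e + \<eta> *\<^sub>R n" "Q - w = (- (x - b / 2)) *\<^sub>R e + (- \<eta>) *\<^sub>R n"
    unfolding w cP cQ by (simp_all add: algebra_simps)
  then have r12: "r1\<^sup>2 = (x + b / 2)\<^sup>2 + \<eta>\<^sup>2" "r2\<^sup>2 = (x - b / 2)\<^sup>2 + \<eta>\<^sup>2"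
    unfolding r1_r2_def by (simp_all only: nrm power2_minus)
  have r0: "0 \<le> r1" "0 \<le> r2" by (simp_all add: r1_r2_def)
  define \<sigma> where "\<sigma> = r1 + r2"
  have \<sigma>0: "0 \<le> \<sigma>" using r0 by (simp add: \<sigma>_def)
  have b4: "4 * (b / 2)\<^sup>2 = 1 + t\<^sup>2" using b2 by (simp add: power_divide)
  have \<eta>2: "1 \<le> \<eta>\<^sup>2" using \<eta> by simp
  have \<sigma>2: "1 + t\<^sup>2 + 4 * \<eta>\<^sup>2 \<le> \<sigma>\<^sup>2"
    and ell: "4 * x\<^sup>2 * (\<sigma>\<^sup>2 - (1 + t\<^sup>2)) = \<sigma>\<^sup>2 * (\<sigma>\<^sup>2 - 4 * \<eta>\<^sup>2 - (1 + t\<^sup>2))"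
    using sum_of_distances_to_foci[OF r0 r12] b4 by (simp_all add: \<sigma>_def)
  have \<sigma>l: "\<sigma> \<le> l + t" using sides by (simp add: \<sigma>_def r1_r2_def)
  have "b\<^sup>2 \<le> (l - t)\<^sup>2" using base(2) b0 by (intro power_mono) (auto simp: b_def)
  then have t1: "2 * l * t \<le> l\<^sup>2 - 1" using b2 by (simp add: power2_eq_square algebra_simps)
  have \<sigma>l2: "\<sigma>\<^sup>2 \<le> (l + t)\<^sup>2" using \<sigma>l \<sigma>0 by (intro power_mono) auto
  have lt2: "(l + t)\<^sup>2 = l\<^sup>2 + 2 * l * t + t\<^sup>2" "(l - t)\<^sup>2 = l\<^sup>2 - 2 * l * t + t\<^sup>2"
    by (simp_all add: power2_eq_square algebra_simps)
  have t2: "5 - l\<^sup>2 \<le> 2 * l * t" using \<sigma>2 \<eta>2 \<sigma>l2 lt2 by linarith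
  have l3: "3 \<le> l\<^sup>2" using t1 t2 by linarith
  have "l\<^sup>2 \<le> 2\<^sup>2" using l by (intro power_mono) auto
  then have l4: "l\<^sup>2 \<le> 4" by simp
  have est: "(b / 2 - 1 / sqrt 3)\<^sup>2 \<le> l\<^sup>2 - 3" "t\<^sup>2 \<le> 3"
    by (rule base_estimate[OF l3 l4 l(1) t1 t2]; use b0 b2 in simp)+
  \<comment> \<open>In terms of \<open>V\<close> the equation of the ellipse is \<open>4 x\<^sup>2 V = \<sigma>\<^sup>2 (V - 4 \<eta>\<^sup>2)\<close>,
    and \<open>t\<^sup>2 \<le> 3\<close> makes \<open>\<sigma>\<^sup>2 \<le> 2 V\<close>.\<close>
  define V where "V = \<sigma>\<^sup>2 - (1 + t\<^sup>2)"
  have V: "4 * \<eta>\<^sup>2 \<le> V" "V \<le> 4 + 2 * (l\<^sup>2 - 3)"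
    using \<sigma>2 \<sigma>l2 lt2 t1 by (simp_all add: V_def)
  have "\<sigma>\<^sup>2 = V + (1 + t\<^sup>2)" by (simp add: V_def)
  then have "\<sigma>\<^sup>2 \<le> 2 * V" using est(2) V(1) \<eta>2 by linarith
  then have "\<sigma>\<^sup>2 * (V - 4 * \<eta>\<^sup>2) \<le> 2 * V * (V - 4 * \<eta>\<^sup>2)" using V by (intro mult_right_mono) auto
  moreover have "4 * x\<^sup>2 * V = \<sigma>\<^sup>2 * (V - 4 * \<eta>\<^sup>2)" using ell by (simp add: V_def algebra_simps)
  ultimately have "V * (4 * x\<^sup>2) \<le> V * (2 * (V - 4 * \<eta>\<^sup>2))" by (simp add: algebra_simps)
  moreover have "0 < V" using V(1) \<eta>2 by linarith
  ultimately have "4 * x\<^sup>2 \<le> 2 * (V - 4 * \<eta>\<^sup>2)" by (simp only: mult_le_cancel_left_pos)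
  then have x2: "x\<^sup>2 + \<eta>\<^sup>2 - 1 \<le> l\<^sup>2 - 3" using V(2) \<eta>2 by argo
  have "(1 - \<eta>)\<^sup>2 \<le> \<eta>\<^sup>2 - 1" using \<eta> by (simp add: power2_eq_square algebra_simps)
  then have apex: "x\<^sup>2 + (1 - \<eta>)\<^sup>2 \<le> l\<^sup>2 - 3" using x2 by linarith
  have cross0: "e \<bullet> cross3 e n = 0" "n \<bullet> cross3 e n = 0" by (simp_all add: dot_cross_self)
  have ne: "n \<bullet> e = 0" using en by (simp add: inner_commute)
  define s where "s = 1 / sqrt 3"
  have s3: "2 / sqrt 3 = 2 * s" "sqrt 3 = 3 * s" "1 / sqrt 3 = s"
    by (simp_all add: s_def real_div_sqrt)
  have side: "K\<^sup>2 - k\<^sup>2 \<le> 2 * (l\<^sup>2 - 3)"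
    if "0 \<le> k" "k \<le> K" "K - k \<le> (l + t) - \<sigma>" "K + k \<le> (l + t) + \<sigma>" for K k
  proof -
    have "(K - k) * (K + k) \<le> ((l + t) - \<sigma>) * ((l + t) + \<sigma>)"
      using that by (intro mult_mono) auto
    then have "K\<^sup>2 - k\<^sup>2 \<le> (l + t)\<^sup>2 - \<sigma>\<^sup>2" by (simp add: power2_eq_square algebra_simps)
    then show ?thesis using lt2(1) \<sigma>2 \<eta>2 t1 by argo
  qed
  show ?thesis
  proof (rule that[of "frame_map c e n"])
    show "dist (frame_map c e n x) (frame_map c e n y) = dist x y" for x y
      by (rule frame_map_isometry[OF ee nn en])
    show "frame_map c e n ((1 - \<tau>) *\<^sub>R x + \<tau> *\<^sub>R y) = (1 - \<tau>) *\<^sub>R frame_map c e n x + \<tau> *\<^sub>R frame_map c e n y"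
      for x y \<tau> by (rule frame_map_affine)
    have "(norm (frame_map c e n P - plane_inclusion vertex_P))\<^sup>2 = (b / 2 - s)\<^sup>2"
      unfolding norm_real3 cP frame_map_def plane_inclusion_def vertex_P_def s3(1,3)
      by (simp add: ee en cross0 ne)
        (simp add: power2_eq_square algebra_simps)
    then show "(norm (frame_map c e n P - plane_inclusion vertex_P))\<^sup>2 \<le> l\<^sup>2 - 3"
      using est(1) unfolding s3(3) by simp
    have "(norm (frame_map c e n Q - plane_inclusion vertex_Q))\<^sup>2 = (b / 2 - s)\<^sup>2"
      unfolding norm_real3 cQ frame_map_def plane_inclusion_def vertex_Q_def s3(1)
      unfolding s3(2) by (simp add: ee en cross0 ne)
    then show "(norm (frame_map c e n Q - plane_inclusion vertex_Q))\<^sup>2 \<le> l\<^sup>2 - 3"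
      using est(1) unfolding s3(3) by simp
    have "(norm (frame_map c e n w - plane_inclusion vertex_R))\<^sup>2 = x\<^sup>2 + (1 - \<eta>)\<^sup>2"
      unfolding norm_real3 w frame_map_def plane_inclusion_def vertex_R_def
      by (simp add: ee en ne nn cross0 inner_add_left)
    then show "(norm (frame_map c e n w - plane_inclusion vertex_R))\<^sup>2 \<le> l\<^sup>2 - 3"
      using apex by simp
    show "(l - t)\<^sup>2 - (norm (P - Q))\<^sup>2 \<le> 2 * (l\<^sup>2 - 3)"
      using base(1) t2 lt2 by (simp add: norm_minus_commute)
    show "L2\<^sup>2 - (norm (Q - w))\<^sup>2 \<le> 2 * (l\<^sup>2 - 3)" "L3\<^sup>2 - (norm (w - P))\<^sup>2 \<le> 2 * (l\<^sup>2 - 3)"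
      using sides by (intro side; simp add: \<sigma>_def r1_r2_def; smt (verit) norm_ge_zero)+
  qed
qed


section \<open>The boundary circle\<close>

abbreviation bottom_point :: "real \<Rightarrow> real \<Rightarrow> band_point" where
  "bottom_point l u \<equiv> moebius_class l (u, 0)"

abbreviation boundary_topology :: "real \<Rightarrow> band_point topology" where
  "boundary_topology l \<equiv> subtopology (moebius_topology l) (moebius_boundary l)"

lemma moebius_class_top: "moebius_class l (x, 1) = bottom_point l (x + l)"
  unfolding moebius_class_eq_iff by (rule exI[of _ 1]) (simp add: glide_def)

text \<open>An odd glide moves the point to the other side of the strip, so only even ones count, and the boundary
  is a circle of length \<open>2 l\<close>.\<close>

lemma bottom_point_eq_iff:
  "bottom_point l u = bottom_point l v \<longleftrightarrow> (\<exists>k::int. v = u + of_int k * (2 * l))"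
proof
  assume "bottom_point l u = bottom_point l v"
  then obtain k where k: "(v, 0) = glide l k (u, 0)" unfolding moebius_class_eq_iff ..
  then have "even k" by (auto simp: glide_def split: if_splits)
  then obtain j where "k = 2 * j" by (elim evenE)
  then have "v = u + of_int j * (2 * l)" using k by (simp add: glide_def)
  then show "\<exists>k::int. v = u + of_int k * (2 * l)" ..
next
  assume "\<exists>k::int. v = u + of_int k * (2 * l)"
  then obtain k :: int where "v = u + of_int k * (2 * l)" ..
  then have "(v, 0) = glide l (2 * k) (u, 0)" by (simp add: glide_def)
  then show "bottom_point l u = bottom_point l v" unfolding moebius_class_eq_iff ..
qed

lemma bottom_point_reduce:
  assumes "0 < l"
  obtains v where "a \<le> v" "v < a + 2 * l" "bottom_point l u = bottom_point l v"
proof -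
  define k where "k = \<lfloor>(u - a) / (2 * l)\<rfloor>"
  define v where "v = u + of_int (- k) * (2 * l)"
  have "of_int k \<le> (u - a) / (2 * l)" "(u - a) / (2 * l) < of_int k + 1"
    unfolding k_def by linarith+
  then have "of_int k * (2 * l) \<le> u - a" "u - a < (of_int k + 1) * (2 * l)"
    using assms by (simp_all add: field_simps)
  then have "a \<le> v" "v < a + 2 * l" by (simp_all add: v_def algebra_simps)
  moreover have "bottom_point l u = bottom_point l v"
    unfolding bottom_point_eq_iff v_def by blast
  ultimately show ?thesis using that by blast
qed

lemma moebius_boundary_eq: "moebius_boundary l = range (bottom_point l)"
proof
  show "moebius_boundary l \<subseteq> range (bottom_point l)"
    unfolding moebius_boundary_def using moebius_class_top by auto
  show "range (bottom_point l) \<subseteq> moebius_boundary l"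
    unfolding moebius_boundary_def by auto
qed

lemma topspace_boundary: "topspace (boundary_topology l) = moebius_boundary l"
proof -
  have "moebius_boundary l \<subseteq> moebius l"
    unfolding moebius_boundary_def moebius_def strip_def by auto
  then show ?thesis by (simp add: topspace_moebius_topology Int_absorb1)
qed

lemma boundary_arc_surj:
  assumes "0 < l"
  shows "bottom_point l ` {0..2 * l} = moebius_boundary l"
proof -
  have "bottom_point l u \<in> bottom_point l ` {0..2 * l}" for u
    using bottom_point_reduce[OF assms, of 0 u] by (smt (verit) atLeastAtMost_iff image_eqI)
  then show ?thesis unfolding moebius_boundary_eq by auto
qed

lemma continuous_bottom_point:
  assumes "continuous_on S h"
  shows "continuous_map (top_of_set S) (boundary_topology l) (\<lambda>u. bottom_point l (h u))"
proof (rule continuous_map_into_subtopology)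
  have "continuous_map (top_of_set S) (top_of_set strip) (\<lambda>u. (h u, 0))"
    using assms by (auto simp: strip_def continuous_on_Pair)
  from continuous_map_compose[OF this quotient_imp_continuous_map[OF quotient_map_moebius_class]]
  show "continuous_map (top_of_set S) (moebius_topology l) (\<lambda>u. bottom_point l (h u))"
    by (simp add: o_def)
qed (auto simp: moebius_boundary_eq)

text \<open>The map \<open>(x, y) \<mapsto> (1 - 2 y) cis (\<pi> x / l)\<close> is invariant under the glide, because both factors
  change their sign. On the boundary it is injective: it identifies the circle with the unit circle.\<close>

lemma Hausdorff_boundary:
  assumes l: "0 < l"
  shows "Hausdorff_space (boundary_topology l)"
proof -
  define G where "G p = (1 - 2 * snd p) *\<^sub>R cis (pi * fst p / l)" for p :: "real \<times> real"
  have G1: "G (glide l k p) = G p" for k p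
  proof -
    have "cis (pi * (fst p + of_int k * l) / l) = cis (pi * fst p / l) * cis (of_int k * pi)"
      using l by (simp add: cis_mult field_simps)
    moreover have "cis (of_int k * pi) = (if even k then 1 else - 1)"
      by (auto simp: complex_eq_iff elim!: evenE oddE simp: algebra_simps sin_add cos_add)
    ultimately show ?thesis by (auto simp: G_def glide_def simp flip: scaleR_minus_left)
  qed
  have contG: "continuous_map (top_of_set strip) euclidean G"
    using l unfolding G_def by (auto intro!: continuous_intros)
  have invG: "G p = G q" if eq: "moebius_class l p = moebius_class l q" for p q
  proof -
    obtain k where "q = glide l k p" using eq unfolding moebius_class_eq_iff ..
    then show ?thesis by (simp only: G1)
  qed
  obtain g where g: "continuous_map (moebius_topology l) euclidean g"
    "\<And>p. p \<in> strip \<Longrightarrow> g (moebius_class l p) = G p"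
  proof (rule quotient_map_lift_exists[OF quotient_map_moebius_class contG])
    fix g assume "continuous_map (moebius_topology l) euclidean g"
      "\<And>p. p \<in> topspace (top_of_set strip) \<Longrightarrow> g (moebius_class l p) = G p"
    then show thesis by (intro that) simp_all
  qed (rule invG)
  show ?thesis
  proof (rule Hausdorff_space_injective_preimage)
    show "Hausdorff_space (euclidean :: complex topology)" by simp
    show "continuous_map (boundary_topology l) euclidean g"
      using g(1) by (rule continuous_map_from_subtopology)
    show "inj_on g (topspace (boundary_topology l))"
      unfolding topspace_boundary
    proof (rule inj_onI)
      fix c d assume "c \<in> moebius_boundary l" "d \<in> moebius_boundary l" and eq: "g c = g d"
      then obtain u v where uv: "c = bottom_point l u" "d = bottom_point l v"
        unfolding moebius_boundary_eq by auto
      then have "cis (pi * u / l) = cis (pi * v / l)"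
        using eq g(2)[of "(u, 0)"] g(2)[of "(v, 0)"] by (simp add: strip_def G_def)
      then have "exp (\<i> * of_real (pi * v / l)) = exp (\<i> * of_real (pi * u / l))"
        by (simp only: cis_conv_exp)
      then obtain n :: int where "\<i> * of_real (pi * v / l) =
          \<i> * of_real (pi * u / l) + (of_int (2 * n) * pi) * \<i>"
        unfolding exp_eq by blast
      then have "Im (\<i> * of_real (pi * v / l)) =
          Im (\<i> * of_real (pi * u / l) + (of_int (2 * n) * pi) * \<i>)" by (rule arg_cong)
      then have "pi * v / l = pi * u / l + of_int (2 * n) * pi" by simp
      then have "pi * v = pi * (u + of_int n * (2 * l))" using l by (simp add: field_simps)
      then have "v = u + of_int n * (2 * l)" by (metis mult_cancel_left pi_neq_zero)
      then show "c = d" unfolding uv bottom_point_eq_iff by blast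
    qed
  qed
qed

lemma bottom_point_eq_arc:
  assumes "0 < l" "a \<le> u" "u \<le> a + 2 * l" "a \<le> v" "v \<le> a + 2 * l" "bottom_point l u = bottom_point l v"
  shows "u = v \<or> (u = a \<and> v = a + 2 * l) \<or> (u = a + 2 * l \<and> v = a)"
proof -
  obtain k :: int where k: "v = u + of_int k * (2 * l)"
    using assms(6) unfolding bottom_point_eq_iff ..
  have "of_int k * (2 * l) \<le> 1 * (2 * l)" "(- 1) * (2 * l) \<le> of_int k * (2 * l)"
    using assms k by linarith+
  then have "of_int k \<le> (1::real)" "- 1 \<le> (of_int k :: real)"
    using assms(1) by (simp_all only: mult_le_cancel_right)
  then have "k = 0 \<or> k = 1 \<or> k = - 1" by linarith
  then show ?thesis using k assms(2-5) by auto
qed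

text \<open>An increasing map of parameter intervals that is compatible with the identification of the end points
  descends to the circles, since a closed interval maps onto the circle by a quotient map.\<close>

lemma boundary_homeomorphism:
  assumes kl: "0 < k" "0 < l" and H: "continuous_on {0..2 * k} H" "strict_mono_on {0..2 * k} H"
    "H (2 * k) = H 0 + 2 * l"
  obtains \<phi> where "homeomorphic_map (boundary_topology k) (boundary_topology l) \<phi>"
    "\<And>u. 0 \<le> u \<Longrightarrow> u \<le> 2 * k \<Longrightarrow> \<phi> (bottom_point k u) = bottom_point l (H u)"
proof -
  let ?S = "{0..2 * k}"
  have cm: "continuous_map (top_of_set ?S) (boundary_topology k) (bottom_point k)"
    using continuous_bottom_point[OF continuous_on_id, of ?S k] by simp
  have S: "compact_space (top_of_set ?S)" by (simp add: compact_space_subtopology)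
  have surj: "bottom_point k ` topspace (top_of_set ?S) = topspace (boundary_topology k)"
    using boundary_arc_surj[OF kl(1)]
    by (simp only: topspace_boundary topspace_euclidean_subtopology)
  have q: "quotient_map (top_of_set ?S) (boundary_topology k) (bottom_point k)"
    by (rule continuous_imp_quotient_map[OF cm S Hausdorff_boundary[OF kl(1)] surj])
  have "compactin (boundary_topology k) (bottom_point k ` topspace (top_of_set ?S))"
    using S cm unfolding compact_space_def by (rule image_compactin)
  then have comp: "compact_space (boundary_topology k)" unfolding surj compact_space_def .
  have ends: "bottom_point l (H (2 * k)) = bottom_point l (H 0)"
    unfolding H(3) bottom_point_eq_iff by (rule exI[of _ "- 1"]) simp
  have "bottom_point l (H u) = bottom_point l (H v)"
    if "u \<in> topspace (top_of_set ?S)" "v \<in> topspace (top_of_set ?S)" "bottom_point k u = bottom_point k v"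
    for u v
    using bottom_point_eq_arc[OF kl(1), of 0 u v] that ends by auto
  then obtain \<phi> where \<phi>: "continuous_map (boundary_topology k) (boundary_topology l) \<phi>"
    "\<phi> ` topspace (boundary_topology k) = (\<lambda>u. bottom_point l (H u)) ` topspace (top_of_set ?S)"
    "\<And>u. u \<in> topspace (top_of_set ?S) \<Longrightarrow> \<phi> (bottom_point k u) = bottom_point l (H u)"
    using quotient_map_lift_exists[OF q continuous_bottom_point[OF H(1), of l]] by metis
  have strict: "H u < H v" if "0 \<le> u" "u < v" "v \<le> 2 * k" for u v
    using that by (intro strict_mono_onD[OF H(2)]) auto
  have mono: "H u \<le> H v" if "0 \<le> u" "u \<le> v" "v \<le> 2 * k" for u v
    using strict[of u v] that by (cases "u = v") auto
  have H_inj: "u = v" if "0 \<le> u" "u \<le> 2 * k" "0 \<le> v" "v \<le> 2 * k" "H u = H v" for u v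
    using strict[of u v] strict[of v u] that by (cases u v rule: linorder_cases) auto
  have "homeomorphic_map (boundary_topology k) (boundary_topology l) \<phi>"
  proof (rule continuous_imp_homeomorphic_map[OF \<phi>(1) comp Hausdorff_boundary[OF kl(2)]])
    have "bottom_point l v \<in> (\<lambda>u. bottom_point l (H u)) ` ?S" for v
    proof -
      obtain w where w: "H 0 \<le> w" "w < H 0 + 2 * l" "bottom_point l v = bottom_point l w"
        using bottom_point_reduce[OF kl(2)] by blast
      have "w \<le> H (2 * k)" using w(2) H(3) by simp
      then obtain u where "0 \<le> u" "u \<le> 2 * k" "H u = w"
        using IVT'[of H 0 w "2 * k"] w(1) kl H(1) by auto
      then show ?thesis unfolding w(3) by auto
    qed
    then have "(\<lambda>u. bottom_point l (H u)) ` ?S = range (bottom_point l)" by auto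
    then show "\<phi> ` topspace (boundary_topology k) = topspace (boundary_topology l)"
      unfolding \<phi>(2) unfolding topspace_boundary topspace_euclidean_subtopology
      unfolding moebius_boundary_eq .
    show "inj_on \<phi> (topspace (boundary_topology k))"
    proof (rule inj_onI)
      fix c d assume "c \<in> topspace (boundary_topology k)" "d \<in> topspace (boundary_topology k)"
        and eq: "\<phi> c = \<phi> d"
      then obtain u v where uv: "u \<in> ?S" "v \<in> ?S" "c = bottom_point k u" "d = bottom_point k v"
        unfolding surj[symmetric] by auto
      then have "bottom_point l (H u) = bottom_point l (H v)" using eq \<phi>(3) by simp
      moreover have "H 0 \<le> H u" "H u \<le> H 0 + 2 * l" "H 0 \<le> H v" "H v \<le> H 0 + 2 * l"
        using mono[of 0 u] mono[of u "2 * k"] mono[of 0 v] mono[of v "2 * k"] uv(1,2) H(3) by auto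
      ultimately have "H u = H v \<or> (H u = H 0 \<and> H v = H (2 * k)) \<or> (H u = H (2 * k) \<and> H v = H 0)"
        using bottom_point_eq_arc[OF kl(2), of "H 0" "H u" "H v"] H(3) by auto
      then have "u = v \<or> (u = 0 \<and> v = 2 * k) \<or> (u = 2 * k \<and> v = 0)"
        using H_inj[of u v] H_inj[of u 0] H_inj[of u "2 * k"] H_inj[of v 0] H_inj[of v "2 * k"] uv(1,2) kl
        by auto
      moreover have "bottom_point k 0 = bottom_point k (2 * k)"
        unfolding bottom_point_eq_iff by (rule exI[of _ 1]) simp
      ultimately show "c = d" unfolding uv by auto
    qed
  qed
  then show ?thesis by (rule that) (use \<phi>(3) in simp)
qed

text \<open>The boundary circle runs once around the triangle with constant speed, in the order \<open>Q\<close>, \<open>R\<close>, \<open>P\<close>,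
  \<open>Q\<close>: the two halves of the long side of the trapezoid are reflected to \<open>QR\<close> and \<open>RP\<close>, and the
  short side is \<open>PQ\<close> itself.\<close>

lemma triangular_map_bottom:
  assumes \<tau>: "0 \<le> \<tau>" "\<tau> \<le> 1"
  shows "triangular_map (bottom_point (sqrt 3) (2 / sqrt 3 * \<tau>)) =
      (1 - \<tau>) *\<^sub>R plane_inclusion vertex_Q + \<tau> *\<^sub>R plane_inclusion vertex_R" (is ?QR)
    "triangular_map (bottom_point (sqrt 3) (2 / sqrt 3 + 2 / sqrt 3 * \<tau>)) =
      (1 - \<tau>) *\<^sub>R plane_inclusion vertex_R + \<tau> *\<^sub>R plane_inclusion vertex_P" (is ?RP)
    "triangular_map (bottom_point (sqrt 3) (4 / sqrt 3 + 2 / sqrt 3 * \<tau>)) =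
      (1 - \<tau>) *\<^sub>R plane_inclusion vertex_P + \<tau> *\<^sub>R plane_inclusion vertex_Q" (is ?PQ)
proof -
  define s where "s = 1 / sqrt 3"
  have s: "2 / sqrt 3 = 2 * s" "4 / sqrt 3 = 4 * s" "1 / sqrt 3 = s" "sqrt 3 = 3 * s" "3 * s * s = 1"
    by (simp_all add: s_def real_div_sqrt)
  have ss: "s * (s * x) = x / 3" for x using s(5) by (simp flip: mult.assoc)
  have incl: "(1 - \<tau>) *\<^sub>R plane_inclusion p + \<tau> *\<^sub>R plane_inclusion q =
      plane_inclusion ((1 - \<tau>) *\<^sub>R p + \<tau> *\<^sub>R q)" for p q
    by (simp add: plane_inclusion_def vec_eq_iff forall_3)
  show ?QR
  proof -
    have "triangular_fold (2 * s * \<tau>, 0) = (1 - \<tau>) *\<^sub>R vertex_Q + \<tau> *\<^sub>R vertex_R"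
    proof (cases "\<tau> = 1")
      case True
      then show ?thesis
        unfolding triangular_fold_def middle_triangle_eq unfolding vertex_R_def s(1)
        unfolding s(4) using s(5) by simp
    next
      case False
      then show ?thesis
        unfolding triangular_fold_def middle_triangle_eq left_triangle_eq reflect_line_PR
        unfolding vertex_R_def vertex_Q_def s(1,3)
        unfolding s(4)
        using \<tau> s(5) by (simp add: ss) (simp add: algebra_simps ss)
    qed
    moreover have "(2 * s * \<tau>, 0) \<in> trapezoid"
      unfolding trapezoid_eq s(4) using \<tau> s(5) by (simp add: ss)
    ultimately show ?thesis unfolding incl s(1) by (simp add: triangular_map_eq)
  qed
  show ?RP
  proof -
    have "triangular_fold (2 * s + 2 * s * \<tau>, 0) = (1 - \<tau>) *\<^sub>R vertex_R + \<tau> *\<^sub>R vertex_P"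
    proof (cases "\<tau> = 0")
      case True
      then show ?thesis
        unfolding triangular_fold_def middle_triangle_eq unfolding vertex_R_def s(1)
        unfolding s(4) using s(5) by simp
    next
      case False
      then show ?thesis
        unfolding triangular_fold_def middle_triangle_eq left_triangle_eq reflect_line_QR
        unfolding vertex_R_def vertex_P_def s(1,3)
        unfolding s(4)
        using \<tau> s(5) by (simp add: ss) (simp add: algebra_simps ss)
    qed
    moreover have "(2 * s + 2 * s * \<tau>, 0) \<in> trapezoid"
      unfolding trapezoid_eq s(4) using \<tau> s(5) by (simp add: algebra_simps ss)
    ultimately show ?thesis unfolding incl s(1) by (simp add: triangular_map_eq)
  qed
  show ?PQ
  proof -
    have "triangular_fold (s + 2 * s * \<tau>, 1) = (1 - \<tau>) *\<^sub>R vertex_P + \<tau> *\<^sub>R vertex_Q"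
      unfolding triangular_fold_def middle_triangle_eq
      unfolding vertex_P_def vertex_Q_def s(3)
      unfolding s(4)
      using \<tau> s(5) by (simp add: algebra_simps ss)
    moreover have "(s + 2 * s * \<tau>, 1) \<in> trapezoid"
      unfolding trapezoid_eq s(4) using \<tau> s(5) by (simp add: algebra_simps ss)
    moreover have "bottom_point (sqrt 3) (4 * s + 2 * s * \<tau>) = moebius_class (sqrt 3) (s + 2 * s * \<tau>, 1)"
      unfolding moebius_class_top by (simp add: s(4) algebra_simps)
    ultimately show ?thesis unfolding incl s(1,2) by (simp add: triangular_map_eq)
  qed
qed


section \<open>The boundary is close to the triangle\<close>

text \<open>In a T-pattern the far point \<open>c\<close> may lie on either of the two arcs between the ends of the bend, and
  \<open>triangle_comparison\<close> needs it on the arc of length \<open>l + d\<close>. Otherwise read the bend in the opposite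
  direction, which exchanges the arcs and replaces \<open>d\<close> by \<open>- d\<close>.\<close>

lemma (in paper_strip) boundary_near_triangle:
  assumes l2: "l < 2"
  obtains \<psi> q w p where "\<And>x y. dist (\<psi> x) (\<psi> y) = dist x y" "q < w" "w < p" "p < q + 2 * l"
    "\<And>\<tau>. 0 \<le> \<tau> \<Longrightarrow> \<tau> \<le> 1 \<Longrightarrow>
      norm (((1 - \<tau>) *\<^sub>R plane_inclusion vertex_Q + \<tau> *\<^sub>R plane_inclusion vertex_R)
        - \<psi> (f (q + \<tau> * (w - q), 0))) \<le> 2 * sqrt (l\<^sup>2 - 3)"
    "\<And>\<tau>. 0 \<le> \<tau> \<Longrightarrow> \<tau> \<le> 1 \<Longrightarrow>
      norm (((1 - \<tau>) *\<^sub>R plane_inclusion vertex_R + \<tau> *\<^sub>R plane_inclusion vertex_P)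
        - \<psi> (f (w + \<tau> * (p - w), 0))) \<le> 2 * sqrt (l\<^sup>2 - 3)"
    "\<And>\<tau>. 0 \<le> \<tau> \<Longrightarrow> \<tau> \<le> 1 \<Longrightarrow>
      norm (((1 - \<tau>) *\<^sub>R plane_inclusion vertex_P + \<tau> *\<^sub>R plane_inclusion vertex_Q)
        - \<psi> (f (p + \<tau> * (q + 2 * l - p), 0))) \<le> 2 * sqrt (l\<^sup>2 - 3)"
proof -
  note witness = that
  define g where "g u = f (u, 0)" for u
  have g_lip: "norm (g x - g y) \<le> \<bar>x - y\<bar>" for x y
    using lipschitz[of "(x, 0)" "(y, 0)"] by (simp add: g_def strip_def norm_Pair)
  have g_per: "g (u + of_int k * (2 * l)) = g u" for u k
  proof -
    have "glide l (2 * k) (u, 0) = (u + of_int k * (2 * l), 0)" by (simp add: glide_def)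
    then show ?thesis using f_glide[of "(u, 0)" "2 * k"] by (simp add: g_def strip_def)
  qed
  have g_per1: "g (u + 2 * l) = g u" for u using g_per[of u 1] by simp
  obtain a d c where T: "(norm (g (a + l - d) - g a))\<^sup>2 = 1 + d\<^sup>2"
    "\<And>r. 1 \<le> norm (g c - (g a + r *\<^sub>R (g (a + l - d) - g a)))" "a + l - d \<le> c" "c \<le> a + 2 * l"
    "\<bar>d\<bar> \<le> l"
  proof -
    obtain a d c where T: "\<bar>d\<bar> \<le> l" "(norm (g (a + l - d) - g a))\<^sup>2 = 1 + d\<^sup>2"
      "\<And>r. 1 \<le> norm (g c - (g a + r *\<^sub>R (g (a + l - d) - g a)))"
    proof (rule T_pattern[folded g_def])
      fix a d c assume "\<bar>d\<bar> \<le> l" "(norm (g (a + l - d) - g a))\<^sup>2 = 1 + d\<^sup>2"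
        "\<And>r. 1 \<le> norm (g c - (g a + r *\<^sub>R (g (a + l - d) - g a)))"
      then show thesis by (rule that)
    qed
    define k where "k = \<lfloor>(c - a) / (2 * l)\<rfloor>"
    \<comment> \<open>The parameter of the far point, moved by a multiple of the period into \<open>[a, a + 2 l]\<close>.\<close>
    define c' where "c' = c + of_int (- k) * (2 * l)"
    have "of_int k \<le> (c - a) / (2 * l)" "(c - a) / (2 * l) < of_int k + 1"
      unfolding k_def by linarith+
    then have "of_int k * (2 * l) \<le> c - a" "c - a < (of_int k + 1) * (2 * l)"
      using l_pos by (simp_all add: field_simps)
    then have c': "a \<le> c'" "c' \<le> a + 2 * l" by (simp_all add: c'_def algebra_simps)
    have gc: "g c' = g c" unfolding c'_def by (rule g_per)
    show thesis
    proof (cases "a + l - d \<le> c'")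
      case True
      then show thesis using that[of a d c'] T c' gc by simp
    next
      case False
      define a2 where "a2 = a + l - d"
      have e: "a2 + l - - d = a + 2 * l" by (simp add: a2_def)
      have swap: "g (a2 + l - - d) = g a" unfolding e by (rule g_per1)
      show thesis
      proof (rule that[of a2 "- d" "c' + 2 * l"])
        show "(norm (g (a2 + l - - d) - g a2))\<^sup>2 = 1 + (- d)\<^sup>2"
          using T(2) unfolding swap by (simp add: a2_def norm_minus_commute)
        show "1 \<le> norm (g (c' + 2 * l) - (g a2 + r *\<^sub>R (g (a2 + l - - d) - g a2)))" for r
        proof -
          have "g a2 + r *\<^sub>R (g a - g a2) = g a + (1 - r) *\<^sub>R (g a2 - g a)"
            by (simp add: algebra_simps)
          then show ?thesis using T(3)[of "1 - r"] unfolding swap g_per1 gc by (simp add: a2_def)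
        qed
        show "a2 + l - - d \<le> c' + 2 * l" unfolding e using c'(1) by simp
        show "c' + 2 * l \<le> a2 + 2 * l" using False by (simp add: a2_def)
        show "\<bar>- d\<bar> \<le> l" using T(1) by simp
      qed
    qed
  qed
  define q p where "q = a + l - d" "p = a + 2 * l"
  have gp: "g p = g a" unfolding q_p_def by (rule g_per1)
  have len: "norm (g q - g p) \<le> l - d"
  proof -
    have "q + 2 * l - p = l - d" by (simp add: q_p_def)
    then have "norm (g (q + 2 * l) - g p) \<le> l - d" using g_lip[of "q + 2 * l" p] T(5) by simp
    then show ?thesis by (simp only: g_per1)
  qed
  have sides: "norm (g q - g c) \<le> c - q" "norm (g c - g p) \<le> p - c"
    using g_lip[of q c] g_lip[of c p] T(3,4) by (simp_all add: q_p_def)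
  have base: "(norm (g q - g p))\<^sup>2 = 1 + d\<^sup>2" using T(1) unfolding gp by (simp add: q_p_def)
  have height: "1 \<le> norm (g c - (g p + r *\<^sub>R (g q - g p)))" for r
    using T(2)[of r] unfolding gp by (simp add: q_p_def)
  have total: "(c - q) + (p - c) = l + d" by (simp add: q_p_def)
  have qc: "q < c" and cp: "c < p"
    using height[of 1] height[of 0] sides by (simp_all add: norm_minus_commute)
  have "1\<^sup>2 \<le> (norm (g q - g p))\<^sup>2" using base by simp
  then have "1 \<le> norm (g q - g p)" by (rule power2_le_imp_le) simp
  then have pq: "p < q + 2 * l" using len by (simp add: q_p_def)
  have last: "q + 2 * l - p = l - d" by (simp add: q_p_def)
  obtain \<psi> where \<psi>: "\<And>x y. dist (\<psi> x) (\<psi> y) = dist x y"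
      "\<And>x y \<tau>. \<psi> ((1 - \<tau>) *\<^sub>R x + \<tau> *\<^sub>R y) = (1 - \<tau>) *\<^sub>R \<psi> x + \<tau> *\<^sub>R \<psi> y"
    and V: "(norm (\<psi> (g p) - plane_inclusion vertex_P))\<^sup>2 \<le> l\<^sup>2 - 3"
      "(norm (\<psi> (g q) - plane_inclusion vertex_Q))\<^sup>2 \<le> l\<^sup>2 - 3"
      "(norm (\<psi> (g c) - plane_inclusion vertex_R))\<^sup>2 \<le> l\<^sup>2 - 3"
    and E: "(l - d)\<^sup>2 - (norm (g p - g q))\<^sup>2 \<le> 2 * (l\<^sup>2 - 3)"
      "(c - q)\<^sup>2 - (norm (g q - g c))\<^sup>2 \<le> 2 * (l\<^sup>2 - 3)"
      "(p - c)\<^sup>2 - (norm (g c - g p))\<^sup>2 \<le> 2 * (l\<^sup>2 - 3)"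
    using triangle_comparison[OF l_pos l2 base len height sides total] by metis
  show thesis
  proof (rule witness[OF \<psi>(1) qc cp pq])
    fix \<tau> :: real assume \<tau>: "0 \<le> \<tau>" "\<tau> \<le> 1"
    show "norm (((1 - \<tau>) *\<^sub>R plane_inclusion vertex_Q + \<tau> *\<^sub>R plane_inclusion vertex_R)
        - \<psi> (f (q + \<tau> * (c - q), 0))) \<le> 2 * sqrt (l\<^sup>2 - 3)"
      using arc_near_segment[OF g_lip \<psi> less_imp_le[OF qc] \<tau> E(2) V(2,3)] by (simp add: g_def)
    show "norm (((1 - \<tau>) *\<^sub>R plane_inclusion vertex_R + \<tau> *\<^sub>R plane_inclusion vertex_P)
        - \<psi> (f (c + \<tau> * (p - c), 0))) \<le> 2 * sqrt (l\<^sup>2 - 3)"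
      using arc_near_segment[OF g_lip \<psi> less_imp_le[OF cp] \<tau> E(3) V(3,1)] by (simp add: g_def)
    have E1: "(q + 2 * l - p)\<^sup>2 - (norm (g p - g (q + 2 * l)))\<^sup>2 \<le> 2 * (l\<^sup>2 - 3)"
      using E(1) unfolding last g_per1 .
    have V2: "(norm (\<psi> (g (q + 2 * l)) - plane_inclusion vertex_Q))\<^sup>2 \<le> l\<^sup>2 - 3"
      using V(2) unfolding g_per1 .
    show "norm (((1 - \<tau>) *\<^sub>R plane_inclusion vertex_P + \<tau> *\<^sub>R plane_inclusion vertex_Q)
        - \<psi> (f (p + \<tau> * (q + 2 * l - p), 0))) \<le> 2 * sqrt (l\<^sup>2 - 3)"
      using arc_near_segment[OF g_lip \<psi> less_imp_le[OF pq] \<tau> E1 V(1) V2] by (simp add: g_def)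
  qed
qed

text \<open>The map that is affine on each of the intervals \<open>[0, r]\<close>, \<open>[r, 2 r]\<close>, \<open>[2 r, 3 r]\<close> and has the values
  \<open>a\<close>, \<open>b\<close>, \<open>c\<close>, \<open>d\<close> at their end points. Minima and maxima instead of cases make its continuity
  evident.\<close>

definition three_piece :: "real \<Rightarrow> real \<Rightarrow> real \<Rightarrow> real \<Rightarrow> real \<Rightarrow> real \<Rightarrow> real" where
  "three_piece r a b c d u = a + (b - a) / r * min u r + (c - b) / r * max 0 (min (u - r) r)
     + (d - c) / r * max 0 (u - 2 * r)"

lemma three_piece_values:
  assumes "0 < r" "0 \<le> \<tau>" "\<tau> \<le> 1"
  shows "three_piece r a b c d (r * \<tau>) = a + \<tau> * (b - a)"
    "three_piece r a b c d (r + r * \<tau>) = b + \<tau> * (c - b)"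
    "three_piece r a b c d (2 * r + r * \<tau>) = c + \<tau> * (d - c)"
proof -
  have "0 \<le> r * \<tau>" "r * \<tau> \<le> r" using assms mult_left_le[of \<tau> r] by simp_all
  then have "min (r * \<tau>) r = r * \<tau>" "max 0 (min (r * \<tau> - r) r) = 0" "max 0 (r * \<tau> - 2 * r) = 0"
    "min (r + r * \<tau>) r = r" "max 0 (min (r + r * \<tau> - r) r) = r * \<tau>" "max 0 (r + r * \<tau> - 2 * r) = 0"
    "min (2 * r + r * \<tau>) r = r" "max 0 (min (2 * r + r * \<tau> - r) r) = r"
    "max 0 (2 * r + r * \<tau> - 2 * r) = r * \<tau>"
    by (auto simp: min_def max_def)
  then show "three_piece r a b c d (r * \<tau>) = a + \<tau> * (b - a)"
    "three_piece r a b c d (r + r * \<tau>) = b + \<tau> * (c - b)"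
    "three_piece r a b c d (2 * r + r * \<tau>) = c + \<tau> * (d - c)"
    using assms(1) unfolding three_piece_def by (simp_all add: mult.commute)
qed

lemma strict_mono_three_piece:
  assumes "0 < r" "a < b" "b < c" "c < d"
  shows "strict_mono_on S (three_piece r a b c d)"
proof (rule strict_mono_onI)
  fix u v :: real assume "u < v"
  define x y z where "x = (b - a) / r" "y = (c - b) / r" "z = (d - c) / r"
  have pos: "0 < x" "0 < y" "0 < z" using assms by (simp_all add: x_y_z_def)
  define m1 m2 m3 :: "real \<Rightarrow> real" where "m1 t = min t r" "m2 t = max 0 (min (t - r) r)"
    "m3 t = max 0 (t - 2 * r)" for t
  have le: "m1 u \<le> m1 v" "m2 u \<le> m2 v" "m3 u \<le> m3 v"
    using \<open>u < v\<close> by (auto simp: m1_m2_m3_def min_def max_def)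
  have "m1 u < m1 v \<or> m2 u < m2 v \<or> m3 u < m3 v"
    using \<open>u < v\<close> assms(1) by (auto simp: m1_m2_m3_def min_def max_def)
  moreover have "x * m1 u \<le> x * m1 v" "y * m2 u \<le> y * m2 v" "z * m3 u \<le> z * m3 v"
    using le pos by simp_all
  moreover have "m1 u < m1 v \<Longrightarrow> x * m1 u < x * m1 v" "m2 u < m2 v \<Longrightarrow> y * m2 u < y * m2 v"
    "m3 u < m3 v \<Longrightarrow> z * m3 u < z * m3 v"
    using pos by simp_all
  ultimately have "x * m1 u + y * m2 u + z * m3 u < x * m1 v + y * m2 v + z * m3 v" by linarith
  then show "three_piece r a b c d u < three_piece r a b c d v"
    by (simp add: three_piece_def x_y_z_def m1_m2_m3_def)
qed

lemma continuous_three_piece: "continuous_on S (three_piece r a b c d)"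
  unfolding three_piece_def[abs_def] by (intro continuous_intros)

lemma paper_strip_of_band:
  assumes "0 < l" "paper_moebius_band l I"
  shows "paper_strip l (I \<circ> moebius_class l)"
proof
  show "0 < l" by (rule assms)
  show "smooth strip (I \<circ> moebius_class l)" "riemannian_isometric strip (I \<circ> moebius_class l)"
    using assms(2) by (simp_all add: paper_moebius_band_def)
  have "inj_on I (moebius l)"
    using assms(2) homeomorphic_imp_injective_map
    unfolding paper_moebius_band_def embedding_map_def topspace_moebius_topology[symmetric] by blast
  then show "(I \<circ> moebius_class l) p = (I \<circ> moebius_class l) q \<longleftrightarrow> (\<exists>k. q = glide l k p)"
    if "p \<in> strip" "q \<in> strip" for p q
    using that unfolding moebius_class_eq_iff[symmetric] by (auto simp: moebius_def inj_on_eq_iff)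
qed

text \<open>With \<open>sqrt 3 < 7 / 4\<close> and \<open>\<epsilon> < 1 / 4\<close>, \<open>(sqrt 3 + \<epsilon>)\<^sup>2 = 3 + \<epsilon> (2 sqrt 3 + \<epsilon>) < 3 + 4 \<epsilon>\<close>, which
  bounds the error \<open>2 sqrt (l\<^sup>2 - 3)\<close> by \<open>4 sqrt \<epsilon>\<close>. The homeomorphism is affine from each edge of the
  triangle to the corresponding arc of the boundary.\<close>

theorem theorem1p1:
  fixes \<epsilon> l :: real and I :: "band_point \<Rightarrow> real ^ 3"
  assumes "0 < \<epsilon>" "\<epsilon> < 1 / 4"
    and "0 < l" "l < sqrt 3 + \<epsilon>"
    and "paper_moebius_band l I"
  shows "\<exists>\<phi> (\<psi> :: real ^ 3 \<Rightarrow> real ^ 3).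
    homeomorphic_map (subtopology (moebius_topology (sqrt 3)) (moebius_boundary (sqrt 3)))
      (subtopology (moebius_topology l) (moebius_boundary l)) \<phi> \<and>
    (\<forall>x y. dist (\<psi> x) (\<psi> y) = dist x y) \<and>
    (SUP p \<in> moebius_boundary (sqrt 3). ereal (norm (triangular_map p - \<psi> (I (\<phi> p)))))
      < ereal (6 * sqrt \<epsilon>)"
proof -
  interpret paper_strip l "I \<circ> moebius_class l" by (rule paper_strip_of_band[OF assms(3,5)])
  have "sqrt 3 < sqrt ((7 / 4)\<^sup>2)" unfolding real_sqrt_less_iff by (simp add: power2_eq_square)
  then have s3: "sqrt 3 < 7 / 4" by simp
  then have l2: "l < 2" using assms(2,4) by linarith
  have "l\<^sup>2 < (sqrt 3 + \<epsilon>)\<^sup>2" using assms(3,4) by (intro power_strict_mono) auto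
  also have "\<dots> = 3 + \<epsilon> * (2 * sqrt 3 + \<epsilon>)" by (simp add: power2_eq_square algebra_simps)
  also have "\<dots> \<le> 3 + \<epsilon> * 4"
    using s3 assms(1,2) by (intro add_left_mono mult_left_mono) auto
  finally have "sqrt (l\<^sup>2 - 3) \<le> sqrt (\<epsilon> * 4)" by simp
  then have bound: "2 * sqrt (l\<^sup>2 - 3) \<le> 4 * sqrt \<epsilon>" by (simp add: real_sqrt_mult)
  obtain \<psi> q w p where \<psi>: "\<And>x y. dist (\<psi> x) (\<psi> y) = dist x y"
    and ord: "q < w" "w < p" "p < q + 2 * l"
    and QR: "\<And>\<tau>. 0 \<le> \<tau> \<Longrightarrow> \<tau> \<le> 1 \<Longrightarrow>
      norm (((1 - \<tau>) *\<^sub>R plane_inclusion vertex_Q + \<tau> *\<^sub>R plane_inclusion vertex_R)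
        - \<psi> ((I \<circ> moebius_class l) (q + \<tau> * (w - q), 0))) \<le> 2 * sqrt (l\<^sup>2 - 3)"
    and RP: "\<And>\<tau>. 0 \<le> \<tau> \<Longrightarrow> \<tau> \<le> 1 \<Longrightarrow>
      norm (((1 - \<tau>) *\<^sub>R plane_inclusion vertex_R + \<tau> *\<^sub>R plane_inclusion vertex_P)
        - \<psi> ((I \<circ> moebius_class l) (w + \<tau> * (p - w), 0))) \<le> 2 * sqrt (l\<^sup>2 - 3)"
    and PQ: "\<And>\<tau>. 0 \<le> \<tau> \<Longrightarrow> \<tau> \<le> 1 \<Longrightarrow>
      norm (((1 - \<tau>) *\<^sub>R plane_inclusion vertex_P + \<tau> *\<^sub>R plane_inclusion vertex_Q)
        - \<psi> ((I \<circ> moebius_class l) (p + \<tau> * (q + 2 * l - p), 0))) \<le> 2 * sqrt (l\<^sup>2 - 3)"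
    using boundary_near_triangle[OF l2] by metis
  define r where "r = 2 / sqrt 3"
  have r: "0 < r" "4 / sqrt 3 = 2 * r" "2 * sqrt 3 = 3 * r"
    by (simp_all add: r_def field_simps)
  define H where "H = three_piece r q w p (q + 2 * l)"
  note H_values = three_piece_values[OF r(1), of _ q w p "q + 2 * l", folded H_def]
  have "H (2 * sqrt 3) = H 0 + 2 * l"
    using H_values(1)[of 0] H_values(3)[of 1] by (simp add: r(3))
  then obtain \<phi> where \<phi>: "homeomorphic_map (boundary_topology (sqrt 3)) (boundary_topology l) \<phi>"
    "\<And>u. 0 \<le> u \<Longrightarrow> u \<le> 2 * sqrt 3 \<Longrightarrow> \<phi> (bottom_point (sqrt 3) u) = bottom_point l (H u)"
    using boundary_homeomorphism[of "sqrt 3" l H] assms(3)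
      continuous_three_piece strict_mono_three_piece[OF r(1) ord] unfolding H_def by auto
  have close: "norm (triangular_map (bottom_point (sqrt 3) u) - \<psi> (I (\<phi> (bottom_point (sqrt 3) u))))
      \<le> 2 * sqrt (l\<^sup>2 - 3)" if u: "0 \<le> u" "u \<le> 2 * sqrt 3" for u
  proof -
    note tri = triangular_map_bottom[folded r_def, unfolded r(2)]
    consider "u \<le> r" | "r \<le> u" "u \<le> 2 * r" | "2 * r \<le> u" by linarith
    then show ?thesis
    proof cases
      case 1
      define \<tau> where "\<tau> = u / r"
      have \<tau>: "0 \<le> \<tau>" "\<tau> \<le> 1" "u = r * \<tau>" using 1 u r(1) by (simp_all add: \<tau>_def)
      show ?thesis unfolding \<phi>(2)[OF u] unfolding \<tau>(3) tri(1)[OF \<tau>(1,2)] H_values(1)[OF \<tau>(1,2)]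
        using QR[OF \<tau>(1,2)] by simp
    next
      case 2
      define \<tau> where "\<tau> = (u - r) / r"
      have \<tau>: "0 \<le> \<tau>" "\<tau> \<le> 1" "u = r + r * \<tau>" using 2 r(1) by (simp_all add: \<tau>_def)
      show ?thesis unfolding \<phi>(2)[OF u] unfolding \<tau>(3) tri(2)[OF \<tau>(1,2)] H_values(2)[OF \<tau>(1,2)]
        using RP[OF \<tau>(1,2)] by simp
    next
      case 3
      define \<tau> where "\<tau> = (u - 2 * r) / r"
      have \<tau>: "0 \<le> \<tau>" "\<tau> \<le> 1" "u = 2 * r + r * \<tau>" using 3 u r by (simp_all add: \<tau>_def)
      show ?thesis unfolding \<phi>(2)[OF u] unfolding \<tau>(3) tri(3)[OF \<tau>(1,2)] H_values(3)[OF \<tau>(1,2)]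
        using PQ[OF \<tau>(1,2)] by simp
    qed
  qed
  have "(SUP c \<in> moebius_boundary (sqrt 3). ereal (norm (triangular_map c - \<psi> (I (\<phi> c)))))
      \<le> ereal (2 * sqrt (l\<^sup>2 - 3))"
  proof (rule SUP_least)
    fix c assume "c \<in> moebius_boundary (sqrt 3)"
    then have "c \<in> bottom_point (sqrt 3) ` {0..2 * sqrt 3}"
      using boundary_arc_surj[of "sqrt 3"] by simp
    then obtain u where "c = bottom_point (sqrt 3) u" "0 \<le> u" "u \<le> 2 * sqrt 3" by auto
    then show "ereal (norm (triangular_map c - \<psi> (I (\<phi> c)))) \<le> ereal (2 * sqrt (l\<^sup>2 - 3))"
      using close by simp
  qed
  also have "\<dots> \<le> ereal (4 * sqrt \<epsilon>)" using bound by simp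
  also have "\<dots> < ereal (6 * sqrt \<epsilon>)" using assms(1) by simp
  finally show ?thesis using \<phi>(1) \<psi> by blast
qed

end
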